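(* Let $\Omega\subset\mathbb{R}^3$ be an open set and let $f\in C^\infty(\Omega,\mathbb{R})$. Let $\mathcal{G}_1,\mathcal{G}_2,\mathcal{G}_3$ and $\mathcal{Z}_{3,f}$ be as defined in the context. Let $A_1,A_2,A_3\subset\mathbb{R}$ be compact sets with $\dim_H A_i>0$ for each $i$ and $A_1\times A_2\times A_3\subset\Omega\setminus\mathcal{Z}_{3,f}$. Let $\Delta_f(A_1,A_2,A_3)=f(A_1\times A_2\times A_3)$. (i) If $0<u<1$ and $\sum_{i=1}^3\dim_H A_i>1+u$, then $\dim_H\Delta_f(A_1,A_2,A_3)\ge u$. (ii) If $\sum_{i=1}^3\dim_H A_i>2$, then $\mathcal{L}^1(\Delta_f(A_1,A_2,A_3))>0$. Moreover, if there exists $i_0\in\{1,2,3\}$ such that $\nabla\mathcal{G}_{i_0}(x)\ne0$ for all $x\in\Omega$, then (ii) holds with the assumption $A_1\times A_2\times A_3\subset\Omega\setminus\mathcal{Z}_{3,f}$ replaced by $A_1\times A_2\times A_3\subset\Omega$.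
   Context: $\dim_H$ is Hausdorff dimension and $\mathcal{L}^1$ is Lebesgue measure on $\mathbb{R}$. With $f_i=\partial_{x_i}f$ and $f_{ij}=\partial^2f/\partial x_i\partial x_j$, define on $\Omega$ $$\mathcal{G}_1=f_3f_{12}-f_{13}f_2,\qquad \mathcal{G}_2=f_3f_{12}-f_{23}f_1,\qquad \mathcal{G}_3=f_1f_{23}-f_{13}f_2,$$ and $\mathcal{Z}_{3,f}=\{x\in\Omega:\mathcal{G}_1(x)=\mathcal{G}_2(x)=\mathcal{G}_3(x)=0\}$. *)

theory Defs
  imports "HOL-Analysis.Analysis"
begin

definition hausdorff_premeasure :: "real \<Rightarrow> real \<Rightarrow> 'a::metric_space set \<Rightarrow> ennreal" where
  "hausdorff_premeasure s \<delta> E =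
     (INF U \<in> {U :: nat \<Rightarrow> 'a set. E \<subseteq> (\<Union>n. U n) \<and> (\<forall>n. bounded (U n) \<and> diameter (U n) \<le> \<delta>)}.
        \<Sum>n. ennreal (diameter (U n) powr s))"

(* Meant for s > 0 only: since 0 powr 0 = 0, the value at s = 0 is not the counting measure. *)
definition hausdorff_measure :: "real \<Rightarrow> 'a::metric_space set \<Rightarrow> ennreal" where
  "hausdorff_measure s E = (SUP \<delta> \<in> {0<..}. hausdorff_premeasure s \<delta> E)"

(* Leaving out s = 0 does not change the infimum, because a set whose 0-dimensional measure
   vanishes has vanishing s-dimensional measure for every s > 0. *)
definition hausdorff_dim :: "'a::metric_space set \<Rightarrow> ennreal" where
  "hausdorff_dim E = Inf (ennreal ` {s. s > 0 \<and> hausdorff_measure s E = 0})"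

definition partial :: "'n::finite \<Rightarrow> (real ^ 'n \<Rightarrow> real) \<Rightarrow> real ^ 'n \<Rightarrow> real" where
  "partial i f x = deriv (\<lambda>t. f (x + t *\<^sub>R axis i 1)) 0"

definition grad :: "(real ^ 'n::finite \<Rightarrow> real) \<Rightarrow> real ^ 'n \<Rightarrow> real ^ 'n" where
  "grad f x = (\<chi> i. partial i f x)"

(* For open S these are the functions of class C^k on S; the values of f outside S play no role. *)
primrec Ck_on :: "nat \<Rightarrow> (real ^ 'n::finite \<Rightarrow> real) \<Rightarrow> (real ^ 'n) set \<Rightarrow> bool" where
  "Ck_on 0 f S \<longleftrightarrow> continuous_on S f"
| "Ck_on (Suc k) f S \<longleftrightarrow> (\<forall>x\<in>S. f differentiable (at x)) \<and> (\<forall>i. Ck_on k (partial i f) S)"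

definition smooth_on :: "(real ^ 'n::finite) set \<Rightarrow> (real ^ 'n \<Rightarrow> real) \<Rightarrow> bool" where
  "smooth_on S f \<longleftrightarrow> (\<forall>k. Ck_on k f S)"

abbreviation partial2 :: "'n::finite \<Rightarrow> 'n \<Rightarrow> (real ^ 'n \<Rightarrow> real) \<Rightarrow> real ^ 'n \<Rightarrow> real" where
  "partial2 i j f \<equiv> partial i (partial j f)"

(* The numeral 3 of the index type 3 equals 0; the indices 1, 2, 3 are pairwise distinct
   and exhaust the type (UNIV_3). *)
definition G :: "3 \<Rightarrow> (real ^ 3 \<Rightarrow> real) \<Rightarrow> real ^ 3 \<Rightarrow> real" where
  "G i f x =
    (if i = 1 then partial 3 f x * partial2 1 2 f x - partial2 1 3 f x * partial 2 f x
     else if i = 2 then partial 3 f x * partial2 1 2 f x - partial2 2 3 f x * partial 1 f x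
     else partial 1 f x * partial2 2 3 f x - partial2 1 3 f x * partial 2 f x)"

definition Z3 :: "(real ^ 3) set \<Rightarrow> (real ^ 3 \<Rightarrow> real) \<Rightarrow> (real ^ 3) set" where
  "Z3 \<Omega> f = {x \<in> \<Omega>. G 1 f x = 0 \<and> G 2 f x = 0 \<and> G 3 f x = 0}"

definition box3 :: "real set \<Rightarrow> real set \<Rightarrow> real set \<Rightarrow> (real ^ 3) set" where
  "box3 A1 A2 A3 = {x. x $ 1 \<in> A1 \<and> x $ 2 \<in> A2 \<and> x $ 3 \<in> A3}"

definition Delta :: "(real ^ 3 \<Rightarrow> real) \<Rightarrow> real set \<Rightarrow> real set \<Rightarrow> real set \<Rightarrow> real set" where
  "Delta f A1 A2 A3 = f ` box3 A1 A2 A3"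

end

(* Suppose G_1 does not vanish at a point of the box, all of whose coordinates are points of full
   dimension of their sets. Then the gradient of f(l, .) in the last two variables rotates with l,
   so near that point the maps f(l, .) form a transversal family of nonlinear projections of the
   plane. With Frostman weights on the three sets (exponents s1, s2, s3, sum sigma), the part of
   the pushforward under f living at scale d is isolated by a mean-zero kernel. For Lebesgue
   averaged l, one integration by parts in l bounds the interaction of two points at distance r
   by min(1/d, d/r^2), and Schur's test gives energy d^(s2+s3-1); passing from Lebesgue measure to
   the weights on the first set costs d^(s1-1), because the d-scale part varies at scale d in l.
   Hence the squared L^2 norm at scale d is at most a multiple of d^(sigma-2). Summing over scales,
   this is incompatible with a null image if sigma > 2, and with efficient covers of the image if
   sigma > 1 + u. All measures are finite sums of point masses at a finite resolution, with bounds
   uniform in the resolution; compactness of the image makes this sufficient. For the last claim,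
   where G vanishes some partial derivative of G does not, and points of full dimension accumulate
   in every coordinate, so a nearby such point has G nonzero. *)

theory Submission
  imports Defs
begin

text \<open>Nonvanishing of G makes the plane map x -> (\<open>h a x\<close>, \<open>h1 a x\<close>)
  invertible near the chosen point: its Jacobian determinant there is G up to sign. Hence two points
  at distance r have \<open>h\<close>-values or \<open>l\<close>-derivatives that differ by at least
  a multiple of r. In the first case kernels of scale d overlap only if r is at most a multiple of
  d; in the second the phase moves with speed comparable to r and integration by parts applies.
  Differentiating a wave in \<open>l\<close> replaces \<open>wav\<close> by \<open>wav'\<close> and
  brings in the amplitude \<open>h1\<close>, so the estimates are proved for a general amplitude and
  a general kernel with compactly supported antiderivative. Exponents are taken strictly below the
  dimensions, hence below 1. Then s2 + s3 < 2, and the dyadic series in Schur's test is dominated by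
  its finest term. The resolution is fixed only after an open neighbourhood or a finite cover of the
  image has been chosen. Since the constants do not depend on it, no limit of measures and no
  Fourier transform enters.\<close>

section \<open>Sets of zero Hausdorff content\<close>

text \<open>Hausdorff content rather than measure: the diameters are not bounded in advance. Finite
  covers fit the countable format by padding with empty sets, since the empty set has diameter 0 and
  \<open>0 powr s = 0\<close>.\<close>

definition content_le :: "real \<Rightarrow> real set \<Rightarrow> real \<Rightarrow> bool" where
  "content_le s E c \<longleftrightarrow> (\<exists>U::nat \<Rightarrow> real set. E \<subseteq> (\<Union>n. U n) \<and> (\<forall>n. bounded (U n)) \<and>
     (\<Sum>n. ennreal (diameter (U n) powr s)) \<le> ennreal c)"

definition content_null :: "real \<Rightarrow> real set \<Rightarrow> bool" where
  "content_null s E \<longleftrightarrow> (\<forall>e>0. content_le s E e)"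

lemma content_le_mono:
  assumes "content_le s E c" "F \<subseteq> E" "c \<le> d"
  shows "content_le s F d"
proof -
  have "ennreal c \<le> ennreal d" using assms(3) by (rule ennreal_leI)
  then show ?thesis using assms(1,2) unfolding content_le_def by (meson order_trans)
qed

lemma content_le_single:
  assumes "bounded E" "s > 0"
  shows "content_le s E (diameter E powr s)"
proof -
  define U where "U = (\<lambda>n::nat. if n = 0 then E else {})"
  have "(\<Sum>n. ennreal (diameter (U n) powr s)) = (\<Sum>n\<in>{0}. ennreal (diameter (U n) powr s))"
    by (rule suminf_finite) (auto simp: U_def)
  also have "\<dots> = ennreal (diameter E powr s)" by (simp add: U_def)
  finally show ?thesis unfolding content_le_def
    by (intro exI[of _ U]) (auto simp: U_def assms)
qed

lemma content_le_Un:
  assumes "content_le s E c" "content_le s F d" "c \<ge> 0" "d \<ge> 0"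
  shows "content_le s (E \<union> F) (c + d)"
proof -
  obtain A where A: "E \<subseteq> (\<Union>n. A n)" "\<And>n. bounded (A n)"
    "(\<Sum>n. ennreal (diameter (A n) powr s)) \<le> ennreal c"
    using assms(1) unfolding content_le_def by blast
  obtain B where B: "F \<subseteq> (\<Union>n. B n)" "\<And>n. bounded (B n)"
    "(\<Sum>n. ennreal (diameter (B n) powr s)) \<le> ennreal d"
    using assms(2) unfolding content_le_def by blast
  \<comment> \<open>Interleaving the covers makes the first 2m terms of the new series the first m
    terms of each old one.\<close>
  define U where "U = (\<lambda>n::nat. if even n then A (n div 2) else B (n div 2))"
  have "x \<in> (\<Union>n. U n)" if "x \<in> E \<union> F" for x
  proof -
    from that consider n where "x \<in> A n" | n where "x \<in> B n" using A(1) B(1) by blast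
    then show ?thesis
    proof cases
      case 1 then have "x \<in> U (2 * n)" by (simp add: U_def) then show ?thesis by blast
    next
      case 2 then have "x \<in> U (2 * n + 1)" by (simp add: U_def) then show ?thesis by blast
    qed
  qed
  moreover have "(\<Sum>n. ennreal (diameter (U n) powr s)) \<le> ennreal (c + d)"
  proof -
    have eq: "(\<Sum>n<2*m. ennreal (diameter (U n) powr s)) =
      (\<Sum>n<m. ennreal (diameter (A n) powr s)) + (\<Sum>n<m. ennreal (diameter (B n) powr s))" for m
      by (induction m) (auto simp: U_def algebra_simps)
    have "(\<Sum>n<m. ennreal (diameter (U n) powr s)) \<le> ennreal (c + d)" for m
    proof -
      have "(\<Sum>n<m. ennreal (diameter (U n) powr s)) \<le> (\<Sum>n<2*m. ennreal (diameter (U n) powr s))"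
        by (rule sum_mono2) auto
      also have "\<dots> \<le> ennreal c + ennreal d"
        unfolding eq
        by (intro add_mono order_trans[OF sum_le_suminf A(3)] order_trans[OF sum_le_suminf B(3)]) auto
      finally show ?thesis using assms by (simp add: ennreal_plus)
    qed
    then show ?thesis by (auto simp: suminf_eq_SUP intro!: SUP_least)
  qed
  moreover have "bounded (U n)" for n using A(2) B(2) by (simp add: U_def)
  ultimately show ?thesis unfolding content_le_def by (intro exI[of _ U]) blast
qed

lemma content_null_subset: "content_null s E \<Longrightarrow> F \<subseteq> E \<Longrightarrow> content_null s F"
  unfolding content_null_def using content_le_mono by blast

lemma content_null_Un:
  assumes "content_null s E" "content_null s F"
  shows "content_null s (E \<union> F)"
  unfolding content_null_def
proof (intro allI impI)
  fix e :: real assume "e > 0"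
  then have "content_le s (E \<union> F) (e/2 + e/2)"
    using assms unfolding content_null_def by (intro content_le_Un) auto
  then show "content_le s (E \<union> F) e" by simp
qed

lemma content_null_empty [simp]: "s > 0 \<Longrightarrow> content_null s {}"
  unfolding content_null_def using content_le_single[of "{}" s] content_le_mono[of s "{}" 0 "{}"] by simp

lemma content_null_UN:
  assumes "finite I" "\<And>i. i \<in> I \<Longrightarrow> content_null s (E i)" "s > 0"
  shows "content_null s (\<Union>i\<in>I. E i)"
  using assms by (induction I rule: finite_induct) (auto intro: content_null_Un)

text \<open>A cover of total cost at most \<delta> powr s consists of sets of diameter at most
  \<delta>, so small content already yields covers admissible for every mesh. Dimension can
  therefore be handled through content alone.\<close>

lemma hausdorff_measure_eq_0_iff:
  assumes "s > 0"
  shows "hausdorff_measure s E = 0 \<longleftrightarrow> content_null s E"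
proof
  assume "hausdorff_measure s E = 0"
  then have "hausdorff_premeasure s 1 E = 0"
    unfolding hausdorff_measure_def by (metis SUP_upper greaterThan_iff le_zero_eq zero_less_one)
  then have "content_le s E e" if "e > 0" for e
  proof -
    have "hausdorff_premeasure s 1 E < ennreal e"
      using that \<open>hausdorff_premeasure s 1 E = 0\<close> by (simp add: ennreal_less_zero_iff)
    then obtain U where "U \<in> {U :: nat \<Rightarrow> real set. E \<subseteq> (\<Union>n. U n) \<and> (\<forall>n. bounded (U n) \<and> diameter (U n) \<le> 1)}"
      "(\<Sum>n. ennreal (diameter (U n) powr s)) < ennreal e"
      unfolding hausdorff_premeasure_def INF_less_iff by blast
    then show ?thesis unfolding content_le_def by (intro exI[of _ U]) (simp add: less_imp_le)
  qed
  then show "content_null s E" unfolding content_null_def by blast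
next
  assume null: "content_null s E"
  have "hausdorff_premeasure s \<delta> E \<le> 0" if "\<delta> > 0" for \<delta>
  proof (rule ennreal_le_epsilon)
    fix e :: real assume e: "e > 0"
    define e' where "e' = min e (\<delta> powr s)"
    have "e' > 0" using e that by (simp add: e'_def)
    then obtain U where U: "E \<subseteq> (\<Union>n. U n)" "\<And>n. bounded (U n)"
      "(\<Sum>n. ennreal (diameter (U n) powr s)) \<le> ennreal e'"
      using null unfolding content_null_def content_le_def by blast
    have "diameter (U n) \<le> \<delta>" for n
    proof -
      have "ennreal (diameter (U n) powr s) = (\<Sum>k\<in>{n}. ennreal (diameter (U k) powr s))" by simp
      also have "\<dots> \<le> ennreal e'" by (rule order_trans[OF sum_le_suminf U(3)]) auto
      finally have "diameter (U n) powr s \<le> e'" using \<open>e' > 0\<close> by (simp add: ennreal_le_iff)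
      then have "diameter (U n) powr s \<le> \<delta> powr s" by (simp add: e'_def)
      then show ?thesis
        by (metis assms that diameter_ge_0 U(2) powr_less_mono2 less_imp_le not_less)
    qed
    then have "hausdorff_premeasure s \<delta> E \<le> (\<Sum>n. ennreal (diameter (U n) powr s))"
      unfolding hausdorff_premeasure_def using U by (intro INF_lower) auto
    also have "\<dots> \<le> ennreal e" using U(3) by (rule order_trans) (auto simp: e'_def ennreal_leI)
    finally show "hausdorff_premeasure s \<delta> E \<le> 0 + ennreal e" by simp
  qed
  then show "hausdorff_measure s E = 0"
    unfolding hausdorff_measure_def by (metis SUP_least greaterThan_iff le_zero_eq)
qed

lemma hausdorff_dim_gtD:
  assumes "ennreal s < hausdorff_dim E" "s > 0"
  shows "\<not> content_null s E"
proof
  assume "content_null s E"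
  then have "hausdorff_dim E \<le> ennreal s"
    unfolding hausdorff_dim_def using assms(2) hausdorff_measure_eq_0_iff[of s E] by (intro Inf_lower) auto
  with assms(1) show False by simp
qed

lemma hausdorff_dim_geI:
  assumes "\<And>s. 0 < s \<Longrightarrow> s < u \<Longrightarrow> \<not> content_null s E"
  shows "hausdorff_dim E \<ge> ennreal u"
  unfolding hausdorff_dim_def
proof (rule Inf_greatest)
  fix z assume "z \<in> ennreal ` {s. s > 0 \<and> hausdorff_measure s E = 0}"
  then obtain s where s: "z = ennreal s" "s > 0" "content_null s E"
    using hausdorff_measure_eq_0_iff by blast
  then have "u \<le> s" using assms[of s] by force
  then show "ennreal u \<le> z" using s by (simp add: ennreal_leI)
qed

text \<open>Cutting an interval of length 2M into k equal pieces costs k (2M/k)^s, which tends to 0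
  for s > 1. The resulting bound 1 on dimensions later keeps the Frostman exponents below 1.\<close>

lemma bounded_content_null:
  fixes E :: "real set"
  assumes "bounded E" "s > 1"
  shows "content_null s E"
  unfolding content_null_def
proof (intro allI impI)
  fix e :: real assume e: "e > 0"
  obtain M where M: "M > 0" "\<And>x. x \<in> E \<Longrightarrow> \<bar>x\<bar> \<le> M"
    using assms(1) by (metis bounded_pos real_norm_def)
  have step: "content_le s {-M..-M + 2 * real k * d} (real k * (2 * d) powr s)" if "d > 0" for k d
  proof (induction k)
    case 0
    have "content_le s {-M} 0" using content_le_single[of "{-M}" s] assms by simp
    then show ?case by simp
  next
    case (Suc k)
    have "content_le s {-M + 2 * real k * d..-M + 2 * real k * d + 2 * d} ((2 * d) powr s)"
      using content_le_single[of "{-M + 2 * real k * d..-M + 2 * real k * d + 2 * d}" s] assms that by simp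
    then have "content_le s ({-M..-M + 2 * real k * d} \<union> {-M + 2 * real k * d..-M + 2 * real k * d + 2 * d})
      (real k * (2 * d) powr s + (2 * d) powr s)"
      using Suc that by (intro content_le_Un) auto
    then show ?case by (rule content_le_mono) (auto simp: algebra_simps)
  qed
  have "((\<lambda>k. real k * (2 * (M / real k)) powr s) \<longlongrightarrow> 0) sequentially"
  proof -
    have "((\<lambda>k. (2 * M) powr s * real k powr (1 - s)) \<longlongrightarrow> (2*M) powr s * 0) sequentially"
      using assms by (intro tendsto_intros tendsto_neg_powr filterlim_real_sequentially) auto
    moreover have "(2 * M) powr s * real k powr (1 - s) = real k * (2 * (M / real k)) powr s" if "k > 0" for k :: nat
      using M(1) that by (simp add: powr_mult powr_divide powr_diff)
    then have "\<forall>\<^sub>F k in sequentially. (2 * M) powr s * real k powr (1 - s) = real k * (2 * (M / real k)) powr s"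
      using eventually_gt_at_top[of 0] by (rule eventually_mono[rotated]) auto
    ultimately show ?thesis by (simp add: tendsto_cong)
  qed
  then have "\<forall>\<^sub>F k in sequentially. real k * (2 * (M / real k)) powr s < e \<and> k > 0"
    using e by (intro eventually_conj order_tendstoD(2)[of _ 0] eventually_gt_at_top) auto
  then obtain k where k: "real k * (2 * (M / real k)) powr s < e" "k > 0"
    by (auto simp: eventually_sequentially)
  have "content_le s {-M..-M + 2 * real k * (M / real k)} (real k * (2 * (M / real k)) powr s)"
    using step[of "M / real k" k] M k by simp
  moreover have "E \<subseteq> {-M..-M + 2 * real k * (M / real k)}" using M k by (force simp: abs_le_iff)
  ultimately show "content_le s E e" by (rule content_le_mono) (use k in simp)
qed

lemma hausdorff_dim_le_1:
  fixes E :: "real set"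
  assumes "bounded E"
  shows "hausdorff_dim E \<le> 1"
proof (rule ccontr)
  assume "\<not> ?thesis"
  then have "1 < hausdorff_dim E" by simp
  then obtain z where z: "1 < z" "z < hausdorff_dim E" using dense by blast
  then have "z \<noteq> top" using top.not_eq_extremum by fastforce
  then obtain s where s: "z = ennreal s" "s \<ge> 0" by (metis ennreal_cases)
  then have "s > 1" using z(1) by (metis ennreal_1 ennreal_less_iff zero_le_one)
  then show False using hausdorff_dim_gtD[of s E] bounded_content_null[OF assms] z s by auto
qed

text \<open>A substitute for lying in the support of a measure of dimension s: every neighbourhood
  keeps positive s-content. With s just below the dimension these play the role of points of full
  dimension.\<close>

definition thick_at :: "real \<Rightarrow> real set \<Rightarrow> real \<Rightarrow> bool" where
  "thick_at s A a \<longleftrightarrow> a \<in> A \<and> (\<forall>\<eta>>0. \<not> content_null s (A \<inter> {a-\<eta>..a+\<eta>}))"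

text \<open>Otherwise each point of the compact set would have a neighbourhood of zero content, and
  finitely many of these would cover it. The separate \<open>K\<close> allows a thick point of
  \<open>A\<close> to be found in a prescribed part of \<open>A\<close>.\<close>

lemma exists_thick:
  assumes "compact K" "K \<subseteq> A" "\<not> content_null s K" "s > 0"
  shows "\<exists>a\<in>K. thick_at s A a"
proof (rule ccontr)
  assume "\<not> ?thesis"
  then have "\<forall>a\<in>K. \<exists>\<eta>>0. content_null s (A \<inter> {a-\<eta>..a+\<eta>})"
    using assms(2) unfolding thick_at_def by blast
  then obtain r where r: "\<And>a. a \<in> K \<Longrightarrow> r a > 0 \<and> content_null s (A \<inter> {a - r a..a + r a})"
    by metis
  have "K \<subseteq> (\<Union>a\<in>K. {a - r a<..<a + r a})" using r by force
  then obtain D where D: "D \<subseteq> K" "finite D" "K \<subseteq> (\<Union>a\<in>D. {a - r a<..<a + r a})"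
    using compactE_image[OF assms(1), of K "\<lambda>a. {a - r a<..<a + r a}"] by auto
  have "content_null s (\<Union>a\<in>D. A \<inter> {a - r a..a + r a})"
    using D r assms(4) by (intro content_null_UN) auto
  moreover have "K \<subseteq> (\<Union>a\<in>D. A \<inter> {a - r a..a + r a})"
  proof
    fix x assume "x \<in> K"
    then obtain b where "b \<in> D" "x \<in> {b - r b<..<b + r b}" using D(3) by blast
    then have "x \<in> A \<inter> {b - r b..b + r b}" using \<open>x \<in> K\<close> assms(2) by auto
    then show "x \<in> (\<Union>a\<in>D. A \<inter> {a - r a..a + r a})" using \<open>b \<in> D\<close> by blast
  qed
  ultimately show False using assms(3) content_null_subset by blast
qed

text \<open>A short interval around \<open>a\<close> has arbitrarily small content, so deleting it
  from a neighbourhood of positive content leaves a compact set of positive content. That set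
  contains another thick point.\<close>

lemma thick_at_accumulates:
  assumes "compact A" "thick_at s A a" "s > 0" "\<epsilon> > 0"
  shows "\<exists>b. thick_at s A b \<and> b \<noteq> a \<and> \<bar>b - a\<bar> \<le> \<epsilon>"
proof -
  have "\<not> content_null s (A \<inter> {a-\<epsilon>..a+\<epsilon>})" using assms unfolding thick_at_def by blast
  then obtain e where e: "e > 0" "\<not> content_le s (A \<inter> {a-\<epsilon>..a+\<epsilon>}) e"
    unfolding content_null_def by blast
  \<comment> \<open>The interval of radius \<eta> has diameter (e/2)^(1/s), hence cost exactly
    e/2.\<close>
  define \<eta> where "\<eta> = (e/2) powr (1/s) / 2"
  have \<eta>: "\<eta> > 0" "(2 * \<eta>) powr s = e/2" using e assms(3) by (auto simp: \<eta>_def powr_powr)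
  define K where "K = A \<inter> ({a-\<epsilon>..a-\<eta>} \<union> {a+\<eta>..a+\<epsilon>})"
  have "compact K" unfolding K_def by (intro compact_Int_closed assms closed_Un) auto
  have "\<not> content_null s K"
  proof
    assume "content_null s K"
    then have "content_le s K (e/2)" using e unfolding content_null_def by auto
    moreover have "content_le s {a-\<eta>..a+\<eta>} (e/2)"
    proof -
      have "diameter {a-\<eta>..a+\<eta>} = 2 * \<eta>" using \<eta>(1) by simp
      then show ?thesis using content_le_single[of "{a-\<eta>..a+\<eta>}" s] \<eta>(2) assms(3) by simp
    qed
    ultimately have "content_le s (K \<union> {a-\<eta>..a+\<eta>}) (e/2 + e/2)" using e by (intro content_le_Un) auto
    then have "content_le s (A \<inter> {a-\<epsilon>..a+\<epsilon>}) e" by (rule content_le_mono) (auto simp: K_def)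
    with e show False by blast
  qed
  moreover have "K \<subseteq> A" by (auto simp: K_def)
  ultimately obtain b where "b \<in> K" "thick_at s A b"
    using exists_thick[OF \<open>compact K\<close>, of A s] assms(3) by blast
  then show ?thesis using \<eta> by (intro exI[of _ b]) (auto simp: K_def)
qed

section \<open>Discrete Frostman weights\<close>

text \<open>Half-open dyadic intervals of length 1/2^n: those of one level partition the line, so
  weights split over the two halves of an interval without overlap.\<close>

definition dyad :: "nat \<Rightarrow> int \<Rightarrow> real set" where
  "dyad n j = {x. \<lfloor>2^n * x\<rfloor> = j}"

lemma dyad_Suc: "dyad n j = dyad (Suc n) (2*j) \<union> dyad (Suc n) (2*j+1)"
proof -
  have "\<lfloor>y\<rfloor> = j \<longleftrightarrow> \<lfloor>2*y\<rfloor> = 2*j \<or> \<lfloor>2*y\<rfloor> = 2*j+1" for y :: real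
    unfolding floor_eq_iff by auto
  then show ?thesis by (auto simp: dyad_def mult.assoc)
qed

lemma dyad_unique: "x \<in> dyad n i \<Longrightarrow> x \<in> dyad n j \<Longrightarrow> i = j"
  by (simp add: dyad_def)

lemma dyad_coarsen:
  assumes "m \<ge> n" "x \<in> dyad m i"
  shows "x \<in> dyad n (i div 2^(m-n))"
  using assms
proof (induction m arbitrary: i rule: dec_induct)
  case base then show ?case by simp
next
  case (step m)
  have "dyad (Suc m) i \<subseteq> dyad m (i div 2)"
    unfolding dyad_Suc[of m "i div 2"] by (cases "even i") (auto simp: odd_two_times_div_two_succ)
  with step have "x \<in> dyad n (i div 2 div 2^(m-n))" by blast
  then show ?case using step by (simp add: zdiv_zmult2_eq Suc_diff_le)
qed

lemma bounded_dyad: "bounded (dyad n j)" "diameter (dyad n j) \<le> 1/2^n"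
proof -
  have sub: "dyad n j \<subseteq> {real_of_int j / 2^n..(real_of_int j + 1) / 2^n}"
    by (auto simp: dyad_def floor_eq_iff field_simps)
  then show "bounded (dyad n j)" using bounded_subset[OF bounded_closed_interval] by blast
  have "diameter (dyad n j) \<le> diameter {real_of_int j / 2^n..(real_of_int j + 1) / 2^n}"
    using sub by (rule diameter_subset) simp
  also have "\<dots> \<le> 1/2^n" by (auto simp: field_simps)
  finally show "diameter (dyad n j) \<le> 1/2^n" .
qed

text \<open>Max-flow--min-cut on the dyadic tree: the total weight given to an interval is the minimum of its
  cap and of what its two halves carry, and by the same recursion it bounds the cost of a cover.\<close>

lemma frostman_tree:
  assumes "s > 0"
  shows "\<exists>P w. finite P \<and> P \<subseteq> A \<inter> dyad n j \<and> (\<forall>x::real. 0 \<le> w x) \<and>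
    content_le s (A \<inter> dyad n j) (sum w P) \<and>
    (\<forall>m i. n \<le> m \<longrightarrow> m \<le> n + k \<longrightarrow> sum w (P \<inter> dyad m i) \<le> (1/2^m) powr s)"
proof (induction k arbitrary: n j)
  case 0
  have cap: "content_le s (A \<inter> dyad n j) ((1/2^n) powr s)"
  proof (rule content_le_mono)
    show "content_le s (dyad n j) (diameter (dyad n j) powr s)"
      by (rule content_le_single) (use bounded_dyad assms in auto)
    show "diameter (dyad n j) powr s \<le> (1/2^n) powr s"
      by (rule powr_mono2) (use assms bounded_dyad diameter_ge_0[OF bounded_dyad(1)] in auto)
  qed auto
  show ?case
  proof (cases "A \<inter> dyad n j = {}")
    case True
    then show ?thesis using content_le_single[of "{}" s] assms
      by (intro exI[of _ "{}"] exI[of _ "\<lambda>_. 0"]) auto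
  next
    case False
    \<comment> \<open>At the finest level a single point of the set carries the whole cap.\<close>
    then obtain p where "p \<in> A \<inter> dyad n j" by blast
    moreover have "(\<Sum>x\<in>{p} \<inter> D. (1/2^n) powr s) \<le> (1/2^n :: real) powr s" for D
      by (cases "p \<in> D") auto
    ultimately show ?thesis using cap
      by (intro exI[of _ "{p}"] exI[of _ "\<lambda>_. (1/2^n) powr s"]) auto
  qed
next
  case (Suc k)
  define cap where "cap = (1/2^n :: real) powr s"
  obtain P v where P: "finite P" "P \<subseteq> A \<inter> dyad (Suc n) (2*j)" "\<And>x. 0 \<le> v x"
    "content_le s (A \<inter> dyad (Suc n) (2*j)) (sum v P)"
    "\<And>m i. Suc n \<le> m \<Longrightarrow> m \<le> Suc n + k \<Longrightarrow> sum v (P \<inter> dyad m i) \<le> (1/2^m) powr s"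
    using Suc.IH[of "Suc n" "2*j"] by blast
  obtain Q w where Q: "finite Q" "Q \<subseteq> A \<inter> dyad (Suc n) (2*j+1)" "\<And>x. 0 \<le> w x"
    "content_le s (A \<inter> dyad (Suc n) (2*j+1)) (sum w Q)"
    "\<And>m i. Suc n \<le> m \<Longrightarrow> m \<le> Suc n + k \<Longrightarrow> sum w (Q \<inter> dyad m i) \<le> (1/2^m) powr s"
    using Suc.IH[of "Suc n" "2*j+1"] by blast
  have disj: "P \<inter> Q = {}" using P(2) Q(2) dyad_unique[of _ "Suc n" "2*j" "2*j+1"] by fastforce
  define u where "u = (\<lambda>x. if x \<in> P then v x else w x)"
  have sumu: "sum u ((P \<union> Q) \<inter> D) = sum v (P \<inter> D) + sum w (Q \<inter> D)" for D
  proof -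
    have "sum u ((P \<union> Q) \<inter> D) = sum u (P \<inter> D) + sum u (Q \<inter> D)"
      unfolding Int_Un_distrib2 using P(1) Q(1) disj by (intro sum.union_disjoint) auto
    moreover have "sum u (P \<inter> D) = sum v (P \<inter> D)" by (rule sum.cong) (auto simp: u_def)
    moreover have "sum u (Q \<inter> D) = sum w (Q \<inter> D)" using disj by (intro sum.cong) (auto simp: u_def)
    ultimately show ?thesis by simp
  qed
  define T where "T = sum v P + sum w Q"
  have sumT: "sum u (P \<union> Q) = T" using sumu[of UNIV] by (simp add: T_def)
  have T0: "T \<ge> 0" unfolding T_def using P(3) Q(3) by (simp add: sum_nonneg)
  \<comment> \<open>If the two halves together exceed the cap of the parent, all weights are scaled
    down so that the total equals the cap. The parent interval alone is then a cover of at most that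
    cost.\<close>
  define f where "f = (if T \<le> cap then 1 else cap / T)"
  have cap0: "cap > 0" by (simp add: cap_def)
  have f: "0 \<le> f" "f \<le> 1" using cap0 by (auto simp: f_def)
  have u0: "u x \<ge> 0" for x using P(3) Q(3) by (simp add: u_def)
  have fT: "f * T \<le> cap" using cap0 by (auto simp: f_def)
  have sumf: "sum (\<lambda>x. f * u x) D = f * sum u D" for D by (simp add: sum_distrib_left)
  show ?case
  proof (intro exI[of _ "P \<union> Q"] exI[of _ "\<lambda>x. f * u x"] conjI allI impI)
    show "finite (P \<union> Q)" using P Q by simp
    show "P \<union> Q \<subseteq> A \<inter> dyad n j" using P(2) Q(2) dyad_Suc[of n j] by blast
    show "0 \<le> f * u x" for x using f u0 by simp
    show "content_le s (A \<inter> dyad n j) (\<Sum>x\<in>P \<union> Q. f * u x)"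
    proof (cases "T \<le> cap")
      case True
      have "content_le s (A \<inter> dyad (Suc n) (2*j) \<union> A \<inter> dyad (Suc n) (2*j+1)) T"
        unfolding T_def using P(3,4) Q(3,4) by (intro content_le_Un) (auto simp: sum_nonneg)
      then show ?thesis using True by (simp add: sumf sumT f_def dyad_Suc[of n j] Int_Un_distrib)
    next
      case False
      have "content_le s (A \<inter> dyad n j) cap"
      proof (rule content_le_mono)
        show "content_le s (dyad n j) (diameter (dyad n j) powr s)"
          by (rule content_le_single) (use bounded_dyad assms in auto)
        show "diameter (dyad n j) powr s \<le> cap" unfolding cap_def
          by (rule powr_mono2) (use assms bounded_dyad diameter_ge_0[OF bounded_dyad(1)] in auto)
      qed auto
      moreover have "(\<Sum>x\<in>P \<union> Q. f * u x) = cap"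
        unfolding sumf sumT using False cap0 by (simp add: f_def)
      ultimately show ?thesis by simp
    qed
    fix m i assume m: "n \<le> m" "m \<le> n + Suc k"
    show "(\<Sum>x\<in>(P \<union> Q) \<inter> dyad m i. f * u x) \<le> (1/2^m) powr s"
    proof (cases "m = n")
      case True
      have "(\<Sum>x\<in>(P \<union> Q) \<inter> dyad m i. f * u x) \<le> (\<Sum>x\<in>P \<union> Q. f * u x)"
        using P Q f u0 by (intro sum_mono2) auto
      also have "\<dots> \<le> cap" using fT by (simp add: sumf sumT)
      finally show ?thesis using True by (simp add: cap_def)
    next
      case False
      then have m': "Suc n \<le> m" "m \<le> Suc n + k" using m by auto
      \<comment> \<open>A dyadic interval below level n lies in one half, so it receives weight from
        only one of \<open>P\<close> and \<open>Q\<close>; scaling by \<open>f\<close>, which is at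
        most 1, preserves its bound.\<close>
      have "P \<inter> dyad m i = {} \<or> Q \<inter> dyad m i = {}"
      proof (rule ccontr)
        assume "\<not> ?thesis"
        then obtain x y where "x \<in> P" "x \<in> dyad m i" "y \<in> Q" "y \<in> dyad m i" by blast
        then have "i div 2^(m - Suc n) = 2*j" "i div 2^(m - Suc n) = 2*j+1"
          using P(2) Q(2) dyad_coarsen[OF m'(1)] dyad_unique by blast+
        then show False by simp
      qed
      then have "sum u ((P \<union> Q) \<inter> dyad m i) \<le> (1/2^m) powr s"
        unfolding sumu using P(5)[OF m'] Q(5)[OF m'] by auto
      then have "f * sum u ((P \<union> Q) \<inter> dyad m i) \<le> (1/2^m) powr s"
        using f u0 mult_left_le_one_le[of "sum u ((P \<union> Q) \<inter> dyad m i)" f]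
        by (smt (verit) sum_nonneg)
      then show ?thesis by (simp add: sumf)
    qed
  qed
qed

text \<open>The condition is on arbitrary intervals of radius 1/2^n instead of dyadic ones. Such an
  interval is covered by three dyadic intervals of level n, whence the factor 3. It is demanded only
  down to the resolution 1/2^N.\<close>

definition frostman :: "real \<Rightarrow> nat \<Rightarrow> real set \<Rightarrow> (real \<Rightarrow> real) \<Rightarrow> bool" where
  "frostman s N P w \<longleftrightarrow> finite P \<and> (\<forall>x. 0 \<le> w x) \<and> sum w P \<le> 1 \<and>
     (\<forall>n\<le>N. \<forall>x. sum w (P \<inter> {x - 1/2^n..x + 1/2^n}) \<le> 3 * (1/2^n) powr s)"

text \<open>As A is bounded, some unit dyadic interval has positive content. The cover that
  accompanies the tree weights costs no more than their total, so the total is bounded below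
  independently of N, while the level-0 cap keeps it at most 1.\<close>

lemma exists_frostman:
  assumes "s > 0" "bounded A" "\<not> content_null s A"
  shows "\<exists>c>0. \<forall>N. \<exists>P w. P \<subseteq> A \<and> frostman s N P w \<and> c \<le> sum w P"
proof -
  obtain M where M: "\<And>x. x \<in> A \<Longrightarrow> \<bar>x\<bar> \<le> M"
    using assms(2) by (metis bounded_pos real_norm_def)
  have "\<exists>j. \<not> content_null s (A \<inter> dyad 0 j)"
  proof (rule ccontr)
    assume "\<not> ?thesis"
    then have "content_null s (\<Union>j\<in>{\<lfloor>-M\<rfloor>..\<lfloor>M\<rfloor>}. A \<inter> dyad 0 j)"
      using assms(1) by (intro content_null_UN) auto
    moreover have "A \<subseteq> (\<Union>j\<in>{\<lfloor>-M\<rfloor>..\<lfloor>M\<rfloor>}. A \<inter> dyad 0 j)"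
      using M by (auto simp: dyad_def abs_le_iff intro!: floor_mono) (meson floor_mono minus_le_iff)+
    ultimately show False using assms(3) content_null_subset by blast
  qed
  then obtain j c where c: "c > 0" "\<not> content_le s (A \<inter> dyad 0 j) c"
    unfolding content_null_def by blast
  have "\<exists>P w. P \<subseteq> A \<and> frostman s N P w \<and> c \<le> sum w P" for N
  proof -
    obtain P w where P: "finite P" "P \<subseteq> A \<inter> dyad 0 j" "\<And>x::real. 0 \<le> w x"
      "content_le s (A \<inter> dyad 0 j) (sum w P)"
      "\<And>m i. m \<le> N \<Longrightarrow> sum w (P \<inter> dyad m i) \<le> (1/2^m) powr s"
      using frostman_tree[OF assms(1), of A 0 j N] by (metis add_0 le0)
    have "c \<le> sum w P" using content_le_mono[OF P(4) order_refl, of c] c(2) by linarith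
    moreover have "P \<inter> dyad 0 j = P" using P(2) by blast
    then have "sum w P \<le> 1" using P(5)[of 0 j] by simp
    moreover have "sum w (P \<inter> {x - 1/2^n..x + 1/2^n}) \<le> 3 * (1/2^n) powr s" if "n \<le> N" for n x
    proof -
      define i where "i = \<lfloor>2^n * x\<rfloor>"
      have "{x - 1/2^n..x + 1/2^n} \<subseteq> dyad n (i-1) \<union> dyad n i \<union> dyad n (i+1)"
      proof
        fix y assume "y \<in> {x - 1/2^n..x + 1/2^n}"
        then have "2^n * x - 1 \<le> 2^n * y" "2^n * y \<le> 2^n * x + 1" by (auto simp: field_simps)
        then have "\<lfloor>2^n * x\<rfloor> - 1 \<le> \<lfloor>2^n * y\<rfloor>" "\<lfloor>2^n * y\<rfloor> \<le> \<lfloor>2^n * x\<rfloor> + 1" by linarith+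
        then show "y \<in> dyad n (i-1) \<union> dyad n i \<union> dyad n (i+1)" by (auto simp: dyad_def i_def)
      qed
      then have "sum w (P \<inter> {x - 1/2^n..x + 1/2^n}) \<le>
          sum w ((P \<inter> dyad n (i-1) \<union> P \<inter> dyad n i) \<union> P \<inter> dyad n (i+1))"
        using P by (intro sum_mono2) auto
      also have "\<dots> \<le> sum w (P \<inter> dyad n (i-1)) + sum w (P \<inter> dyad n i) + sum w (P \<inter> dyad n (i+1))"
        using P(1) by (subst sum.union_disjoint; (subst sum.union_disjoint)?) (auto simp: dyad_def)
      also have "\<dots> \<le> 3 * (1/2^n) powr s" using P(5)[OF that, of "i-1"] P(5)[OF that, of i] P(5)[OF that, of "i+1"] by simp
      finally show ?thesis .
    qed
    ultimately show ?thesis using P by (intro exI[of _ P] exI[of _ w]) (auto simp: frostman_def)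
  qed
  then show ?thesis using c(1) by blast
qed

section \<open>Bump functions and an oscillatory integral\<close>

text \<open>The difference quotient errs by at most |h|: squaring removes the kink of
  \<open>max 0\<close>. This makes \<open>bump\<close> an explicit C^1 function, the regularity that
  the kernels require.\<close>

lemma DERIV_max_square: "((\<lambda>z::real. (max 0 z)^2) has_real_derivative 2 * max 0 z) (at z)"
proof -
  have "\<bar>((max 0 (z + h))^2 - (max 0 z)^2) / h - 2 * max 0 z\<bar> \<le> \<bar>h\<bar>" if "h \<noteq> 0" for h
  proof -
    have "\<bar>(max 0 (z + h))^2 - (max 0 z)^2 - 2 * max 0 z * h\<bar> \<le> h^2"
    proof (cases "z \<ge> 0"; cases "z + h \<ge> 0")
      assume "z \<ge> 0" "z + h \<ge> 0" then show ?thesis by (simp add: power2_eq_square algebra_simps)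
    next
      assume a: "z \<ge> 0" "\<not> z + h \<ge> 0"
      then have "(max 0 (z + h))^2 - (max 0 z)^2 - 2 * max 0 z * h = h^2 - (z+h)^2"
        by (simp add: power2_eq_square algebra_simps)
      moreover have "(z+h)^2 \<le> h^2" using a by (simp add: abs_le_square_iff[symmetric])
      ultimately show ?thesis using zero_le_power2[of "z+h"] by linarith
    next
      assume a: "\<not> z \<ge> 0" "z + h \<ge> 0"
      then have "(z+h)^2 \<le> h^2" by (simp add: abs_le_square_iff[symmetric])
      then show ?thesis using a by simp
    next
      assume "\<not> z \<ge> 0" "\<not> z + h \<ge> 0" then show ?thesis by simp
    qed
    then have "\<bar>(max 0 (z + h))^2 - (max 0 z)^2 - 2 * max 0 z * h\<bar> / \<bar>h\<bar> \<le> h^2 / \<bar>h\<bar>"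
      by (simp add: divide_right_mono)
    moreover have "((max 0 (z + h))^2 - (max 0 z)^2) / h - 2 * max 0 z =
      ((max 0 (z + h))^2 - (max 0 z)^2 - 2 * max 0 z * h) / h" using that by (simp add: field_simps)
    moreover have "h^2 / \<bar>h\<bar> = \<bar>h\<bar>" using that by (simp add: power2_eq_square abs_if)
    ultimately show ?thesis by (simp add: abs_divide)
  qed
  then have "\<forall>\<^sub>F h in at 0. norm (((max 0 (z + h))^2 - (max 0 z)^2) / h - 2 * max 0 z) \<le> \<bar>h\<bar>"
    by (auto simp: eventually_at_filter)
  moreover have "((\<lambda>h::real. \<bar>h\<bar>) \<longlongrightarrow> 0) (at 0)" by (rule tendsto_rabs_zero[OF tendsto_ident_at])
  ultimately have "((\<lambda>h. ((max 0 (z + h))^2 - (max 0 z)^2) / h - 2 * max 0 z) \<longlongrightarrow> 0) (at 0)"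
    by (rule Lim_null_comparison)
  then show ?thesis unfolding DERIV_def by (simp add: LIM_zero_iff)
qed

definition bump :: "real \<Rightarrow> real" where "bump t = (max 0 (1 - t^2))^2"
definition bump' :: "real \<Rightarrow> real" where "bump' t = 2 * max 0 (1 - t^2) * (- (2 * t))"
text \<open>Starting at -3, well to the left of the support [-1, 1], leaves room to apply the
  fundamental theorem of calculus around every point where \<open>bump\<close> may be nonzero;
  further left the function is locally 0.\<close>

definition bump_int :: "real \<Rightarrow> real" where "bump_int t = integral {-3..t} bump"

lemma DERIV_bump: "(bump has_real_derivative bump' t) (at t)"
  unfolding bump_def[abs_def] bump'_def
  by (rule DERIV_chain'[where g = "\<lambda>z. (max 0 z)^2", OF _ DERIV_max_square])
     (auto intro!: derivative_eq_intros)

lemma bump_nonneg: "bump t \<ge> 0" by (simp add: bump_def)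
lemma bump_zero: "\<bar>t\<bar> \<ge> 1 \<Longrightarrow> bump t = 0"
  using abs_le_square_iff[of 1 t] by (simp add: bump_def max_def)
lemma bump'_zero: "\<bar>t\<bar> \<ge> 1 \<Longrightarrow> bump' t = 0"
  using abs_le_square_iff[of 1 t] by (simp add: bump'_def max_def)
lemma continuous_on_bump: "continuous_on S bump"
  unfolding bump_def[abs_def] by (intro continuous_intros)
lemma continuous_on_bump': "continuous_on S bump'"
  unfolding bump'_def[abs_def] by (intro continuous_intros)

lemma bump_int_zero: "t \<le> -1 \<Longrightarrow> bump_int t = 0"
proof -
  assume t: "t \<le> -1"
  have "integral {-3..t} bump = integral {-3..t} (\<lambda>_. 0)"
    by (rule integral_cong) (use t in \<open>auto intro: bump_zero\<close>)
  then show ?thesis by (simp add: bump_int_def)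
qed

lemma bump_int_const: "t \<ge> 1 \<Longrightarrow> bump_int t = bump_int 1"
proof -
  assume t: "t \<ge> 1"
  have "integral {-3..t} bump = integral {-3..1} bump + integral {1..t} bump"
    using t by (intro Henstock_Kurzweil_Integration.integral_combine[symmetric] integrable_continuous_interval continuous_on_bump) auto
  moreover have "integral {1..t} bump = integral {1..t} (\<lambda>_. 0)"
    by (rule integral_cong) (use t in \<open>auto intro: bump_zero\<close>)
  ultimately show ?thesis by (simp add: bump_int_def)
qed

lemma DERIV_bump_int: "(bump_int has_real_derivative bump t) (at t)"
proof (cases "t > -2")
  case True
  have "((\<lambda>u. integral {-3..u} bump) has_real_derivative bump t) (at t within {-3..t+1})"
    using True by (intro integral_has_real_derivative continuous_on_bump) auto
  moreover have "at t within {-3..t+1} = at t" using True by (intro at_within_interior) auto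
  ultimately show ?thesis by (simp add: bump_int_def[abs_def])
next
  case False
  have "((\<lambda>_. 0::real) has_real_derivative 0) (at t)" by simp
  then have "(bump_int has_real_derivative 0) (at t)"
    by (rule has_field_derivative_transform_within_open[of _ _ _ "{..<-1}"])
       (use False in \<open>auto simp: bump_int_zero\<close>)
  then show ?thesis using False by (simp add: bump_zero)
qed

text \<open>\<open>wav\<close> compares \<open>bump\<close> at two consecutive dyadic scales. Both
  versions have the same mass, so \<open>wav\<close> has mean zero and its antiderivative
  \<open>wav_int\<close> has compact support: the two terms agree to the right of [-1, 1] as well as
  to the left.\<close>

definition wav_int :: "real \<Rightarrow> real" where "wav_int t = bump_int (2 * t) - bump_int t"
definition wav :: "real \<Rightarrow> real" where "wav t = 2 * bump (2 * t) - bump t"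
definition wav' :: "real \<Rightarrow> real" where "wav' t = 4 * bump' (2 * t) - bump' t"

lemma DERIV_wav_int: "(wav_int has_real_derivative wav t) (at t)"
  unfolding wav_int_def[abs_def] wav_def
  by (auto intro!: derivative_eq_intros DERIV_chain'[where g = bump_int] DERIV_bump_int)

lemma DERIV_wav: "(wav has_real_derivative wav' t) (at t)"
  unfolding wav_def[abs_def] wav'_def
  by (auto intro!: derivative_eq_intros DERIV_chain'[where g = bump] DERIV_bump)

lemma continuous_on_wav: "continuous_on S wav"
  using DERIV_wav by (meson DERIV_isCont continuous_at_imp_continuous_on)
lemma continuous_on_wav': "continuous_on S wav'"
  unfolding wav'_def[abs_def]
  by (intro continuous_intros continuous_on_compose2[OF continuous_on_bump'[of UNIV]]) auto

lemma wav_int_zero: "\<bar>t\<bar> \<ge> 1 \<Longrightarrow> wav_int t = 0"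
  using bump_int_const[of t] bump_int_const[of "2*t"] bump_int_zero[of t] bump_int_zero[of "2*t"]
  unfolding wav_int_def by linarith
lemma wav_zero: "\<bar>t\<bar> \<ge> 1 \<Longrightarrow> wav t = 0"
  unfolding wav_def by (simp add: bump_zero)
lemma wav'_zero: "\<bar>t\<bar> \<ge> 1 \<Longrightarrow> wav' t = 0"
  unfolding wav'_def by (simp add: bump'_zero)

lemma bounded_of_support:
  fixes f :: "real \<Rightarrow> real"
  assumes "continuous_on {-1..1} f" "\<And>t. \<bar>t\<bar> \<ge> 1 \<Longrightarrow> f t = 0"
  shows "\<exists>M>0. \<forall>t. \<bar>f t\<bar> \<le> M"
proof -
  have "compact (f ` {-1..1})" using assms(1) by (intro compact_continuous_image) auto
  then obtain M where M: "M > 0" "\<And>t. t \<in> {-1..1} \<Longrightarrow> \<bar>f t\<bar> \<le> M"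
    using compact_imp_bounded bounded_pos by (metis imageI real_norm_def)
  have "\<bar>f t\<bar> \<le> M" for t
  proof (cases "\<bar>t\<bar> \<le> 1")
    case True then show ?thesis by (intro M(2)) auto
  next
    case False then show ?thesis using M(1) assms(2)[of t] by simp
  qed
  then show ?thesis using M by blast
qed

lemma kernel_bound:
  "\<exists>M\<ge>1. \<forall>t. \<bar>bump t\<bar> \<le> M \<and> \<bar>wav_int t\<bar> \<le> M \<and> \<bar>wav t\<bar> \<le> M \<and> \<bar>wav' t\<bar> \<le> M"
proof -
  have "continuous_on {-1..1} wav_int"
    using DERIV_wav_int by (meson DERIV_isCont continuous_at_imp_continuous_on)
  then obtain M1 where 1: "M1 > 0" "\<forall>t. \<bar>wav_int t\<bar> \<le> M1" using bounded_of_support wav_int_zero by blast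
  obtain M2 where 2: "M2 > 0" "\<forall>t. \<bar>wav t\<bar> \<le> M2" using bounded_of_support continuous_on_wav wav_zero by blast
  obtain M3 where 3: "M3 > 0" "\<forall>t. \<bar>wav' t\<bar> \<le> M3" using bounded_of_support continuous_on_wav' wav'_zero by blast
  obtain M4 where 4: "M4 > 0" "\<forall>t. \<bar>bump t\<bar> \<le> M4" using bounded_of_support continuous_on_bump bump_zero by blast
  show ?thesis
  proof (intro exI[of _ "1 + M1 + M2 + M3 + M4"] conjI allI)
    fix t
    show "\<bar>bump t\<bar> \<le> 1 + M1 + M2 + M3 + M4" using 4(2)[rule_format, of t] 1(1) 2(1) 3(1) by linarith
    show "\<bar>wav_int t\<bar> \<le> 1 + M1 + M2 + M3 + M4" using 1(2)[rule_format, of t] 4(1) 2(1) 3(1) by linarith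
    show "\<bar>wav t\<bar> \<le> 1 + M1 + M2 + M3 + M4" using 2(2)[rule_format, of t] 1(1) 4(1) 3(1) by linarith
    show "\<bar>wav' t\<bar> \<le> 1 + M1 + M2 + M3 + M4" using 3(2)[rule_format, of t] 1(1) 2(1) 4(1) by linarith
  qed (use 1 2 3 4 in simp)
qed

lemma bump_two_scale: "2^Suc n * bump (2^Suc n * t) - 2^n * bump (2^n * t) = 2^n * wav (2^n * t)"
  by (simp add: wav_def algebra_simps)

section \<open>Integration by parts in the parameter\<close>

lemma DERIV_at_imp_continuous_on:
  fixes f :: "real \<Rightarrow> real"
  assumes "\<And>x. x \<in> S \<Longrightarrow> (f has_real_derivative f' x) (at x)"
  shows "continuous_on S f"
  using assms by (meson DERIV_isCont continuous_at_imp_continuous_on)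

text \<open>Up to the factor d/\<Phi>', \<theta>((s + \<Phi>)/d) is the derivative of \<Theta>((s +
  \<Phi>)/d), and A vanishes at both ends; integrating by parts gains d/\<rho>. A second d/\<rho>
  comes from the support: \<Phi> moves with speed at least \<rho>, so |s + \<Phi>| <= d can hold
  only inside an interval of length 4d/\<rho>. Measuring \<Phi>'' relative to \<rho> keeps the
  remaining constant free of \<rho>.\<close>

lemma oscillatory_integral_bound:
  fixes \<Phi> \<Phi>' \<Phi>'' A A' \<Theta> \<theta> :: "real \<Rightarrow> real"
  assumes ab: "\<alpha> \<le> \<beta>" and d: "d > 0" and \<rho>: "\<rho> > 0" and L: "L \<ge> 0"
    and D: "\<And>l. l \<in> {\<alpha>..\<beta>} \<Longrightarrow> (\<Phi> has_real_derivative \<Phi>' l) (at l)"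
    and D': "\<And>l. l \<in> {\<alpha>..\<beta>} \<Longrightarrow> (\<Phi>' has_real_derivative \<Phi>'' l) (at l)"
    and DA: "\<And>l. l \<in> {\<alpha>..\<beta>} \<Longrightarrow> (A has_real_derivative A' l) (at l)"
    and cont: "continuous_on {\<alpha>..\<beta>} \<Phi>''" "continuous_on {\<alpha>..\<beta>} A'"
    and low: "\<And>l. l \<in> {\<alpha>..\<beta>} \<Longrightarrow> \<bar>\<Phi>' l\<bar> \<ge> \<rho>"
    and up: "\<And>l. l \<in> {\<alpha>..\<beta>} \<Longrightarrow> \<bar>\<Phi>'' l\<bar> \<le> L * \<rho>"
    and A: "\<And>l. l \<in> {\<alpha>..\<beta>} \<Longrightarrow> \<bar>A l\<bar> \<le> M \<and> \<bar>A' l\<bar> \<le> M" "A \<alpha> = 0" "A \<beta> = 0"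
    and D\<Theta>: "\<And>t. (\<Theta> has_real_derivative \<theta> t) (at t)" "continuous_on UNIV \<theta>"
    and supp: "\<And>t. \<bar>t\<bar> \<ge> 1 \<Longrightarrow> \<Theta> t = 0" and bd: "\<And>t. \<bar>\<Theta> t\<bar> \<le> M0"
  shows "\<bar>integral {\<alpha>..\<beta>} (\<lambda>l. A l * \<theta> ((s + \<Phi> l) / d))\<bar> \<le> M * (1 + L) * 4 * M0 * d^2 / \<rho>^2"
proof -
  have M: "M \<ge> 0" using A(1)[of \<alpha>] ab by force
  have M0: "M0 \<ge> 0" using bd[of 0] by linarith
  define g where "g = (\<lambda>l. A l / \<Phi>' l)"
  define g' where "g' = (\<lambda>l. (A' l * \<Phi>' l - A l * \<Phi>'' l) / (\<Phi>' l * \<Phi>' l))"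
  define T where "T = (\<lambda>l. \<Theta> ((s + \<Phi> l) / d))"
  have nz: "\<Phi>' l \<noteq> 0" if "l \<in> {\<alpha>..\<beta>}" for l using low[OF that] \<rho> by auto
  have Dg: "(g has_real_derivative g' l) (at l)" if "l \<in> {\<alpha>..\<beta>}" for l
    unfolding g_def g'_def using DERIV_divide[OF DA[OF that] D'[OF that] nz[OF that]] .
  have DT: "(T has_real_derivative \<theta> ((s + \<Phi> l) / d) * (\<Phi>' l / d)) (at l)" if "l \<in> {\<alpha>..\<beta>}" for l
    unfolding T_def
    by (rule DERIV_chain'[where g = \<Theta>, OF _ D\<Theta>(1)])
       (use D[OF that] d in \<open>auto intro!: derivative_eq_intros\<close>)
  have c: "continuous_on {\<alpha>..\<beta>} \<Phi>" "continuous_on {\<alpha>..\<beta>} \<Phi>'" "continuous_on {\<alpha>..\<beta>} A" "continuous_on {\<alpha>..\<beta>} T"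
    by (rule DERIV_at_imp_continuous_on, erule D D' DA DT)+
  have cg': "continuous_on {\<alpha>..\<beta>} g'" unfolding g'_def
    by (intro continuous_intros c cont) (use nz in auto)
  have c\<theta>: "continuous_on {\<alpha>..\<beta>} (\<lambda>l. A l * \<theta> ((s + \<Phi> l) / d))"
    using d by (intro continuous_intros c continuous_on_compose2[OF D\<Theta>(2)]) auto
  have "((\<lambda>l. g' l * T l + \<theta> ((s + \<Phi> l) / d) * (\<Phi>' l / d) * g l) has_integral (g \<beta> * T \<beta> - g \<alpha> * T \<alpha>)) {\<alpha>..\<beta>}"
    by (rule fundamental_theorem_of_calculus[OF ab])
       (use DERIV_mult[OF Dg DT] in \<open>auto simp: has_real_derivative_iff_has_vector_derivative[symmetric] intro: has_field_derivative_at_within\<close>)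
  then have "((\<lambda>l. g' l * T l + \<theta> ((s + \<Phi> l) / d) * (\<Phi>' l / d) * g l) has_integral 0) {\<alpha>..\<beta>}"
    using A by (simp add: g_def)
  then have "((\<lambda>l. g' l * T l + A l * \<theta> ((s + \<Phi> l) / d) / d) has_integral 0) {\<alpha>..\<beta>}"
    by (rule has_integral_eq[rotated]) (use nz in \<open>auto simp: g_def\<close>)
  moreover have "((\<lambda>l. g' l * T l) has_integral integral {\<alpha>..\<beta>} (\<lambda>l. g' l * T l)) {\<alpha>..\<beta>}"
    by (intro integrable_integral integrable_continuous_interval continuous_intros cg' c)
  ultimately have "((\<lambda>l. g' l * T l + A l * \<theta> ((s + \<Phi> l) / d) / d - g' l * T l) has_integral
      0 - integral {\<alpha>..\<beta>} (\<lambda>l. g' l * T l)) {\<alpha>..\<beta>}" by (rule has_integral_diff)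
  then have "((\<lambda>l. d * (A l * \<theta> ((s + \<Phi> l) / d) / d)) has_integral
      d * (- integral {\<alpha>..\<beta>} (\<lambda>l. g' l * T l))) {\<alpha>..\<beta>}"
    by (intro has_integral_mult_right) simp
  then have eq: "integral {\<alpha>..\<beta>} (\<lambda>l. A l * \<theta> ((s + \<Phi> l) / d)) = d * (- integral {\<alpha>..\<beta>} (\<lambda>l. g' l * T l))"
    using d by (simp add: integral_unique)
  define K where "K = M * (1 + L) / \<rho> * M0"
  have K0: "K \<ge> 0" unfolding K_def using M M0 L \<rho> by simp
  have g'b: "\<bar>g' l\<bar> \<le> M * (1 + L) / \<rho>" if l: "l \<in> {\<alpha>..\<beta>}" for l
  proof -
    define p where "p = \<bar>\<Phi>' l\<bar>"
    have p: "p \<ge> \<rho>" "p > 0" using low[OF l] \<rho> by (auto simp: p_def)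
    have "\<bar>A' l * \<Phi>' l - A l * \<Phi>'' l\<bar> \<le> \<bar>A' l\<bar> * p + \<bar>A l\<bar> * \<bar>\<Phi>'' l\<bar>"
      unfolding p_def abs_mult[symmetric] by linarith
    also have "\<dots> \<le> M * p + M * (L * p)"
      using A(1)[OF l] up[OF l] p L M mult_left_mono[OF p(1) L]
      by (intro add_mono mult_mono) auto
    finally have "\<bar>g' l\<bar> \<le> (M * p + M * (L * p)) / (p * p)"
      unfolding g'_def abs_divide p_def abs_mult by (intro divide_right_mono) auto
    also have "\<dots> = M * (1 + L) / p" using p by (simp add: field_simps)
    also have "\<dots> \<le> M * (1 + L) / \<rho>" using p \<rho> M L by (intro divide_left_mono) auto
    finally show ?thesis .
  qed
  have b: "\<bar>integral {\<alpha>..\<beta>} (\<lambda>l. g' l * T l)\<bar> \<le> K * (4 * d / \<rho>)"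
  proof (cases "\<exists>l1\<in>{\<alpha>..\<beta>}. \<bar>s + \<Phi> l1\<bar> \<le> d")
    case False
    then have "T l = 0" if "l \<in> {\<alpha>..\<beta>}" for l
      unfolding T_def using d that by (intro supp) (force simp: abs_divide)
    then have "integral {\<alpha>..\<beta>} (\<lambda>l. g' l * T l) = integral {\<alpha>..\<beta>} (\<lambda>_. 0)"
      by (intro integral_cong) simp
    then show ?thesis using K0 d \<rho> by simp
  next
    case True
    then obtain l1 where l1: "l1 \<in> {\<alpha>..\<beta>}" "\<bar>s + \<Phi> l1\<bar> \<le> d" by blast
    \<comment> \<open>\<open>l1\<close> is a point where the kernel may be active. Beyond distance
      2d/\<rho> from it \<Phi> has changed by more than 2d, so |s + \<Phi>| > d and \<open>T\<close>
      vanishes.\<close>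
    define u where "u = l1 - 2 * d / \<rho>"
    define v where "v = l1 + 2 * d / \<rho>"
    have mvt: "\<rho> * \<bar>x - y\<bar> \<le> \<bar>\<Phi> x - \<Phi> y\<bar>" if xy: "x \<in> {\<alpha>..\<beta>}" "y \<in> {\<alpha>..\<beta>}" "x < y" for x y
    proof -
      obtain z where z: "x < z" "z < y" "\<Phi> y - \<Phi> x = (y - x) * \<Phi>' z"
        using MVT2[OF xy(3), of \<Phi> \<Phi>'] D xy by auto
      have "\<rho> * (y - x) \<le> \<bar>\<Phi>' z\<bar> * (y - x)" using low[of z] z xy by (intro mult_right_mono) auto
      also have "\<dots> = \<bar>\<Phi> y - \<Phi> x\<bar>" using z xy by (simp add: abs_mult)
      finally show ?thesis using xy by (simp add: abs_minus_commute)
    qed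
    have sep: "\<rho> * \<bar>l - l1\<bar> \<le> \<bar>\<Phi> l - \<Phi> l1\<bar>" if "l \<in> {\<alpha>..\<beta>}" for l
      using mvt[OF that l1(1)] mvt[OF l1(1) that] by (cases l l1 rule: linorder_cases) (auto simp: abs_minus_commute)
    have bound: "\<bar>g' l * T l\<bar> \<le> (if l \<in> {u..v} then K else 0)" if l: "l \<in> {\<alpha>..\<beta>}" for l
    proof (cases "l \<in> {u..v}")
      case True
      have "\<bar>g' l\<bar> * \<bar>T l\<bar> \<le> M * (1 + L) / \<rho> * M0"
        using g'b[OF l] bd M L \<rho> by (intro mult_mono) (auto simp: T_def)
      then show ?thesis using True by (simp add: abs_mult K_def)
    next
      case False
      then have "\<bar>l - l1\<bar> > 2 * d / \<rho>" by (auto simp: u_def v_def)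
      then have "\<rho> * \<bar>l - l1\<bar> > 2 * d" using \<rho> by (simp add: field_simps)
      then have "\<bar>s + \<Phi> l\<bar> > d" using sep[OF l] l1(2) by linarith
      then have "T l = 0" unfolding T_def using d by (intro supp) (simp add: abs_divide)
      then show ?thesis using K0 by simp
    qed
    have "norm (integral {\<alpha>..\<beta>} (\<lambda>l. g' l * T l)) \<le> integral {\<alpha>..\<beta>} (\<lambda>l. if l \<in> {u..v} then K else 0)"
    proof (rule Henstock_Kurzweil_Integration.integral_norm_bound_integral)
      show "(\<lambda>l. g' l * T l) integrable_on {\<alpha>..\<beta>}"
        by (intro integrable_continuous_interval continuous_intros cg' c)
      show "(\<lambda>l. if l \<in> {u..v} then K else 0) integrable_on {\<alpha>..\<beta>}"
        unfolding integrable_restrict_Int by (simp add: integrable_const_ivl)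
    qed (use bound in auto)
    also have "\<dots> = integral {max \<alpha> u..min \<beta> v} (\<lambda>_. K)"
      by (simp only: integral_restrict_Int Int_atLeastAtMost max.commute min.commute)
    also have "\<dots> \<le> K * (v - u)"
    proof -
      have "u \<le> v" using \<rho> d by (simp add: u_def v_def)
      then have "measure lborel {max \<alpha> u..min \<beta> v} \<le> v - u" by (auto simp: content_real_if)
      then show ?thesis using K0 by (simp add: integral_const_real mult.commute[of K] mult_right_mono)
    qed
    finally show ?thesis by (simp add: u_def v_def)
  qed
  have "\<bar>integral {\<alpha>..\<beta>} (\<lambda>l. A l * \<theta> ((s + \<Phi> l) / d))\<bar> \<le> d * (K * (4 * d / \<rho>))"
  proof -
    have "\<bar>d\<bar> * \<bar>- integral {\<alpha>..\<beta>} (\<lambda>l. g' l * T l)\<bar> \<le> d * (K * (4 * d / \<rho>))"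
      using mult_left_mono[OF b, of d] d by simp
    then show ?thesis unfolding eq abs_mult .
  qed
  also have "\<dots> = M * (1 + L) * 4 * M0 * d^2 / \<rho>^2"
    unfolding K_def using \<rho> by (simp add: field_simps power2_eq_square)
  finally show ?thesis .
qed

section \<open>Transversal families\<close>

text \<open>The maximum metric: its balls are squares, so the ball condition for a product of
  weights factors.\<close>

definition pdist :: "real \<times> real \<Rightarrow> real \<times> real \<Rightarrow> real" where
  "pdist x y = max \<bar>fst x - fst y\<bar> \<bar>snd x - snd y\<bar>"

lemma pdist_nonneg: "pdist x y \<ge> 0" by (simp add: pdist_def le_max_iff_disj)

section \<open>Schur's test over dyadic distances\<close>

lemma dyadic_scale:
  fixes r :: real
  assumes "r \<le> 1"
  shows "r \<le> 1/2^n \<or> (\<exists>k<n. 1/2^Suc k < r \<and> r \<le> 1/2^k)"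
proof (induction n)
  case (Suc n)
  then show ?case by (meson less_Suc_eq not_le)
qed (use assms in simp)

text \<open>Replaces min(C, C/(r^2 4^n)) by a combination of indicators of balls, which can be
  summed against weights obeying a ball condition. The shell 1/2^Suc k < r \<le> 1/2^k needs the
  coefficient 4^k/4^n; the factor 4 is the variation of r^2 across one shell.\<close>

lemma le_dyadic_sum:
  fixes r v C :: real
  assumes "0 \<le> r" "r \<le> 1" "v \<le> C" "v * (r^2 * 4^n) \<le> C" "C \<ge> 0"
  shows "v \<le> 4 * C * (\<Sum>k\<le>n. 4^k/4^n * (if r \<le> 1/2^k then 1 else 0))"
proof -
  let ?f = "\<lambda>k. 4^k/4^n * (if r \<le> 1/2^k then 1 else (0::real))"
  have ge: "?f k \<le> (\<Sum>k\<le>n. ?f k)" if "k \<le> n" for k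
    by (rule member_le_sum) (use that in auto)
  from dyadic_scale[OF assms(2), of n] show ?thesis
  proof
    assume "r \<le> 1/2^n"
    then have "1 \<le> (\<Sum>k\<le>n. ?f k)" using ge[of n] by simp
    then have "4 * C * 1 \<le> 4 * C * (\<Sum>k\<le>n. ?f k)" using assms by (intro mult_left_mono) auto
    then show ?thesis using assms by linarith
  next
    assume "\<exists>k<n. 1/2^Suc k < r \<and> r \<le> 1/2^k"
    then obtain k where k: "k < n" "1/2^Suc k < r" "r \<le> 1/2^k" by blast
    have "(1/2^Suc k)^2 \<le> r^2" using k by (intro power_mono) auto
    then have r2: "1 \<le> 4 * 4^k * r^2" by (simp add: power_divide power_mult[symmetric] power_mult_distrib field_simps power2_eq_square)
      (simp add: power_mult_distrib[symmetric])
    have "v \<le> 4 * C * (4^k/4^n)"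
    proof (cases "v \<ge> 0")
      case True
      have "v * 1 \<le> v * (4 * 4^k * r^2)" using r2 True by (intro mult_left_mono) auto
      also have "\<dots> = 4 * (v * (r^2 * 4^n)) * (4^k / 4^n)" by simp
      also have "\<dots> \<le> 4 * C * (4^k / 4^n)" using assms(4) by (intro mult_right_mono) auto
      finally show ?thesis by simp
    next
      case False
      have "0 \<le> 4 * C * (4^k / 4^n)" using assms(5) by simp
      then show ?thesis using False by linarith
    qed
    also have "\<dots> \<le> 4 * C * (\<Sum>k\<le>n. ?f k)" using ge[of k] k assms by (intro mult_left_mono) auto
    finally show ?thesis .
  qed
qed

text \<open>The terms are q^k/4^n with q = 2 powr (2 - s) > 1, so the last one dominates the
  sum.\<close>

lemma geometric_dyadic_sum:
  fixes s :: real
  assumes "s < 2"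
  shows "(\<Sum>k\<le>n. 4^k/4^n * (1/2^k) powr s) \<le> (2 powr (2-s) / (2 powr (2-s) - 1)) * (1/2^n) powr s"
proof -
  define q :: real where "q = 2 powr (2 - s)"
  have q: "q > 1" using assms by (simp add: q_def)
  have e: "4^k * (1/2^k) powr s = q^k" for k :: nat
  proof -
    have "(4::real)^k = 2 powr (2 * real k)" by (simp add: powr_mult powr_realpow power_mult powr_powr[symmetric])
    moreover have "(1/2^k) powr s = 2 powr (- (real k * s))"
      by (simp add: powr_minus[symmetric] powr_powr divide_inverse flip: powr_realpow powr_minus)
    ultimately show ?thesis
      unfolding q_def by (simp add: powr_add[symmetric] powr_powr algebra_simps flip: powr_realpow)
  qed
  have "(\<Sum>k\<le>n. 4^k/4^n * (1/2^k) powr s) = (\<Sum>k\<le>n. q^k) / 4^n"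
    unfolding sum_divide_distrib by (intro sum.cong) (simp_all add: e[symmetric])
  also have "(\<Sum>k\<le>n. q^k) \<le> q / (q - 1) * q^n"
  proof -
    have "(\<Sum>k\<le>n. q^k) = (q^Suc n - 1) / (q - 1)"
      unfolding lessThan_Suc_atMost[symmetric] using q by (intro geometric_sum) auto
    also have "\<dots> \<le> q^Suc n / (q - 1)" using q by (intro divide_right_mono) auto
    finally show ?thesis by simp
  qed
  then have "(\<Sum>k\<le>n. q^k) / 4^n \<le> q / (q - 1) * q^n / 4^n" by (intro divide_right_mono) auto
  also have "\<dots> = q / (q - 1) * (1/2^n) powr s" by (simp add: e[symmetric])
  finally show ?thesis by (simp add: q_def)
qed

text \<open>The ball condition bounds every row sum of the interaction uniformly; since the total
  weight is at most 1, the row bound is also a bound for the double sum.\<close>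

lemma schur_sum:
  fixes w :: "real \<times> real \<Rightarrow> real" and V :: "real \<times> real \<Rightarrow> real \<times> real \<Rightarrow> real"
  assumes P: "finite P" and w: "\<And>x. 0 \<le> w x" "sum w P \<le> 1" and s: "s < 2" and C: "C \<ge> 0" "K \<ge> 0"
    and mass: "\<And>x k. k \<le> n \<Longrightarrow> (\<Sum>y\<in>{y\<in>P. pdist x y \<le> 1/2^k}. w y) \<le> K * (1/2^k) powr s"
    and V: "\<And>x y. x \<in> P \<Longrightarrow> y \<in> P \<Longrightarrow> pdist x y \<le> 1 \<and> V x y \<le> C \<and> V x y * ((pdist x y)^2 * 4^n) \<le> C"
  shows "(\<Sum>x\<in>P. \<Sum>y\<in>P. w x * w y * V x y) \<le>
    4 * C * K * (2 powr (2-s) / (2 powr (2-s) - 1)) * (1/2^n) powr s"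
proof -
  define Q where "Q = 4 * C * K * (2 powr (2-s) / (2 powr (2-s) - 1)) * (1/2^n) powr s"
  have "2 powr (2 - s) > 1" using s by simp
  then have Q0: "Q \<ge> 0" unfolding Q_def using C by (intro mult_nonneg_nonneg divide_nonneg_nonneg) auto
  have row: "(\<Sum>y\<in>P. w y * V x y) \<le> Q" if x: "x \<in> P" for x
  proof -
    have "(\<Sum>y\<in>P. w y * V x y) \<le>
      (\<Sum>y\<in>P. w y * (4 * C * (\<Sum>k\<le>n. 4^k/4^n * (if pdist x y \<le> 1/2^k then 1 else 0))))"
      using V[OF x] w C by (intro sum_mono mult_left_mono le_dyadic_sum pdist_nonneg) auto
    also have "\<dots> = 4 * C * (\<Sum>k\<le>n. 4^k/4^n * (\<Sum>y\<in>P. if pdist x y \<le> 1/2^k then w y else 0))"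
      unfolding sum_distrib_left by (subst sum.swap) (auto intro!: sum.cong)
    also have "\<dots> \<le> 4 * C * (\<Sum>k\<le>n. 4^k/4^n * (K * (1/2^k) powr s))"
    proof (intro mult_left_mono sum_mono)
      fix k assume "k \<in> {..n}"
      then have "(\<Sum>y\<in>{y\<in>P. pdist x y \<le> 1/2^k}. w y) \<le> K * (1/2^k) powr s" by (intro mass) auto
      then show "(\<Sum>y\<in>P. if pdist x y \<le> 1/2^k then w y else 0) \<le> K * (1/2^k) powr s"
        using P by (simp add: sum.inter_filter)
    qed (use C in auto)
    also have "\<dots> = 4 * C * K * (\<Sum>k\<le>n. 4^k/4^n * (1/2^k) powr s)"
      by (simp add: sum_distrib_left mult_ac)
    also have "\<dots> \<le> Q"
      unfolding Q_def mult.assoc[of "4 * C * K"] using geometric_dyadic_sum[OF s, of n] C by (intro mult_left_mono) auto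
    finally show ?thesis .
  qed
  have "(\<Sum>x\<in>P. \<Sum>y\<in>P. w x * w y * V x y) = (\<Sum>x\<in>P. w x * (\<Sum>y\<in>P. w y * V x y))"
    by (simp add: sum_distrib_left mult.assoc)
  also have "\<dots> \<le> (\<Sum>x\<in>P. w x * Q)" using row w by (intro sum_mono mult_left_mono) auto
  also have "\<dots> = sum w P * Q" by (simp add: sum_distrib_right)
  also have "\<dots> \<le> 1 * Q" using w Q0 by (intro mult_right_mono) auto
  finally show ?thesis by (simp add: Q_def)
qed

text \<open>The parametrised family \<open>h l\<close> of maps of the plane plays the role of the projections; \<open>transversal\<close>
  says that the direction of \<open>h l\<close> rotates with \<open>l\<close>.\<close>

locale transversal_family =
  fixes h h1 h11 :: "real \<Rightarrow> real \<times> real \<Rightarrow> real" and B :: "(real \<times> real) set" and a \<rho> M c :: real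
  assumes \<rho>: "\<rho> > 0" and M: "M \<ge> 1" and c: "c > 0" and small: "4 * M * \<rho> \<le> c"
    and D1: "\<And>l x. l \<in> {a-\<rho>..a+\<rho>} \<Longrightarrow> x \<in> B \<Longrightarrow> ((\<lambda>l. h l x) has_real_derivative h1 l x) (at l)"
    and D2: "\<And>l x. l \<in> {a-\<rho>..a+\<rho>} \<Longrightarrow> x \<in> B \<Longrightarrow> ((\<lambda>l. h1 l x) has_real_derivative h11 l x) (at l)"
    and cont: "\<And>x. x \<in> B \<Longrightarrow> continuous_on {a-\<rho>..a+\<rho>} (\<lambda>l. h11 l x)"
    and bound: "\<And>l x. l \<in> {a-\<rho>..a+\<rho>} \<Longrightarrow> x \<in> B \<Longrightarrow> \<bar>h l x\<bar> \<le> M \<and> \<bar>h1 l x\<bar> \<le> M \<and> \<bar>h11 l x\<bar> \<le> M"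
    and lip: "\<And>l x y. l \<in> {a-\<rho>..a+\<rho>} \<Longrightarrow> x \<in> B \<Longrightarrow> y \<in> B \<Longrightarrow>
      \<bar>h1 l x - h1 l y\<bar> \<le> M * pdist x y \<and> \<bar>h11 l x - h11 l y\<bar> \<le> M * pdist x y"
    and transversal: "\<And>x y. x \<in> B \<Longrightarrow> y \<in> B \<Longrightarrow>
      c * pdist x y \<le> \<bar>h a x - h a y\<bar> + \<bar>h1 a x - h1 a y\<bar>"
    and diam: "\<And>x y. x \<in> B \<Longrightarrow> y \<in> B \<Longrightarrow> pdist x y \<le> 1"
begin

abbreviation "J \<equiv> {a-\<rho>..a+\<rho>}"

text \<open>Vanishes at both ends of \<open>J\<close>, so that integration by parts has no boundary
  terms, and is bounded below on the middle half of \<open>J\<close>, where the parameter weights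
  act.\<close>

definition cutoff :: "real \<Rightarrow> real" where "cutoff l = \<rho>^2 - (l - a)^2"

lemma cutoff_nonneg: "l \<in> J \<Longrightarrow> 0 \<le> cutoff l"
  unfolding cutoff_def by (simp add: abs_le_square_iff[symmetric] abs_le_iff)

text \<open>The interaction of x and y at scale d = 1/2^n; times the factor 2^n left by the two
  kernels, it is of order min(1/d, d/r^2). The shift \<sigma> is the variable that remains when two
  kernels are correlated in t, and \<open>amp\<close> will be 1 or \<open>h1\<close>.\<close>

lemma kernel_estimate:
  fixes amp amp' :: "real \<Rightarrow> real \<times> real \<Rightarrow> real" and \<Theta> \<theta> :: "real \<Rightarrow> real"
  assumes amp: "\<And>l x. l \<in> J \<Longrightarrow> x \<in> B \<Longrightarrow> ((\<lambda>l. amp l x) has_real_derivative amp' l x) (at l)"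
      "\<And>x. x \<in> B \<Longrightarrow> continuous_on J (\<lambda>l. amp' l x)"
      "\<And>l x. l \<in> J \<Longrightarrow> x \<in> B \<Longrightarrow> \<bar>amp l x\<bar> \<le> M \<and> \<bar>amp' l x\<bar> \<le> M"
    and \<Theta>: "\<And>t. (\<Theta> has_real_derivative \<theta> t) (at t)" "continuous_on UNIV \<theta>"
      "\<And>t. \<bar>t\<bar> \<ge> 1 \<Longrightarrow> \<Theta> t = 0" "\<And>t. \<bar>t\<bar> \<ge> 1 \<Longrightarrow> \<theta> t = 0"
      "\<And>t. \<bar>\<Theta> t\<bar> \<le> M0" "\<And>t. \<bar>\<theta> t\<bar> \<le> M0"
  shows "\<exists>C\<ge>0. \<forall>x\<in>B. \<forall>y\<in>B. \<forall>n \<sigma>. \<bar>\<sigma>\<bar> \<le> 1 \<longrightarrow>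
     (let I = \<bar>integral J (\<lambda>l. cutoff l * amp l x * amp l y * \<theta> (\<sigma> + 2^n * (h l x - h l y)))\<bar>
      in I \<le> C \<and> I * ((pdist x y)^2 * 4^n) \<le> C)"
proof -
  let ?I = "\<lambda>n \<sigma> x y. integral J (\<lambda>l. cutoff l * amp l x * amp l y * \<theta> (\<sigma> + 2^n * (h l x - h l y)))"
  have M0: "M0 \<ge> 0" using \<Theta>(5)[of 0] by linarith
  \<comment> \<open>Bounds the amplitude and its derivative: |A| <= \<rho>^2 M^2 and |A'| <= 2
    \<rho> M^2 + 2 \<rho>^2 M^2.\<close>
  define K where "K = 2 * \<rho> * M * M + 2 * \<rho>^2 * M * M"
  have K0: "K \<ge> 0" unfolding K_def using \<rho> M by simp
  define C1 where "C1 = K * M0 * (2 * \<rho>)"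
  define C2 where "C2 = K * (1 + 4 * M / c) * 4 * M0 * 16 / c^2"
  define C where "C = C1 + C1 * (64 / c^2) + C2"
  have C0: "C1 \<ge> 0" "C2 \<ge> 0" using K0 M0 \<rho> c M by (auto simp: C1_def C2_def)
  have main: "\<bar>?I n \<sigma> x y\<bar> \<le> C1 \<and>
    \<bar>?I n \<sigma> x y\<bar> * ((pdist x y)^2 * 4^n) \<le> C"
    if x: "x \<in> B" and y: "y \<in> B" and \<sigma>: "\<bar>\<sigma>\<bar> \<le> 1" for x y n \<sigma>
  proof -
    define r where "r = pdist x y"
    have r0: "r \<ge> 0" by (simp add: r_def pdist_nonneg)
    define A where "A = (\<lambda>l. cutoff l * amp l x * amp l y)"
    define A' where "A' = (\<lambda>l. (- (2 * (l - a)) * amp l x + cutoff l * amp' l x) * amp l y + cutoff l * amp l x * amp' l y)"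
    have DA: "(A has_real_derivative A' l) (at l)" if "l \<in> J" for l
      unfolding A_def A'_def cutoff_def
      by (rule derivative_eq_intros refl amp(1)[OF that x] amp(1)[OF that y])+ (simp add: algebra_simps)
    have camp: "continuous_on J (\<lambda>l. amp l z)" if "z \<in> B" for z
      by (rule DERIV_at_imp_continuous_on) (rule amp(1)[OF _ that])
    have cA': "continuous_on J A'" unfolding A'_def cutoff_def
      by (intro continuous_intros camp amp(2) x y)
    have co: "0 \<le> cutoff l" "cutoff l \<le> \<rho>^2" "\<bar>l - a\<bar> \<le> \<rho>" if "l \<in> J" for l
      using cutoff_nonneg[OF that] that by (auto simp: cutoff_def)
    have bA: "\<bar>A l\<bar> \<le> K \<and> \<bar>A' l\<bar> \<le> K" if l: "l \<in> J" for l
    proof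
      have "\<bar>A l\<bar> = cutoff l * \<bar>amp l x\<bar> * \<bar>amp l y\<bar>" using co[OF l] by (simp add: A_def abs_mult)
      also have "\<dots> \<le> \<rho>^2 * M * M" using co[OF l] amp(3)[OF l x] amp(3)[OF l y] M
        by (intro mult_mono) auto
      also have "\<dots> \<le> K" unfolding K_def using \<rho> M by simp
      finally show "\<bar>A l\<bar> \<le> K" .
      have "\<bar>A' l\<bar> \<le> (2 * \<bar>l - a\<bar> * \<bar>amp l x\<bar> + cutoff l * \<bar>amp' l x\<bar>) * \<bar>amp l y\<bar> + cutoff l * \<bar>amp l x\<bar> * \<bar>amp' l y\<bar>"
      proof -
        have "\<bar>- (2 * (l - a)) * amp l x + cutoff l * amp' l x\<bar> \<le> \<bar>- (2 * (l - a)) * amp l x\<bar> + \<bar>cutoff l * amp' l x\<bar>"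
          by (rule abs_triangle_ineq)
        also have "\<dots> = 2 * \<bar>l - a\<bar> * \<bar>amp l x\<bar> + cutoff l * \<bar>amp' l x\<bar>"
          unfolding abs_mult abs_minus_cancel using co(1)[OF l] by simp
        finally have 1: "\<bar>- (2 * (l - a)) * amp l x + cutoff l * amp' l x\<bar> * \<bar>amp l y\<bar> \<le>
          (2 * \<bar>l - a\<bar> * \<bar>amp l x\<bar> + cutoff l * \<bar>amp' l x\<bar>) * \<bar>amp l y\<bar>"
          by (rule mult_right_mono) simp
        have "\<bar>cutoff l * amp l x * amp' l y\<bar> = cutoff l * \<bar>amp l x\<bar> * \<bar>amp' l y\<bar>"
          unfolding abs_mult using co(1)[OF l] by simp
        with 1 show ?thesis unfolding A'_def
          using abs_triangle_ineq[of "(- (2 * (l - a)) * amp l x + cutoff l * amp' l x) * amp l y" "cutoff l * amp l x * amp' l y"]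
          unfolding abs_mult[of "- (2 * (l - a)) * amp l x + cutoff l * amp' l x" "amp l y"] by linarith
      qed
      also have "\<dots> \<le> (2 * \<rho> * M + \<rho>^2 * M) * M + \<rho>^2 * M * M"
        using co[OF l] amp(3)[OF l x] amp(3)[OF l y] M \<rho>
        by (intro add_mono mult_mono) auto
      also have "\<dots> = K" unfolding K_def by (simp add: algebra_simps)
      finally show "\<bar>A' l\<bar> \<le> K" .
    qed
    have ch: "continuous_on J (\<lambda>l. h l z)" if "z \<in> B" for z
      by (rule DERIV_at_imp_continuous_on) (rule D1[OF _ that])
    define I where "I = \<bar>integral J (\<lambda>l. A l * \<theta> (\<sigma> + 2^n * (h l x - h l y)))\<bar>"
    have "norm (integral J (\<lambda>l. A l * \<theta> (\<sigma> + 2^n * (h l x - h l y)))) \<le> (K * M0) * (a + \<rho> - (a - \<rho>))"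
    proof (rule integral_bound)
      show "continuous_on J (\<lambda>l. A l * \<theta> (\<sigma> + 2^n * (h l x - h l y)))"
        by (intro continuous_intros continuous_on_compose2[OF \<Theta>(2)] ch x y DERIV_at_imp_continuous_on[OF DA]) auto
      fix l assume "l \<in> J"
      then show "norm (A l * \<theta> (\<sigma> + 2^n * (h l x - h l y))) \<le> K * M0"
        using bA[of l] \<Theta>(6) K0 unfolding real_norm_def abs_mult by (intro mult_mono) auto
    qed (use \<rho> in auto)
    then have triv: "I \<le> C1" by (simp add: I_def C1_def)
    have I0: "I \<ge> 0" by (simp add: I_def)
    have "I * (r^2 * 4^n) \<le> C"
    proof (cases "r = 0")
      case True then show ?thesis using C0 by (simp add: C_def)
    next
      case False
      then have r: "r > 0" using r0 by simp
      \<comment> \<open>Transversality is assumed at the centre only. A difference with derivative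
        at most M r moves by at most M r \<rho> <= c r/4 over \<open>J\<close>, so a lower bound c
        r/2 at \<open>a\<close> persists as c r/4.\<close>
      have MVT: "\<bar>g l - g a\<bar> \<le> c * r / 4"
        if g: "\<And>l. l \<in> J \<Longrightarrow> (g has_real_derivative g' l) (at l)" "\<And>l. l \<in> J \<Longrightarrow> \<bar>g' l\<bar> \<le> M * r" and l: "l \<in> J"
        for g g' l
      proof -
        have "norm (g l - g a) \<le> (M * r) * norm (l - a)"
          by (rule field_differentiable_bound[where S = J and f' = g'])
             (use g l \<rho> in \<open>auto intro: has_field_derivative_at_within\<close>)
        also have "\<dots> \<le> (M * r) * \<rho>" using l M r by (intro mult_left_mono) auto
        also have "\<dots> \<le> c * r / 4" using small r mult_right_mono[of "4*M*\<rho>" c r] by simp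
        finally show ?thesis by simp
      qed
      have D\<Phi>: "((\<lambda>l. h l x - h l y) has_real_derivative h1 l x - h1 l y) (at l)"
        "((\<lambda>l. h1 l x - h1 l y) has_real_derivative h11 l x - h11 l y) (at l)" if "l \<in> J" for l
        by (intro DERIV_diff D1 D2 that x y)+
      have lip': "\<bar>h1 l x - h1 l y\<bar> \<le> M * r" "\<bar>h11 l x - h11 l y\<bar> \<le> M * r" if "l \<in> J" for l
        using lip[OF that x y] by (auto simp: r_def)
      have "c * r \<le> \<bar>h a x - h a y\<bar> + \<bar>h1 a x - h1 a y\<bar>" unfolding r_def by (rule transversal[OF x y])
      then consider "\<bar>h a x - h a y\<bar> \<ge> c * r / 2" | "\<bar>h1 a x - h1 a y\<bar> \<ge> c * r / 2" by linarith
      then show ?thesis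
      proof cases
        case 1
        have low: "\<bar>h l x - h l y\<bar> \<ge> c * r / 4" if l: "l \<in> J" for l
          using MVT[OF D\<Phi>(1) lip'(1) l] 1 by linarith
        show ?thesis
        \<comment> \<open>If the values differ by at least 2/2^n throughout, the argument of
          \<theta> leaves its support, as |\<sigma>| <= 1. Otherwise r^2 4^n <= 64/c^2 and the
          trivial bound suffices.\<close>
        proof (cases "2^n * (c * r / 4) \<ge> 2")
          case True
          have "A l * \<theta> (\<sigma> + 2^n * (h l x - h l y)) = 0" if l: "l \<in> J" for l
          proof -
            have "2^n * (c * r / 4) \<le> 2^n * \<bar>h l x - h l y\<bar>" using low[OF l] by (intro mult_left_mono) auto
            moreover have "\<bar>2^n * (h l x - h l y)\<bar> = 2^n * \<bar>h l x - h l y\<bar>" by (simp add: abs_mult)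
            ultimately have "\<bar>2^n * (h l x - h l y)\<bar> \<ge> 2" using True by linarith
            then have "\<bar>\<sigma> + 2^n * (h l x - h l y)\<bar> \<ge> 1" using \<sigma> by linarith
            then show ?thesis by (simp add: \<Theta>(4))
          qed
          then have "I = \<bar>integral J (\<lambda>_. 0)\<bar>" unfolding I_def by (intro arg_cong[where f = abs] integral_cong) auto
          then show ?thesis using C0 by (simp add: C_def)
        next
          case False
          then have "2^n * r \<le> 8 / c" using c by (simp add: field_simps)
          then have "(2^n * r)^2 \<le> (8 / c)^2" using r by (intro power_mono) auto
          moreover have "((2::real)^n)^2 = 4^n" by (simp add: power2_eq_square flip: power_mult_distrib)
          ultimately have "r^2 * 4^n \<le> 64 / c^2" by (simp add: power_mult_distrib power_divide mult.commute)
          then have "I * (r^2 * 4^n) \<le> C1 * (64 / c^2)" using triv I0 C0 by (intro mult_mono) auto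
          then show ?thesis using C0 by (simp add: C_def)
        qed
      next
        case 2
        have low: "\<bar>h1 l x - h1 l y\<bar> \<ge> c * r / 4" if l: "l \<in> J" for l
          using MVT[OF D\<Phi>(2) lip'(2) l] 2 by linarith
        have "\<sigma> + 2^n * z = (\<sigma> / 2^n + z) / (1/2^n)" for z by (simp add: field_simps)
        then have "I = \<bar>integral J (\<lambda>l. A l * \<theta> ((\<sigma> / 2^n + (h l x - h l y)) / (1/2^n)))\<bar>"
          unfolding I_def by (simp only:)
        \<comment> \<open>The phase has speed at least c r/4, and its second derivative is at most M
          r = (4M/c) (c r/4).\<close>
        also have "\<dots> \<le> K * (1 + 4 * M / c) * 4 * M0 * (1/2^n)^2 / (c * r / 4)^2"
        proof (rule oscillatory_integral_bound[where \<Phi> = "\<lambda>l. h l x - h l y" and \<Phi>' = "\<lambda>l. h1 l x - h1 l y"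
              and \<Phi>'' = "\<lambda>l. h11 l x - h11 l y" and A = A and A' = A' and \<Theta> = \<Theta>])
          show "continuous_on J (\<lambda>l. h11 l x - h11 l y)" by (intro continuous_intros cont x y)
          show "\<bar>h11 l x - h11 l y\<bar> \<le> 4 * M / c * (c * r / 4)" if "l \<in> J" for l
            using lip'(2)[OF that] c by simp
          show "A (a - \<rho>) = 0" "A (a + \<rho>) = 0" by (simp_all add: A_def cutoff_def)
        qed (use \<rho> c r M D\<Phi> DA cA' low bA \<Theta> M0 in auto)
        finally have "I * (r^2 * 4^n) \<le> K * (1 + 4 * M / c) * 4 * M0 * (1/2^n)^2 / (c * r / 4)^2 * (r^2 * 4^n)"
          by (intro mult_right_mono) auto
        also have "\<dots> = C2"
        proof -
          have "((2::real)^n)^2 = 4^n" by (simp add: power2_eq_square flip: power_mult_distrib)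
          then show ?thesis unfolding C2_def using r c by (simp add: field_simps power_divide power_mult_distrib)
        qed
        moreover have "0 \<le> C1 * (64 / c^2)" using C0 by simp
        ultimately show ?thesis using C0 unfolding C_def by linarith
      qed
    qed
    then show ?thesis using triv by (simp add: I_def A_def r_def)
  qed
  show ?thesis
  proof (intro exI[of _ C] conjI ballI allI impI)
    show "C \<ge> 0" using C0 by (simp add: C_def)
    fix x y n \<sigma> assume "x \<in> B" "y \<in> B" "\<bar>\<sigma>\<bar> \<le> (1::real)"
    from main[OF this, of n] show "let I = \<bar>?I n \<sigma> x y\<bar>
      in I \<le> C \<and> I * ((pdist x y)^2 * 4^n) \<le> C"
      using C0 unfolding Let_def C_def by (auto intro: order_trans)
  qed
qed

end

section \<open>Energy at a given scale\<close>

text \<open>Integrate the derivative of (1 - (l - u)/\<delta>) g^2, which equals g(u)^2 at u and 0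
  at u + \<delta>, and split the cross term 2 g g' with weights 1/\<delta> and \<delta>. The two
  resulting terms balance when g' has size g/\<delta>, as for a wave of scale \<delta>.\<close>

lemma sobolev_pointwise:
  fixes g g' :: "real \<Rightarrow> real"
  assumes \<delta>: "\<delta> > 0"
    and D: "\<And>l. l \<in> {u..u+\<delta>} \<Longrightarrow> (g has_real_derivative g' l) (at l)"
    and c: "continuous_on {u..u+\<delta>} g'"
  shows "(g u)^2 \<le> integral {u..u+\<delta>} (\<lambda>l. 2/\<delta> * (g l)^2 + \<delta> * (g' l)^2)"
proof -
  have cg: "continuous_on {u..u+\<delta>} g" by (rule DERIV_at_imp_continuous_on[OF D])
  define k where "k = (\<lambda>l. (1 - (l - u)/\<delta>) * (g l)^2)"
  define k' where "k' = (\<lambda>l. - (1/\<delta>) * (g l)^2 + (1 - (l - u)/\<delta>) * (2 * g l * g' l))"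
  have Dk: "(k has_real_derivative k' l) (at l)" if "l \<in> {u..u+\<delta>}" for l
  proof -
    have "((\<lambda>l. (g l)^2) has_real_derivative 2 * g l * g' l) (at l)"
      using DERIV_power[OF D[OF that], of 2] by (simp add: mult_ac)
    moreover have "((\<lambda>l. 1 - (l - u)/\<delta>) has_real_derivative - (1/\<delta>)) (at l)"
      using \<delta> by (auto intro!: derivative_eq_intros)
    ultimately have "(k has_real_derivative - (1/\<delta>) * (g l)^2 + (2 * g l * g' l) * (1 - (l - u)/\<delta>)) (at l)"
      unfolding k_def by (rule DERIV_mult[rotated])
    then show ?thesis unfolding k'_def by (simp only: mult.commute)
  qed
  have "(k' has_integral (k (u+\<delta>) - k u)) {u..u+\<delta>}"
    by (rule fundamental_theorem_of_calculus)
       (use \<delta> Dk in \<open>auto simp: has_real_derivative_iff_has_vector_derivative[symmetric] intro: has_field_derivative_at_within\<close>)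
  then have "((\<lambda>l. - k' l) has_integral (g u)^2) {u..u+\<delta>}"
    using \<delta> by (simp add: k_def has_integral_neg_iff)
  then show ?thesis
  proof (rule has_integral_le)
    show "((\<lambda>l. 2/\<delta> * (g l)^2 + \<delta> * (g' l)^2) has_integral
      integral {u..u+\<delta>} (\<lambda>l. 2/\<delta> * (g l)^2 + \<delta> * (g' l)^2)) {u..u+\<delta>}"
      by (intro integrable_integral integrable_continuous_interval continuous_intros cg c)
    fix l assume l: "l \<in> {u..u+\<delta>}"
    have 1: "0 \<le> 1 - (l - u)/\<delta>" "1 - (l - u)/\<delta> \<le> 1" using l \<delta> by (auto simp: field_simps)
    have "- (2 * g l * g' l) \<le> 1/\<delta> * (g l)^2 + \<delta> * (g' l)^2"
    proof -
      have "0 \<le> (g l + \<delta> * g' l)^2 / \<delta>" using \<delta> by simp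
      also have "\<dots> = 1/\<delta> * (g l)^2 + \<delta> * (g' l)^2 + 2 * g l * g' l"
        using \<delta> by (simp add: field_simps power2_eq_square)
      finally show ?thesis by simp
    qed
    then have "(1 - (l - u)/\<delta>) * (- (2 * g l * g' l)) \<le> (1 - (l - u)/\<delta>) * (1/\<delta> * (g l)^2 + \<delta> * (g' l)^2)"
      by (rule mult_left_mono) (rule 1)
    also have "\<dots> \<le> 1 * (1/\<delta> * (g l)^2 + \<delta> * (g' l)^2)" using 1 \<delta> by (intro mult_right_mono) auto
    finally have "(1 - (l - u)/\<delta>) * (- (2 * g l * g' l)) \<le> 1/\<delta> * (g l)^2 + \<delta> * (g' l)^2" by simp
    moreover have "2/\<delta> * (g l)^2 = 1/\<delta> * (g l)^2 + 1/\<delta> * (g l)^2" by simp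
    ultimately show "- k' l \<le> 2/\<delta> * (g l)^2 + \<delta> * (g' l)^2" unfolding k'_def by linarith
  qed
qed

lemma scaled_distance:
  fixes q t :: real
  assumes "t \<notin> {q - 1/2^n..q + 1/2^n}"
  shows "\<bar>2^n * (t - q)\<bar> \<ge> 1"
proof -
  have "\<bar>t - q\<bar> \<ge> 1/2^n" using assms by auto
  then have "2^n * \<bar>t - q\<bar> \<ge> 1" by (simp add: field_simps)
  then show ?thesis by (simp add: abs_mult)
qed

lemma has_integral_rescaled:
  fixes F :: "real \<Rightarrow> real"
  assumes F: "(F has_integral c) {-1..1}" "\<And>t. \<bar>t\<bar> \<ge> 1 \<Longrightarrow> F t = 0" and p: "\<bar>p\<bar> \<le> T - 1"
  shows "((\<lambda>t. F (2^n * (t - p))) has_integral c / 2^n) {-T..T}"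
proof -
  have "(F has_integral c) (cbox (-1) 1)" using F(1) by simp
  from has_integral_affinity'[OF this, of "2^n" "- (2^n * p)"]
  have "((\<lambda>t. F (2^n * t - 2^n * p)) has_integral c / 2^n) {(-1 + 2^n * p) / 2^n..(1 + 2^n * p) / 2^n}"
    by (simp add: divide_inverse mult.commute)
  moreover have "{(-1 + 2^n * p) / 2^n..(1 + 2^n * p) / 2^n} = {p - 1/2^n..p + 1/2^n}"
    by (simp add: field_simps)
  ultimately have "((\<lambda>t. F (2^n * (t - p))) has_integral c / 2^n) {p - 1/2^n..p + 1/2^n}"
    by (simp add: right_diff_distrib)
  then show ?thesis
  proof (rule has_integral_on_superset)
    define e :: real where "e = 1/2^n"
    have "e \<le> 1" by (simp add: e_def)
    then show "{p - 1/2^n..p + 1/2^n} \<subseteq> {-T..T}" using p unfolding e_def[symmetric] by auto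
  qed (rule F(2), rule scaled_distance)
qed

text \<open>Substituting \<sigma> = 2^n (t - p) fixes the range [-1, 1] of the new variable and
  leaves p and q only in the shift 2^n (p - q). Since |p| <= M, the range of t contains the support
  of the first kernel.\<close>

lemma integral_correlation:
  fixes \<theta> :: "real \<Rightarrow> real"
  assumes \<theta>: "continuous_on UNIV \<theta>" "\<And>t. \<bar>t\<bar> \<ge> 1 \<Longrightarrow> \<theta> t = 0" and p: "\<bar>p\<bar> \<le> M"
  shows "((\<lambda>t. \<theta> (2^n * (t - p)) * \<theta> (2^n * (t - q))) has_integral
    integral {-1..1} (\<lambda>\<sigma>. \<theta> \<sigma> * \<theta> (\<sigma> + 2^n * (p - q))) / 2^n) {-(M+1)..M+1}"
proof -
  define F where "F = (\<lambda>\<sigma>. \<theta> \<sigma> * \<theta> (\<sigma> + 2^n * (p - q)))"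
  have "continuous_on {-1..1} F" unfolding F_def
    by (intro continuous_intros continuous_on_compose2[OF \<theta>(1)]) auto
  then have "(F has_integral integral {-1..1} F) {-1..1}"
    by (intro integrable_integral integrable_continuous_interval)
  then have int: "((\<lambda>t. F (2^n * (t - p))) has_integral integral {-1..1} F / 2^n) {-(M+1)..M+1}"
    by (rule has_integral_rescaled) (use \<theta>(2) p in \<open>simp_all add: F_def\<close>)
  have eq: "F (2^n * (t - p)) = \<theta> (2^n * (t - p)) * \<theta> (2^n * (t - q))" for t
    by (simp add: F_def algebra_simps)
  show ?thesis using int unfolding eq unfolding F_def .
qed

definition plane_frostman :: "real \<Rightarrow> real \<Rightarrow> nat \<Rightarrow> (real \<times> real) set \<Rightarrow> (real \<times> real \<Rightarrow> real) \<Rightarrow> bool" where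
  "plane_frostman s K N P w \<longleftrightarrow> finite P \<and> (\<forall>x. 0 \<le> w x) \<and> sum w P \<le> 1 \<and>
     (\<forall>x. \<forall>k\<le>N. (\<Sum>y\<in>{y\<in>P. pdist x y \<le> 1/2^k}. w y) \<le> K * (1/2^k) powr s)"

text \<open>A ball of \<open>pdist\<close> is a square, so its weight is a product of two interval
  weights, and 9 = 3 * 3.\<close>

lemma plane_frostman_Times:
  assumes "frostman s N P v" "frostman t N Q w"
  shows "plane_frostman (s + t) 9 N (P \<times> Q) (\<lambda>x. v (fst x) * w (snd x))"
proof -
  have prod: "(\<Sum>x\<in>A \<times> B. v (fst x) * w (snd x)) = sum v A * sum w B" for A B
    by (simp add: sum_product sum.cartesian_product case_prod_beta)
  have fin: "finite P" "finite Q" "\<And>x. 0 \<le> v x" "\<And>x. 0 \<le> w x" "sum v P \<le> 1" "sum w Q \<le> 1"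
    using assms by (auto simp: frostman_def)
  show ?thesis unfolding plane_frostman_def
  proof (intro conjI allI impI)
    show "sum (\<lambda>x. v (fst x) * w (snd x)) (P \<times> Q) \<le> 1"
      unfolding prod using fin by (intro mult_le_one sum_nonneg) auto
    fix x :: "real \<times> real" and k assume k: "k \<le> N"
    have "{y \<in> P \<times> Q. pdist x y \<le> 1/2^k} = (P \<inter> {fst x - 1/2^k..fst x + 1/2^k}) \<times> (Q \<inter> {snd x - 1/2^k..snd x + 1/2^k})"
      by (auto simp: pdist_def abs_le_iff)
    then have "(\<Sum>y\<in>{y \<in> P \<times> Q. pdist x y \<le> 1/2^k}. v (fst y) * w (snd y)) =
      sum v (P \<inter> {fst x - 1/2^k..fst x + 1/2^k}) * sum w (Q \<inter> {snd x - 1/2^k..snd x + 1/2^k})"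
      by (simp add: prod)
    also have "\<dots> \<le> (3 * (1/2^k) powr s) * (3 * (1/2^k) powr t)"
      using assms k fin unfolding frostman_def by (intro mult_mono sum_nonneg) auto
    finally show "(\<Sum>y\<in>{y \<in> P \<times> Q. pdist x y \<le> 1/2^k}. v (fst y) * w (snd y)) \<le> 9 * (1/2^k) powr (s + t)"
      by (simp add: powr_add)
  qed (use fin in auto)
qed

context transversal_family
begin

text \<open>With \<open>amp\<close> constantly 1 and \<theta> = \<open>wav\<close> this is the part
  at scale 1/2^n of the image of the weights under \<open>h l\<close>.\<close>

definition wave :: "(real \<Rightarrow> real) \<Rightarrow> (real \<Rightarrow> real \<times> real \<Rightarrow> real) \<Rightarrow> (real \<times> real) set \<Rightarrow>
    (real \<times> real \<Rightarrow> real) \<Rightarrow> nat \<Rightarrow> real \<Rightarrow> real \<Rightarrow> real" where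
  "wave \<theta> amp P w n l t = (\<Sum>x\<in>P. w x * amp l x * (2^n * \<theta> (2^n * (t - h l x))))"

lemma continuous_on_h: "x \<in> B \<Longrightarrow> continuous_on J (\<lambda>l. h l x)"
  by (rule DERIV_at_imp_continuous_on) (rule D1)

lemma continuous_on_wave:
  assumes "P \<subseteq> B" "continuous_on UNIV \<theta>" "\<And>x. x \<in> B \<Longrightarrow> continuous_on J (\<lambda>l. amp l x)"
  shows "continuous_on (J \<times> S) (\<lambda>p. wave \<theta> amp P w n (fst p) (snd p))"
  unfolding wave_def
proof (intro continuous_intros)
  fix x assume "x \<in> P"
  then have x: "x \<in> B" using assms(1) by blast
  have h: "continuous_on (J \<times> S) (\<lambda>p. h (fst p) x)"
    by (rule continuous_on_compose2[OF continuous_on_h[OF x]]) (auto intro!: continuous_intros)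
  show "continuous_on (J \<times> S) (\<lambda>p. amp (fst p) x)"
    by (rule continuous_on_compose2[OF assms(3)[OF x]]) (auto intro!: continuous_intros)
  show "continuous_on (J \<times> S) (\<lambda>p. \<theta> (2^n * (snd p - h (fst p) x)))"
    by (rule continuous_on_compose2[OF assms(2)]) (auto intro!: continuous_intros h)
qed

text \<open>Expanding the square and integrating over t and l gives a double sum over
  \<open>P\<close> whose entries are 2^n times averages over \<sigma> of the interactions in
  \<open>kernel_estimate\<close>; \<open>schur_sum\<close> bounds it. The range of t is
  [-(M+1), M+1] because |h| <= M and the kernels have radius at most 1.\<close>

lemma energy_estimate:
  fixes amp amp' :: "real \<Rightarrow> real \<times> real \<Rightarrow> real" and \<Theta> \<theta> :: "real \<Rightarrow> real"
  assumes amp: "\<And>l x. l \<in> J \<Longrightarrow> x \<in> B \<Longrightarrow> ((\<lambda>l. amp l x) has_real_derivative amp' l x) (at l)"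
      "\<And>x. x \<in> B \<Longrightarrow> continuous_on J (\<lambda>l. amp' l x)"
      "\<And>l x. l \<in> J \<Longrightarrow> x \<in> B \<Longrightarrow> \<bar>amp l x\<bar> \<le> M \<and> \<bar>amp' l x\<bar> \<le> M"
    and \<Theta>: "\<And>t. (\<Theta> has_real_derivative \<theta> t) (at t)" "continuous_on UNIV \<theta>"
      "\<And>t. \<bar>t\<bar> \<ge> 1 \<Longrightarrow> \<Theta> t = 0" "\<And>t. \<bar>t\<bar> \<ge> 1 \<Longrightarrow> \<theta> t = 0"
      "\<And>t. \<bar>\<Theta> t\<bar> \<le> M0" "\<And>t. \<bar>\<theta> t\<bar> \<le> M0"
    and s: "s < 2" and K: "K \<ge> 0"
  shows "\<exists>C\<ge>0. \<forall>N P w n. plane_frostman s K N P w \<longrightarrow> P \<subseteq> B \<longrightarrow> n \<le> N \<longrightarrow>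
    integral J (\<lambda>l. cutoff l * integral {-(M+1)..M+1} (\<lambda>t. (wave \<theta> amp P w n l t)^2)) \<le>
      C * 2^n * (1/2^n) powr s"
proof -
  let ?k = "\<lambda>n x y l \<sigma>. cutoff l * amp l x * amp l y * \<theta> (\<sigma> + 2^n * (h l x - h l y))"
  have "\<exists>C\<ge>0. \<forall>x\<in>B. \<forall>y\<in>B. \<forall>n \<sigma>. \<bar>\<sigma>\<bar> \<le> 1 \<longrightarrow>
     (let I = \<bar>integral J (\<lambda>l. ?k n x y l \<sigma>)\<bar>
      in I \<le> C \<and> I * ((pdist x y)^2 * 4^n) \<le> C)"
    by (rule kernel_estimate[where amp' = amp' and \<Theta> = \<Theta> and ?M0.0 = M0]) (fact amp \<Theta>)+
  then obtain C where C0: "C \<ge> 0" and C1: "\<forall>x\<in>B. \<forall>y\<in>B. \<forall>n \<sigma>. \<bar>\<sigma>\<bar> \<le> 1 \<longrightarrow>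
     (let I = \<bar>integral J (\<lambda>l. ?k n x y l \<sigma>)\<bar>
      in I \<le> C \<and> I * ((pdist x y)^2 * 4^n) \<le> C)"
    by (elim exE conjE)
  have C2: "\<bar>integral J (\<lambda>l. ?k n x y l \<sigma>)\<bar> \<le> C \<and>
     \<bar>integral J (\<lambda>l. ?k n x y l \<sigma>)\<bar> * ((pdist x y)^2 * 4^n) \<le> C"
     if "x \<in> B" "y \<in> B" "\<bar>\<sigma>\<bar> \<le> 1" for x y n \<sigma>
    using C1[rule_format, OF that, of n] by (simp only: Let_def)
  note C = C0 C2
  have M0: "M0 \<ge> 0" using \<Theta>(5)[of 0] by linarith
  have camp: "continuous_on J (\<lambda>l. amp l x)" if "x \<in> B" for x
    by (rule DERIV_at_imp_continuous_on) (rule amp(1)[OF _ that])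
  have \<theta>c: "continuous_on S (\<lambda>z. \<theta> (g z))" if "continuous_on S g" for S :: "'z::topological_space set" and g
    by (rule continuous_on_compose2[OF \<Theta>(2) that]) auto
  define W where "W = (\<lambda>n x y. integral J (\<lambda>l. integral {-1..1} (\<lambda>\<sigma>.
    \<theta> \<sigma> * ?k n x y l \<sigma>)))"
  have c1: "continuous_on (J \<times> S) (\<lambda>p. amp (fst p) x)" "continuous_on (J \<times> S) (\<lambda>p. h (fst p) x)"
    "continuous_on (S \<times> J) (\<lambda>p. amp (snd p) x)" "continuous_on (S \<times> J) (\<lambda>p. h (snd p) x)"
    if "x \<in> B" for x and S :: "real set"
    using that by (auto intro!: continuous_on_compose2[OF camp] continuous_on_compose2[OF continuous_on_h] continuous_intros)
  have cont2: "continuous_on (J \<times> {-1..1}) (\<lambda>p. \<theta> (snd p) * (cutoff (fst p) * amp (fst p) x * amp (fst p) y *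
      \<theta> (snd p + 2^n * (h (fst p) x - h (fst p) y))))" if "x \<in> B" "y \<in> B" for x y n
    unfolding cutoff_def by (intro continuous_intros \<theta>c c1 that)
  have W: "W n x y \<le> 2 * M0 * C \<and> W n x y * ((pdist x y)^2 * 4^n) \<le> 2 * M0 * C" if x: "x \<in> B" and y: "y \<in> B" for n x y
  proof -
    define I where "I = (\<lambda>\<sigma>. integral J (\<lambda>l. ?k n x y l \<sigma>))"
    \<comment> \<open>The l-integral is moved inside because it alone has cancellation. In \<sigma>
      absolute values are taken, at the price of the length 2 and the bound M0 of \<theta>.\<close>
    have "W n x y = integral {-1..1} (\<lambda>\<sigma>. integral J (\<lambda>l. \<theta> \<sigma> * ?k n x y l \<sigma>))"
      unfolding W_def
      using integral_swap_continuous[of "a-\<rho>" "-1" "a+\<rho>" 1 "\<lambda>l \<sigma>. \<theta> \<sigma> * ?k n x y l \<sigma>"]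
        cont2[OF x y, of n] by (simp add: cbox_Pair_eq case_prod_beta)
    also have "\<dots> = integral {-1..1} (\<lambda>\<sigma>. \<theta> \<sigma> * I \<sigma>)" by (simp add: I_def)
    finally have eq: "W n x y = integral {-1..1} (\<lambda>\<sigma>. \<theta> \<sigma> * I \<sigma>)" .
    have "continuous_on {-1..1} (\<lambda>\<sigma>. integral (cbox (a-\<rho>) (a+\<rho>)) (\<lambda>l. ?k n x y l \<sigma>))"
      unfolding cutoff_def
      by (rule integral_continuous_on_param, unfold case_prod_beta cbox_interval)
        (intro continuous_intros \<theta>c c1 x y)
    then have cI: "continuous_on {-1..1} I" by (simp add: I_def)
    have bd: "W n x y * k \<le> 2 * M0 * C" if k: "k \<ge> 0" "\<And>\<sigma>. \<bar>\<sigma>\<bar> \<le> 1 \<Longrightarrow> \<bar>I \<sigma>\<bar> * k \<le> C" for k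
    proof -
      have "norm (integral {-1..1} (\<lambda>\<sigma>. \<theta> \<sigma> * I \<sigma> * k)) \<le> (M0 * C) * (1 - (-1))"
      proof (rule integral_bound)
        show "continuous_on {-1..1} (\<lambda>\<sigma>. \<theta> \<sigma> * I \<sigma> * k)"
          by (intro continuous_intros cI continuous_on_subset[OF \<Theta>(2)]) auto
        fix \<sigma> :: real assume "\<sigma> \<in> {-1..1}"
        then have "\<bar>I \<sigma>\<bar> * k \<le> C" by (intro k) auto
        then have "\<bar>\<theta> \<sigma>\<bar> * (\<bar>I \<sigma>\<bar> * k) \<le> M0 * C" using \<Theta>(6) k(1) M0 by (intro mult_mono) auto
        then show "norm (\<theta> \<sigma> * I \<sigma> * k) \<le> M0 * C" using k(1) by (simp add: abs_mult mult.assoc)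
      qed auto
      then show ?thesis unfolding eq by (simp add: abs_le_iff)
    qed
    show ?thesis
    proof
      show "W n x y \<le> 2 * M0 * C" using bd[of 1] C(2)[OF x y] by (auto simp: I_def)
      show "W n x y * ((pdist x y)^2 * 4^n) \<le> 2 * M0 * C" using C(2)[OF x y] by (intro bd) (auto simp: I_def)
    qed
  qed
  define Q where "Q = 4 * (2 * M0 * C) * K * (2 powr (2-s) / (2 powr (2-s) - 1))"
  show ?thesis
  proof (intro exI[of _ Q] conjI allI impI)
    have "2 powr (2 - s) > 1" using s by simp
    then show "Q \<ge> 0" unfolding Q_def using C(1) M0 K by (intro mult_nonneg_nonneg divide_nonneg_nonneg) auto
    fix N P w n assume pf: "plane_frostman s K N P w" and P: "P \<subseteq> B" and n: "n \<le> N"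
    have fin: "finite P" "\<And>x. 0 \<le> w x" "sum w P \<le> 1"
      "\<And>x k. k \<le> n \<Longrightarrow> (\<Sum>y\<in>{y\<in>P. pdist x y \<le> 1/2^k}. w y) \<le> K * (1/2^k) powr s"
      using pf n unfolding plane_frostman_def by auto
    have inner: "cutoff l * integral {-(M+1)..M+1} (\<lambda>t. (wave \<theta> amp P w n l t)^2) =
      (\<Sum>x\<in>P. \<Sum>y\<in>P. w x * w y * (2^n * integral {-1..1} (\<lambda>\<sigma>.
        \<theta> \<sigma> * ?k n x y l \<sigma>)))" if l: "l \<in> J" for l
    proof -
      have "((\<lambda>t. \<Sum>x\<in>P. \<Sum>y\<in>P. (w x * amp l x * w y * amp l y * 2^n * 2^n) *
          (\<theta> (2^n * (t - h l x)) * \<theta> (2^n * (t - h l y)))) has_integral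
          (\<Sum>x\<in>P. \<Sum>y\<in>P. (w x * amp l x * w y * amp l y * 2^n * 2^n) *
            (integral {-1..1} (\<lambda>\<sigma>. \<theta> \<sigma> * \<theta> (\<sigma> + 2^n * (h l x - h l y))) / 2^n))) {-(M+1)..M+1}"
        using P bound[OF l]
        by (intro has_integral_sum has_integral_mult_right integral_correlation \<Theta> fin(1)) auto
      moreover have "(\<Sum>x\<in>P. \<Sum>y\<in>P. (w x * amp l x * w y * amp l y * 2^n * 2^n) *
          (\<theta> (2^n * (t - h l x)) * \<theta> (2^n * (t - h l y)))) = (wave \<theta> amp P w n l t)^2" for t
        unfolding wave_def power2_eq_square sum_product by (intro sum.cong refl) (simp add: mult_ac)
      ultimately have "integral {-(M+1)..M+1} (\<lambda>t. (wave \<theta> amp P w n l t)^2) =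
        (\<Sum>x\<in>P. \<Sum>y\<in>P. (w x * amp l x * w y * amp l y * 2^n * 2^n) *
            (integral {-1..1} (\<lambda>\<sigma>. \<theta> \<sigma> * \<theta> (\<sigma> + 2^n * (h l x - h l y))) / 2^n))"
        by (simp add: integral_unique)
      moreover have "integral {-1..1} (\<lambda>\<sigma>. \<theta> \<sigma> * ?k n x y l \<sigma>) =
        cutoff l * amp l x * amp l y * integral {-1..1} (\<lambda>\<sigma>. \<theta> \<sigma> * \<theta> (\<sigma> + 2^n * (h l x - h l y)))" for x y
        by (simp flip: integral_mult_right add: mult_ac)
      ultimately show ?thesis by (simp add: sum_distrib_left mult_ac)
    qed
    have "integral J (\<lambda>l. cutoff l * integral {-(M+1)..M+1} (\<lambda>t. (wave \<theta> amp P w n l t)^2)) =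
      integral J (\<lambda>l. \<Sum>x\<in>P. \<Sum>y\<in>P. w x * w y * (2^n * integral {-1..1} (\<lambda>\<sigma>.
        \<theta> \<sigma> * ?k n x y l \<sigma>)))"
      by (intro integral_cong inner)
    also have "\<dots> = (\<Sum>x\<in>P. \<Sum>y\<in>P. w x * w y * (2^n * W n x y))"
    proof (rule integral_unique, intro has_integral_sum has_integral_mult_right fin(1))
      fix x y assume "x \<in> P" "y \<in> P"
      then have xy: "x \<in> B" "y \<in> B" using P by auto
      have "continuous_on J (\<lambda>l. integral (cbox (-1) 1) (\<lambda>\<sigma>. \<theta> \<sigma> * ?k n x y l \<sigma>))"
        by (rule integral_continuous_on_param) (use cont2[OF xy, of n] in \<open>simp add: case_prod_beta\<close>)
      then show "((\<lambda>l. integral {-1..1} (\<lambda>\<sigma>. \<theta> \<sigma> * ?k n x y l \<sigma>))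
        has_integral W n x y) J"
        unfolding W_def by (intro integrable_integral integrable_continuous_interval) simp
    qed
    also have "\<dots> = 2^n * (\<Sum>x\<in>P. \<Sum>y\<in>P. w x * w y * W n x y)"
      by (simp add: sum_distrib_left mult_ac)
    also have "\<dots> \<le> 2^n * (Q * (1/2^n) powr s)"
      unfolding Q_def
    proof (intro mult_left_mono schur_sum fin s K)
      fix x y assume "x \<in> P" "y \<in> P"
      then have "x \<in> B" "y \<in> B" using P by auto
      then show "pdist x y \<le> 1 \<and> W n x y \<le> 2 * M0 * C \<and> W n x y * ((pdist x y)^2 * 4^n) \<le> 2 * M0 * C"
        using W diam by blast
    qed (use C(1) M0 in auto)
    finally show "integral J (\<lambda>l. cutoff l * integral {-(M+1)..M+1} (\<lambda>t. (wave \<theta> amp P w n l t)^2)) \<le> Q * 2^n * (1/2^n) powr s"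
      by (simp add: mult_ac)
  qed
qed

end

section \<open>Replacing Lebesgue measure in the parameter by Frostman weights\<close>

lemma weighted_square_sum:
  fixes w E :: "'i \<Rightarrow> real"
  assumes "\<And>i. i \<in> I \<Longrightarrow> 0 \<le> w i" "sum w I \<le> 1"
  shows "(\<Sum>i\<in>I. w i * E i)^2 \<le> (\<Sum>i\<in>I. w i * (E i)^2)"
proof -
  have 0: "0 \<le> (\<Sum>i\<in>I. w i * (E i)^2)" using assms by (intro sum_nonneg) auto
  have "(\<Sum>i\<in>I. w i * E i)^2 = (\<Sum>i\<in>I. sqrt (w i) * (sqrt (w i) * E i))^2"
    using assms by (intro arg_cong[where f = "\<lambda>x. x^2"] sum.cong) (auto simp flip: mult.assoc)
  also have "\<dots> \<le> (\<Sum>i\<in>I. (sqrt (w i))^2) * (\<Sum>i\<in>I. (sqrt (w i) * E i)^2)"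
    by (rule Cauchy_Schwarz_ineq_sum)
  also have "\<dots> = sum w I * (\<Sum>i\<in>I. w i * (E i)^2)"
    using assms by (intro arg_cong2[where f = "(*)"] sum.cong) (auto simp: power_mult_distrib)
  also have "\<dots> \<le> 1 * (\<Sum>i\<in>I. w i * (E i)^2)" using assms 0 by (intro mult_right_mono) auto
  finally show ?thesis by simp
qed

context transversal_family
begin

lemma DERIV_wave:
  assumes "finite P" "P \<subseteq> B" "l \<in> J"
  shows "((\<lambda>l. wave wav (\<lambda>_ _. 1) P w n l t) has_real_derivative - (2^n * wave wav' h1 P w n l t)) (at l)"
proof -
  have "((\<lambda>l. \<Sum>x\<in>P. w x * 1 * (2^n * wav (2^n * (t - h l x)))) has_real_derivative
     (\<Sum>x\<in>P. w x * 1 * (2^n * (wav' (2^n * (t - h l x)) * (2^n * (0 - h1 l x)))))) (at l)"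
  proof (intro DERIV_sum DERIV_cmult)
    fix x assume "x \<in> P"
    then have "((\<lambda>l. h l x) has_real_derivative h1 l x) (at l)" using D1 assms by blast
    then have "((\<lambda>l. 2^n * (t - h l x)) has_real_derivative 2^n * (0 - h1 l x)) (at l)"
      by (intro DERIV_cmult DERIV_diff DERIV_const)
    then show "((\<lambda>l. wav (2^n * (t - h l x))) has_real_derivative wav' (2^n * (t - h l x)) * (2^n * (0 - h1 l x))) (at l)"
      by (rule DERIV_chain'[OF _ DERIV_wav])
  qed
  moreover have "(\<Sum>x\<in>P. w x * 1 * (2^n * (wav' (2^n * (t - h l x)) * (2^n * (0 - h1 l x))))) = - (2^n * wave wav' h1 P w n l t)"
    unfolding wave_def sum_distrib_left sum_negf[symmetric] by (intro sum.cong) (auto simp: mult_ac)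
  ultimately show ?thesis unfolding wave_def by simp
qed

text \<open>This is \<open>sobolev_pointwise\<close> in l with \<delta> = 1/2^n, integrated over t.
  Differentiation in l costs the factor 2^n = 1/\<delta>, so both terms on the right scale
  alike.\<close>

lemma integral_wave_square_le:
  assumes P: "finite P" "P \<subseteq> B" and l1: "l1 \<in> J" "l1 + 1/2^n \<in> J"
  shows "integral {t0..t1} (\<lambda>t. (wave wav (\<lambda>_ _. 1) P w n l1 t)^2) \<le>
    2 * 2^n * integral {l1..l1+1/2^n} (\<lambda>l. integral {t0..t1} (\<lambda>t.
      (wave wav (\<lambda>_ _. 1) P w n l t)^2 + (wave wav' h1 P w n l t)^2))"
proof -
  define E1 where "E1 = wave wav (\<lambda>_ _. 1) P w n"
  define E2 where "E2 = wave wav' h1 P w n"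
  define F where "F = (\<lambda>l t. (E1 l t)^2 + (E2 l t)^2)"
  have ch1: "continuous_on J (\<lambda>l. h1 l x)" if "x \<in> B" for x
    by (rule DERIV_at_imp_continuous_on) (rule D2[OF _ that])
  have cE: "continuous_on (J \<times> UNIV) (\<lambda>p. E1 (fst p) (snd p))" "continuous_on (J \<times> UNIV) (\<lambda>p. E2 (fst p) (snd p))"
    unfolding E1_def E2_def using P(2) by (auto intro!: continuous_on_wave continuous_on_wav continuous_on_wav' ch1)
  have sub: "{l1..l1+1/2^n} \<subseteq> J" using l1 by auto
  have cE': "continuous_on S (\<lambda>z. E1 (f z) (g z))" "continuous_on S (\<lambda>z. E2 (f z) (g z))"
    if "continuous_on S f" "continuous_on S g" "f ` S \<subseteq> J" for S :: "'z::topological_space set" and f g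
    using continuous_on_compose2[OF cE(1) continuous_on_Pair[OF that(1,2)]]
      continuous_on_compose2[OF cE(2) continuous_on_Pair[OF that(1,2)]] that(3) by force+
  have step: "(E1 l1 t)^2 \<le> 2 * 2^n * integral {l1..l1+1/2^n} (\<lambda>l. F l t)" for t
  proof -
    have "(E1 l1 t)^2 \<le> integral {l1..l1+1/2^n} (\<lambda>l. 2/(1/2^n) * (E1 l t)^2 + 1/2^n * (- (2^n * E2 l t))^2)"
    proof (rule sobolev_pointwise)
      fix l assume "l \<in> {l1..l1+1/2^n}"
      then show "((\<lambda>l. E1 l t) has_real_derivative - (2^n * E2 l t)) (at l)"
        unfolding E1_def E2_def using DERIV_wave[OF P] sub by blast
    qed (use sub in \<open>auto intro!: continuous_intros cE'\<close>)
    also have "\<dots> \<le> integral {l1..l1+1/2^n} (\<lambda>l. 2 * 2^n * F l t)"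
    proof (rule integral_le)
      show "(\<lambda>l. 2/(1/2^n) * (E1 l t)^2 + 1/2^n * (- (2^n * E2 l t))^2) integrable_on {l1..l1+1/2^n}"
        using sub by (intro integrable_continuous_interval continuous_intros cE') auto
      show "(\<lambda>l. 2 * 2^n * F l t) integrable_on {l1..l1+1/2^n}"
        unfolding F_def using sub by (intro integrable_continuous_interval continuous_intros cE') auto
      fix l
      have "1/2^n * (- (2^n * E2 l t))^2 = 2^n * (E2 l t)^2" by (simp add: power2_eq_square)
      moreover have "0 \<le> 2^n * (E2 l t)^2" by simp
      ultimately show "2/(1/2^n) * (E1 l t)^2 + 1/2^n * (- (2^n * E2 l t))^2 \<le> 2 * 2^n * F l t"
        unfolding F_def distrib_left by simp
    qed
    finally show ?thesis by simp
  qed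
  have cF: "continuous_on ({l1..l1+1/2^n} \<times> {t0..t1}) (\<lambda>p. F (fst p) (snd p))"
    unfolding F_def using sub by (intro continuous_intros cE') auto
  have cF': "continuous_on ({t0..t1} \<times> {l1..l1+1/2^n}) (\<lambda>p. F (snd p) (fst p))"
    unfolding F_def using sub by (intro continuous_intros cE') auto
  have "integral {t0..t1} (\<lambda>t. (E1 l1 t)^2) \<le> integral {t0..t1} (\<lambda>t. 2 * 2^n * integral {l1..l1+1/2^n} (\<lambda>l. F l t))"
  proof (rule integral_le)
    show "(\<lambda>t. (E1 l1 t)^2) integrable_on {t0..t1}"
      using l1 by (intro integrable_continuous_interval continuous_intros cE') auto
    have "continuous_on {t0..t1} (\<lambda>t. integral (cbox l1 (l1+1/2^n)) (\<lambda>l. F l t))"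
      by (rule integral_continuous_on_param) (use cF' in \<open>simp add: case_prod_beta\<close>)
    then show "(\<lambda>t. 2 * 2^n * integral {l1..l1+1/2^n} (\<lambda>l. F l t)) integrable_on {t0..t1}"
      by (intro integrable_continuous_interval continuous_intros) simp
  qed (rule step)
  also have "\<dots> = 2 * 2^n * integral {t0..t1} (\<lambda>t. integral {l1..l1+1/2^n} (\<lambda>l. F l t))" by simp
  also have "integral {t0..t1} (\<lambda>t. integral {l1..l1+1/2^n} (\<lambda>l. F l t)) = integral {l1..l1+1/2^n} (\<lambda>l. integral {t0..t1} (F l))"
    using integral_swap_continuous[of l1 t0 "l1+1/2^n" t1 F] cF by (simp add: cbox_Pair_eq case_prod_beta)
  finally show ?thesis unfolding F_def E1_def E2_def .
qed

text \<open>The derivative in \<open>l\<close> of \<open>wave wav\<close> is \<open>2^n\<close> times a wave of the same kind, with amplitude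
  \<open>h1\<close> and kernel \<open>wav'\<close>. Therefore the energy at a single \<open>l\<close> is controlled by averages of energies
  over an interval of length \<open>1/2^n\<close>, and weights can replace Lebesgue measure.\<close>

lemma averaged_energy_estimate:
  assumes s: "s < 2" and K: "K \<ge> 0"
  shows "\<exists>C\<ge>0. \<forall>N Q v P w n. frostman s1 N Q v \<longrightarrow> Q \<subseteq> {a-\<rho>/4..a+\<rho>/4} \<longrightarrow> plane_frostman s K N P w \<longrightarrow>
    P \<subseteq> B \<longrightarrow> n \<le> N \<longrightarrow> 1/2^n \<le> \<rho>/4 \<longrightarrow>
    integral {-(M+1)..M+1} (\<lambda>t. (\<Sum>l\<in>Q. v l * wave wav (\<lambda>_ _. 1) P w n l t)^2) \<le>
      C * (2^n)^2 * (1/2^n) powr (s1 + s)"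
proof -
  obtain M0 where M0: "\<And>t. \<bar>wav_int t\<bar> \<le> M0" "\<And>t. \<bar>wav t\<bar> \<le> M0" "\<And>t. \<bar>wav' t\<bar> \<le> M0"
    using kernel_bound by blast
  have "\<exists>C\<ge>0. \<forall>N P w n. plane_frostman s K N P w \<longrightarrow> P \<subseteq> B \<longrightarrow> n \<le> N \<longrightarrow>
    integral J (\<lambda>l. cutoff l * integral {-(M+1)..M+1} (\<lambda>t. (wave wav (\<lambda>_ _. 1) P w n l t)^2)) \<le> C * 2^n * (1/2^n) powr s"
    by (rule energy_estimate[where amp' = "\<lambda>_ _. 0" and \<Theta> = wav_int and ?M0.0 = M0])
      (use M s K in \<open>auto intro: DERIV_wav_int continuous_on_wav wav_int_zero wav_zero M0\<close>)
  then obtain C1 where C1: "C1 \<ge> 0" "\<And>N P w n. plane_frostman s K N P w \<Longrightarrow> P \<subseteq> B \<Longrightarrow> n \<le> N \<Longrightarrow>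
    integral J (\<lambda>l. cutoff l * integral {-(M+1)..M+1} (\<lambda>t. (wave wav (\<lambda>_ _. 1) P w n l t)^2)) \<le> C1 * 2^n * (1/2^n) powr s"
    by blast
  have "\<exists>C\<ge>0. \<forall>N P w n. plane_frostman s K N P w \<longrightarrow> P \<subseteq> B \<longrightarrow> n \<le> N \<longrightarrow>
    integral J (\<lambda>l. cutoff l * integral {-(M+1)..M+1} (\<lambda>t. (wave wav' h1 P w n l t)^2)) \<le> C * 2^n * (1/2^n) powr s"
    by (rule energy_estimate[where amp' = h11 and \<Theta> = wav and ?M0.0 = M0])
      (fact s K DERIV_wav continuous_on_wav' wav_zero wav'_zero M0 | erule (1) D2 | erule cont | use bound in blast)+
  then obtain C2 where C2: "C2 \<ge> 0" "\<And>N P w n. plane_frostman s K N P w \<Longrightarrow> P \<subseteq> B \<Longrightarrow> n \<le> N \<Longrightarrow>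
    integral J (\<lambda>l. cutoff l * integral {-(M+1)..M+1} (\<lambda>t. (wave wav' h1 P w n l t)^2)) \<le> C2 * 2^n * (1/2^n) powr s"
    by blast
  \<comment> \<open>8 = 2 * 4: the 2 comes from \<open>integral_wave_square_le\<close>, and
    4/\<rho>^2 is the Frostman constant 3 divided by the lower bound 3/4 \<rho>^2 of
    \<open>cutoff\<close>.\<close>
  define C where "C = 8 / \<rho>^2 * (C1 + C2)"
  have main: "integral {-(M+1)..M+1} (\<lambda>t. (\<Sum>l\<in>Q. v l * wave wav (\<lambda>_ _. 1) P w n l t)^2) \<le> C * (2^n)^2 * (1/2^n) powr (s1 + s)"
    if fr: "frostman s1 N Q v" and Q: "Q \<subseteq> {a-\<rho>/4..a+\<rho>/4}" and pf: "plane_frostman s K N P w" and P: "P \<subseteq> B"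
      and n: "n \<le> N" "1/2^n \<le> \<rho>/4" for N Q v P w n
  proof -
    define \<delta> :: real where "\<delta> = 1/2^n"
    define E1 where "E1 = wave wav (\<lambda>_ _. 1) P w n"
    define E2 where "E2 = wave wav' h1 P w n"
    define T where "T = {-(M+1)..M+1}"
    define g where "g = (\<lambda>l. integral T (\<lambda>t. (E1 l t)^2 + (E2 l t)^2))"
    have v: "finite Q" "\<And>l. 0 \<le> v l" "sum v Q \<le> 1" using fr by (auto simp: frostman_def)
    have finP: "finite P" using pf by (simp add: plane_frostman_def)
    have \<delta>: "\<delta> > 0" "\<delta> \<le> \<rho>/4" using n by (simp_all add: \<delta>_def)
    have ch1: "continuous_on J (\<lambda>l. h1 l x)" if "x \<in> B" for x
      by (rule DERIV_at_imp_continuous_on) (rule D2[OF _ that])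
    have cE: "continuous_on (J \<times> T) (\<lambda>p. E1 (fst p) (snd p))" "continuous_on (J \<times> T) (\<lambda>p. E2 (fst p) (snd p))"
      unfolding E1_def E2_def using P by (auto intro!: continuous_on_wave continuous_on_wav continuous_on_wav' ch1)
    have cEt: "continuous_on T (E1 l)" "continuous_on T (E2 l)" if "l \<in> J" for l
    proof -
      have im: "Pair l ` T \<subseteq> J \<times> T" using that by auto
      have c: "continuous_on T (Pair l)" by (intro continuous_intros)
      show "continuous_on T (E1 l)" "continuous_on T (E2 l)"
        using continuous_on_compose2[OF cE(1) c im] continuous_on_compose2[OF cE(2) c im] by simp_all
    qed
    have cint: "continuous_on J (\<lambda>l. integral T (\<lambda>t. (E1 l t)^2))" "continuous_on J (\<lambda>l. integral T (\<lambda>t. (E2 l t)^2))"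
      using integral_continuous_on_param[of J "-(M+1)" "M+1" "\<lambda>l t. (E1 l t)^2"]
        integral_continuous_on_param[of J "-(M+1)" "M+1" "\<lambda>l t. (E2 l t)^2"] continuous_on_power[OF cE(1), of 2] continuous_on_power[OF cE(2), of 2]
      by (simp_all add: T_def case_prod_beta)
    have g_eq: "g l = integral T (\<lambda>t. (E1 l t)^2) + integral T (\<lambda>t. (E2 l t)^2)" if "l \<in> J" for l
      unfolding g_def T_def
      by (intro integral_add integrable_continuous_interval continuous_intros) (use cEt[OF that] in \<open>auto simp: T_def\<close>)
    have cg: "continuous_on J g"
      using continuous_on_add[OF cint] by (rule continuous_on_cong[THEN iffD1, rotated 2]) (auto simp: g_eq)
    have g0: "g l \<ge> 0" if "l \<in> J" for l
    proof -
      have "(\<lambda>t. (E1 l t)^2) integrable_on T" "(\<lambda>t. (E2 l t)^2) integrable_on T"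
        unfolding T_def by (intro integrable_continuous_interval continuous_intros cEt[OF that, unfolded T_def])+
      then show ?thesis unfolding g_eq[OF that] by (intro add_nonneg_nonneg integral_nonneg) auto
    qed
    have ccut: "continuous_on J cutoff" unfolding cutoff_def by (intro continuous_intros)
    have cut_g: "integral J (\<lambda>l. cutoff l * g l) \<le> (C1 + C2) * 2^n * (1/2^n) powr s"
    proof -
      have "integral J (\<lambda>l. cutoff l * g l) = integral J (\<lambda>l. cutoff l * integral T (\<lambda>t. (E1 l t)^2) + cutoff l * integral T (\<lambda>t. (E2 l t)^2))"
        by (intro integral_cong) (simp add: g_eq distrib_left)
      also have "\<dots> = integral J (\<lambda>l. cutoff l * integral T (\<lambda>t. (E1 l t)^2)) + integral J (\<lambda>l. cutoff l * integral T (\<lambda>t. (E2 l t)^2))"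
        by (intro integral_add integrable_continuous_interval continuous_on_mult ccut cint)
      also have "\<dots> \<le> C1 * 2^n * (1/2^n) powr s + C2 * 2^n * (1/2^n) powr s"
        unfolding E1_def E2_def T_def by (rule add_mono[OF C1(2)[OF pf P n(1)] C2(2)[OF pf P n(1)]])
      finally show ?thesis by (simp add: algebra_simps)
    qed
    have sub: "{l..l+\<delta>} \<subseteq> J" "l \<in> J" "l + \<delta> \<in> J" if "l \<in> Q" for l
    proof -
      have "a - \<rho>/4 \<le> l" "l \<le> a + \<rho>/4" using Q that by auto
      then show "{l..l+\<delta>} \<subseteq> J" "l \<in> J" "l + \<delta> \<in> J" using \<delta> \<rho> by auto
    qed
    have restr: "integral {l..l+\<delta>} g = integral J (\<lambda>z. if z \<in> {l..l+\<delta>} then g z else 0)"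
      "(\<lambda>z. if z \<in> {l..l+\<delta>} then g z else 0) integrable_on J" if "l \<in> Q" for l
    proof -
      have eq: "J \<inter> {l..l+\<delta>} = {l..l+\<delta>}" "{l..l+\<delta>} \<inter> J = {l..l+\<delta>}" using sub(1)[OF that] by blast+
      show "integral {l..l+\<delta>} g = integral J (\<lambda>z. if z \<in> {l..l+\<delta>} then g z else 0)"
        unfolding integral_restrict_Int eq ..
      show "(\<lambda>z. if z \<in> {l..l+\<delta>} then g z else 0) integrable_on J"
        unfolding integrable_restrict_Int eq
        by (intro integrable_continuous_interval continuous_on_subset[OF cg sub(1)[OF that]])
    qed
    \<comment> \<open>After interchanging sum and integral, the density at z is the weight of those
      l with z in [l, l + \<delta>], at most 3 \<delta> powr s1 by the Frostman condition.\<close>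
    have "(\<Sum>l\<in>Q. v l * integral {l..l+\<delta>} g) = integral J (\<lambda>z. \<Sum>l\<in>Q. v l * (if z \<in> {l..l+\<delta>} then g z else 0))"
    proof -
      have "integral J (\<lambda>z. \<Sum>l\<in>Q. v l * (if z \<in> {l..l+\<delta>} then g z else 0)) =
        (\<Sum>l\<in>Q. integral J (\<lambda>z. v l * (if z \<in> {l..l+\<delta>} then g z else 0)))"
        by (intro integral_sum v(1) integrable_on_mult_right restr(2))
      then show ?thesis by (simp only: integral_mult_right restr(1) cong: sum.cong)
    qed
    also have "\<dots> \<le> integral J (\<lambda>z. 4 / \<rho>^2 * \<delta> powr s1 * (cutoff z * g z))"
    proof (rule integral_le)
      show "(\<lambda>z. \<Sum>l\<in>Q. v l * (if z \<in> {l..l+\<delta>} then g z else 0)) integrable_on J"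
        by (intro integrable_sum v(1) integrable_on_mult_right restr(2))
      show "(\<lambda>z. 4 / \<rho>^2 * \<delta> powr s1 * (cutoff z * g z)) integrable_on J"
        by (intro integrable_continuous_interval continuous_on_mult continuous_on_const ccut cg)
      fix z assume z: "z \<in> J"
      have eq: "(\<Sum>l\<in>Q. v l * (if z \<in> {l..l+\<delta>} then g z else 0)) = sum v {l\<in>Q. z \<in> {l..l+\<delta>}} * g z"
        unfolding sum.inter_filter[OF v(1)] sum_distrib_right by (rule sum.cong) auto
      show "(\<Sum>l\<in>Q. v l * (if z \<in> {l..l+\<delta>} then g z else 0)) \<le> 4 / \<rho>^2 * \<delta> powr s1 * (cutoff z * g z)"
      proof (cases "\<exists>l\<in>Q. z \<in> {l..l+\<delta>}")
        case False
        then have "{l\<in>Q. z \<in> {l..l+\<delta>}} = {}" by blast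
        then have "sum v {l\<in>Q. z \<in> {l..l+\<delta>}} * g z = 0" by (simp only: sum.empty mult_zero_left)
        moreover have "0 \<le> 4 / \<rho>^2 * \<delta> powr s1 * (cutoff z * g z)"
          using g0[OF z] cutoff_nonneg[OF z] by (intro mult_nonneg_nonneg) auto
        ultimately show ?thesis unfolding eq by linarith
      next
        case True
        then obtain l where l: "l \<in> Q" "z \<in> {l..l+\<delta>}" by blast
        have "a - \<rho>/4 \<le> l" "l \<le> a + \<rho>/4" using Q l by auto
        moreover have "l \<le> z" "z \<le> l + \<delta>" using l(2) by auto
        \<comment> \<open>\<open>Q\<close> lies within \<rho>/4 of the centre and \<delta> <=
          \<rho>/4, so z stays in the middle half of \<open>J\<close>.\<close>
        ultimately have "\<bar>z - a\<bar> \<le> \<rho>/2" using \<delta> by linarith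
        then have "(z - a)^2 \<le> (\<rho>/2)^2" using abs_le_square_iff[of "z - a" "\<rho>/2"] \<rho> by simp
        then have cutoff: "cutoff z \<ge> 3/4 * \<rho>^2" by (simp add: cutoff_def power_divide)
        have "{l\<in>Q. z \<in> {l..l+\<delta>}} \<subseteq> Q \<inter> {z - 1/2^n..z + 1/2^n}" using \<delta> by (auto simp: \<delta>_def)
        then have "sum v {l\<in>Q. z \<in> {l..l+\<delta>}} \<le> sum v (Q \<inter> {z - 1/2^n..z + 1/2^n})"
          using v by (intro sum_mono2) auto
        also have "\<dots> \<le> 3 * \<delta> powr s1" using fr n(1) by (simp add: frostman_def \<delta>_def)
        also have "\<dots> = 4 / \<rho>^2 * \<delta> powr s1 * (3/4 * \<rho>^2)" using \<rho> by simp
        also have "\<dots> \<le> 4 / \<rho>^2 * \<delta> powr s1 * cutoff z" using cutoff by (intro mult_left_mono) auto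
        finally have "sum v {l\<in>Q. z \<in> {l..l+\<delta>}} * g z \<le> 4 / \<rho>^2 * \<delta> powr s1 * cutoff z * g z"
          by (rule mult_right_mono) (rule g0[OF z])
        then show ?thesis unfolding eq by (simp only: mult.assoc)
      qed
    qed
    also have "\<dots> = 4 / \<rho>^2 * \<delta> powr s1 * integral J (\<lambda>z. cutoff z * g z)" by simp
    also have "\<dots> \<le> 4 / \<rho>^2 * \<delta> powr s1 * ((C1 + C2) * 2^n * (1/2^n) powr s)"
      using cut_g by (intro mult_left_mono) auto
    finally have sum_g: "(\<Sum>l\<in>Q. v l * integral {l..l+\<delta>} g) \<le> 4 / \<rho>^2 * \<delta> powr s1 * ((C1 + C2) * 2^n * (1/2^n) powr s)" .
    \<comment> \<open>Convexity: the total weight is at most 1, so the energy of the average is at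
      most the average of the energies.\<close>
    have "integral T (\<lambda>t. (\<Sum>l\<in>Q. v l * E1 l t)^2) \<le> integral T (\<lambda>t. \<Sum>l\<in>Q. v l * (E1 l t)^2)"
      unfolding T_def
      by (intro integral_le integrable_continuous_interval continuous_intros weighted_square_sum v cEt[unfolded T_def] sub(2))
    also have "\<dots> = (\<Sum>l\<in>Q. v l * integral T (\<lambda>t. (E1 l t)^2))"
    proof -
      have "integral {-(M+1)..M+1} (\<lambda>t. \<Sum>l\<in>Q. v l * (E1 l t)^2) = (\<Sum>l\<in>Q. integral {-(M+1)..M+1} (\<lambda>t. v l * (E1 l t)^2))"
        by (intro integral_sum v(1) integrable_continuous_interval continuous_intros cEt[unfolded T_def] sub(2))
      then show ?thesis by (simp add: T_def)
    qed
    also have "\<dots> \<le> (\<Sum>l\<in>Q. v l * (2 * 2^n * integral {l..l+\<delta>} g))"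
    proof (intro sum_mono mult_left_mono v)
      fix l assume l: "l \<in> Q"
      show "integral T (\<lambda>t. (E1 l t)^2) \<le> 2 * 2^n * integral {l..l+\<delta>} g"
        unfolding T_def E1_def g_def \<delta>_def E2_def
        by (rule integral_wave_square_le[OF finP P sub(2)[OF l] sub(3)[OF l, unfolded \<delta>_def]])
    qed
    also have "\<dots> = 2 * 2^n * (\<Sum>l\<in>Q. v l * integral {l..l+\<delta>} g)" by (simp add: sum_distrib_left mult_ac)
    also have "\<dots> \<le> 2 * 2^n * (4 / \<rho>^2 * \<delta> powr s1 * ((C1 + C2) * 2^n * (1/2^n) powr s))"
      using sum_g by (intro mult_left_mono) auto
    also have "\<dots> = C * (2^n)^2 * (1/2^n) powr (s1 + s)"
      by (simp add: C_def \<delta>_def powr_add power2_eq_square mult_ac)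
    finally show ?thesis unfolding T_def E1_def .
  qed
  show ?thesis
    by (intro exI[of _ C] conjI allI impI main) (use C1 C2 in \<open>auto simp: C_def\<close>)
qed

end

section \<open>From energy bounds to the size of the support\<close>

text \<open>For \<phi> = \<open>bump\<close>, a mollification at scale 1/2^n of the discrete measure
  with masses \<open>v i\<close> at the points \<open>q i\<close>, with \<open>bump_mass\<close> as
  normalising factor; for \<phi> = \<open>wav\<close>, the detail gained in passing to the next
  scale.\<close>

definition smear :: "(real \<Rightarrow> real) \<Rightarrow> 'i set \<Rightarrow> ('i \<Rightarrow> real) \<Rightarrow> ('i \<Rightarrow> real) \<Rightarrow> nat \<Rightarrow> real \<Rightarrow> real" where
  "smear \<phi> I q v n t = (\<Sum>i\<in>I. v i * (2^n * \<phi> (2^n * (t - q i))))"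

definition bump_mass :: real where "bump_mass = integral {-1..1} bump"

lemma continuous_on_smear:
  assumes "continuous_on UNIV \<phi>"
  shows "continuous_on S (smear \<phi> I q v n)"
proof -
  have "continuous_on S (\<lambda>t. \<phi> (2^n * (t - q i)))" for i
    by (rule continuous_on_compose2[OF assms]) (auto intro!: continuous_intros)
  then show ?thesis unfolding smear_def[abs_def]
    by (intro continuous_on_sum continuous_on_mult continuous_on_const)
qed

lemma bump_mass_pos: "bump_mass > 0"
proof -
  have "integral {-1/2..1/2 :: real} (\<lambda>_. 9/16 :: real) \<le> integral {-1/2..1/2} bump"
  proof (intro integral_le integrable_continuous_interval continuous_on_bump)
    fix t :: real assume "t \<in> {-1/2..1/2}"
    then have "t^2 \<le> (1/2)^2" by (subst abs_le_square_iff[symmetric]) auto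
    then have "3/4 \<le> 1 - t^2" by (simp add: power_divide)
    then have "(3/4)^2 \<le> (1 - t^2)^2" by (rule power_mono) simp
    then show "9/16 \<le> bump t" using \<open>3/4 \<le> 1 - t^2\<close> by (simp add: bump_def power_divide)
  qed auto
  also have "\<dots> \<le> integral {-1..1} bump"
    by (intro integral_subset_le integrable_continuous_interval continuous_on_bump) (auto simp: bump_nonneg)
  finally show ?thesis by (simp add: bump_mass_def)
qed

lemma integral_scaled_bump:
  assumes "\<bar>q\<bar> \<le> T - 1"
  shows "((\<lambda>t. 2^n * bump (2^n * (t - q))) has_integral bump_mass) {-T..T}"
proof -
  have "(bump has_integral bump_mass) {-1..1}"
    unfolding bump_mass_def by (intro integrable_integral integrable_continuous_interval continuous_on_bump)
  from has_integral_mult_right[OF has_integral_rescaled[OF this bump_zero assms], of "2^n" n]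
  show ?thesis by simp
qed

text \<open>By \<open>bump_two_scale\<close>, passing to the next finer mollification adds exactly
  one \<open>wav\<close> term.\<close>

lemma smear_bump_telescope:
  assumes "n0 \<le> n"
  shows "smear bump I q v n t \<le> smear bump I q v n0 t + (\<Sum>m\<in>{n0..<n}. \<bar>smear wav I q v m t\<bar>)"
  using assms
proof (induction n rule: dec_induct)
  case (step n)
  have "smear bump I q v (Suc n) t - smear bump I q v n t = smear wav I q v n t"
    unfolding smear_def sum_subtractf[symmetric] right_diff_distrib[symmetric] bump_two_scale ..
  then have "smear bump I q v (Suc n) t \<le> smear bump I q v n t + \<bar>smear wav I q v n t\<bar>" by linarith
  then show ?case using step by simp
qed simp

text \<open>The inequality \<open>\<bar>z\<bar> \<le> \<kappa> + z^2 / \<kappa>\<close> is used in place of Cauchy--Schwarz; the \<open>\<kappa> m\<close> are chosen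
  differently for the two conclusions drawn from this bound.\<close>

lemma mass_bound:
  fixes I :: "'i set" and q v :: "'i \<Rightarrow> real" and \<kappa> :: "nat \<Rightarrow> real"
  assumes I: "finite I" "\<And>i. i \<in> I \<Longrightarrow> \<bar>q i\<bar> \<le> T - 1 \<and> 0 \<le> v i" "sum v I \<le> 1"
    and M: "\<And>t. \<bar>bump t\<bar> \<le> M"
    and n: "n0 \<le> n"
    and I': "I' \<subseteq> I" "\<And>i. i \<in> I' \<Longrightarrow> {q i - 1/2^n..q i + 1/2^n} \<inter> {-T..T} \<subseteq> E" and E: "E \<in> sets borel" "E \<subseteq> {-T..T}"
    and \<kappa>: "\<And>m. \<kappa> m > 0"
    and en: "\<And>m. n0 \<le> m \<Longrightarrow> m < n \<Longrightarrow> integral {-T..T} (\<lambda>t. (smear wav I q v m t)^2) \<le> en m"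
  shows "bump_mass * sum v I' \<le> 2^n0 * M * measure lborel E + (\<Sum>m\<in>{n0..<n}. \<kappa> m * measure lborel E + en m / \<kappa> m)"
proof -
  have M0: "M \<ge> 0" using M[of 0] by linarith
  have sint: "set_integrable lborel {-T..T} g" if "continuous_on {-T..T} g" for g :: "real \<Rightarrow> real"
    by (rule borel_integrable_atLeastAtMost'[OF that])
  have sintE: "set_integrable lborel E g" if "continuous_on UNIV g" for g :: "real \<Rightarrow> real"
    by (rule set_integrable_subset[OF sint[OF continuous_on_subset[OF that subset_UNIV]]]) (use E in simp_all)
  have \<kappa>0: "\<kappa> m \<noteq> 0" for m using \<kappa>[of m] by simp
  have set_sum: "(LINT t:E|lborel. \<Sum>m\<in>S. g m t) = (\<Sum>m\<in>S. LINT t:E|lborel. g m t)"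
    if "\<And>m. continuous_on UNIV (g m)" for g :: "nat \<Rightarrow> real \<Rightarrow> real" and S
    unfolding set_lebesgue_integral_def scaleR_sum_right
    by (rule Bochner_Integration.integral_sum) (use sintE[OF that] in \<open>simp add: set_integrable_def\<close>)
  have Efin: "emeasure lborel E < \<infinity>"
    by (rule le_less_trans[OF emeasure_mono[OF E(2)]]) (auto simp: emeasure_lborel_Icc_eq)
  have constE: "(LINT t:E|lborel. c) = c * measure lborel E" for c :: real
    using Efin E by (simp add: set_lebesgue_integral_def mult.commute)
  have cb: "continuous_on S (smear bump J q v m)" for S and J :: "'i set" and m
    by (rule continuous_on_smear[OF continuous_on_bump])
  have cw: "continuous_on S (smear wav I q v m)" for S m
    by (rule continuous_on_smear[OF continuous_on_wav])
  \<comment> \<open>The mollified masses with index in \<open>I'\<close> vanish on [-T, T] outside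
    \<open>E\<close>, so \<open>E\<close> sees all of their mass; the remaining masses are
    nonnegative and only add to it.\<close>
  have low: "bump_mass * sum v I' \<le> (LINT t:E|lborel. smear bump I q v n t)"
  proof -
    have finI': "finite I'" using I(1) I'(1) finite_subset by blast
    have "((\<lambda>t. smear bump I' q v n t) has_integral (\<Sum>i\<in>I'. v i * bump_mass)) {-T..T}"
      unfolding smear_def using I I' finI'
      by (intro has_integral_sum has_integral_mult_right integral_scaled_bump) auto
    then have "bump_mass * sum v I' = integral {-T..T} (smear bump I' q v n)"
      by (simp add: integral_unique sum_distrib_left mult.commute)
    also have "\<dots> = (LINT t:{-T..T}|lborel. smear bump I' q v n t)"
      by (rule set_borel_integral_eq_integral(2)[symmetric]) (rule sint[OF cb])
    also have "\<dots> \<le> (LINT t:E|lborel. smear bump I q v n t)"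
      unfolding set_lebesgue_integral_def
    proof (rule integral_mono)
      show "integrable lborel (\<lambda>t. indicat_real {-T..T} t *\<^sub>R smear bump I' q v n t)"
        using sint[OF cb] by (simp add: set_integrable_def)
      show "integrable lborel (\<lambda>t. indicat_real E t *\<^sub>R smear bump I q v n t)"
        using sintE[OF cb] by (simp add: set_integrable_def)
      fix t
      have mono: "smear bump I' q v n t \<le> smear bump I q v n t"
        unfolding smear_def using I I' by (intro sum_mono2) (auto simp: bump_nonneg)
      show "indicat_real {-T..T} t *\<^sub>R smear bump I' q v n t \<le> indicat_real E t *\<^sub>R smear bump I q v n t"
      proof (cases "t \<in> E")
        case True then show ?thesis using mono E(2) by (auto simp: indicator_def)
      next
        case False
        have "smear bump I' q v n t = 0" if "t \<in> {-T..T}"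
          unfolding smear_def
        proof (rule sum.neutral, rule ballI)
          fix i assume "i \<in> I'"
          then have "t \<notin> {q i - 1/2^n..q i + 1/2^n}" using I'(2) False that by blast
          then show "v i * (2^n * bump (2^n * (t - q i))) = 0" by (simp add: bump_zero scaled_distance)
        qed
        then show ?thesis using False by (auto simp: indicator_def)
      qed
    qed
    finally show ?thesis .
  qed
  have cu: "continuous_on UNIV (\<lambda>t. 2^n0 * M + (\<Sum>m\<in>{n0..<n}. \<kappa> m + (smear wav I q v m t)^2 / \<kappa> m))"
    by (intro continuous_intros cw) (simp add: \<kappa>0)
  have "(LINT t:E|lborel. smear bump I q v n t) \<le>
    (LINT t:E|lborel. 2^n0 * M + (\<Sum>m\<in>{n0..<n}. \<kappa> m + (smear wav I q v m t)^2 / \<kappa> m))"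
  proof (intro set_integral_mono sintE cb cu)
    fix t
    \<comment> \<open>The coarsest mollification is bounded pointwise, so its share is controlled by
      the measure of \<open>E\<close>.\<close>
    have "smear bump I q v n0 t \<le> 2^n0 * M"
    proof -
      have "smear bump I q v n0 t \<le> (\<Sum>i\<in>I. v i * (2^n0 * M))"
        unfolding smear_def using I M by (intro sum_mono mult_left_mono) (auto simp: abs_le_iff)
      also have "\<dots> = sum v I * (2^n0 * M)" by (simp add: sum_distrib_right)
      also have "\<dots> \<le> 1 * (2^n0 * M)" using I M0 by (intro mult_right_mono) auto
      finally show ?thesis by simp
    qed
    moreover have amgm: "\<bar>z\<bar> \<le> k + z^2 / k" if "k > 0" for z k :: real
    proof -
      have "0 \<le> (\<bar>z\<bar> - k)^2 / k" using that by simp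
      also have "\<dots> = k + z^2 / k - 2 * \<bar>z\<bar>" using that by (simp add: power2_diff field_simps power2_eq_square)
      finally show ?thesis by simp
    qed
    ultimately show "smear bump I q v n t \<le> 2^n0 * M + (\<Sum>m\<in>{n0..<n}. \<kappa> m + (smear wav I q v m t)^2 / \<kappa> m)"
      by (intro order_trans[OF smear_bump_telescope[OF n]] add_mono sum_mono amgm \<kappa>)
  qed
  also have "\<dots> = 2^n0 * M * measure lborel E + (\<Sum>m\<in>{n0..<n}. \<kappa> m * measure lborel E + (LINT t:E|lborel. (smear wav I q v m t)^2) / \<kappa> m)"
  proof -
    have c2: "continuous_on UNIV (\<lambda>t. (smear wav I q v m t)^2 / \<kappa> m)" for m
      by (intro continuous_intros cw) (simp add: \<kappa>0)
    have "(LINT t:E|lborel. \<Sum>m\<in>{n0..<n}. \<kappa> m + (smear wav I q v m t)^2 / \<kappa> m) =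
      (\<Sum>m\<in>{n0..<n}. LINT t:E|lborel. \<kappa> m + (smear wav I q v m t)^2 / \<kappa> m)"
      by (intro set_sum continuous_on_add c2 continuous_on_const)
    also have "\<dots> = (\<Sum>m\<in>{n0..<n}. \<kappa> m * measure lborel E + (LINT t:E|lborel. (smear wav I q v m t)^2) / \<kappa> m)"
      by (intro sum.cong refl) (simp add: set_integral_add(2)[OF sintE[OF continuous_on_const] sintE[OF c2]] constE)
    moreover have "(LINT t:E|lborel. 2^n0 * M + (\<Sum>m\<in>{n0..<n}. \<kappa> m + (smear wav I q v m t)^2 / \<kappa> m)) =
      (LINT t:E|lborel. 2^n0 * M) + (LINT t:E|lborel. \<Sum>m\<in>{n0..<n}. \<kappa> m + (smear wav I q v m t)^2 / \<kappa> m)"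
      by (rule set_integral_add(2)) (intro sintE continuous_on_sum continuous_on_add c2 continuous_on_const)+
    ultimately show ?thesis using constE[of "2^n0 * M"] by linarith
  qed
  also have "\<dots> \<le> 2^n0 * M * measure lborel E + (\<Sum>m\<in>{n0..<n}. \<kappa> m * measure lborel E + en m / \<kappa> m)"
  proof (intro add_left_mono sum_mono divide_right_mono)
    fix m assume m: "m \<in> {n0..<n}"
    have c2: "continuous_on S (\<lambda>t. (smear wav I q v m t)^2)" for S by (intro continuous_intros cw)
    have "(LINT t:E|lborel. (smear wav I q v m t)^2) \<le> (LINT t:{-T..T}|lborel. (smear wav I q v m t)^2)"
      unfolding set_lebesgue_integral_def
      by (rule integral_mono) (use E sint[OF c2] sintE[OF c2] in \<open>auto simp: set_integrable_def indicator_def\<close>)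
    also have "\<dots> = integral {-T..T} (\<lambda>t. (smear wav I q v m t)^2)"
      by (rule set_borel_integral_eq_integral(2)) (rule sint[OF c2])
    also have "\<dots> \<le> en m" using m by (intro en) auto
    finally show "(LINT t:E|lborel. (smear wav I q v m t)^2) \<le> en m" .
    show "0 \<le> \<kappa> m" using \<kappa>[of m] by simp
  qed
  finally show ?thesis using low by linarith
qed

definition scale_weights :: "real \<Rightarrow> real \<Rightarrow> real \<Rightarrow> nat \<Rightarrow> real \<Rightarrow> real set \<Rightarrow> nat \<Rightarrow> 'i set \<Rightarrow> ('i \<Rightarrow> real) \<Rightarrow> ('i \<Rightarrow> real) \<Rightarrow> bool" where
  "scale_weights \<gamma> c C n0 T S N I q v \<longleftrightarrow> finite I \<and> (\<forall>i\<in>I. q i \<in> S \<and> 0 \<le> v i) \<and> c \<le> sum v I \<and> sum v I \<le> 1 \<and>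
    (\<forall>n. n0 \<le> n \<longrightarrow> n \<le> N \<longrightarrow> integral {-T..T} (\<lambda>t. (smear wav I q v n t)^2) \<le> C * 2 powr (\<gamma> * real n))"

text \<open>The energies of weights of total dimension \<open>\<sigma>\<close> grow with \<open>\<gamma> = 2 - \<sigma>\<close>. The weights may depend
  on the finest scale \<open>N\<close>, the constants may not.\<close>

definition spread :: "real \<Rightarrow> real set \<Rightarrow> bool" where
  "spread \<gamma> S \<longleftrightarrow> (\<exists>c>0. \<exists>C\<ge>0. \<exists>n0 T. S \<subseteq> {-(T-1)..T-1} \<and>
    (\<forall>N. \<exists>(I :: (real \<times> real \<times> real) set) q v. scale_weights \<gamma> c C n0 T S N I q v))"

section \<open>Decaying energies force positive measure\<close>

lemma sum_power_le:
  fixes r :: real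
  assumes "0 \<le> r" "r < 1" "finite S"
  shows "(\<Sum>m\<in>S. r^m) \<le> 1 / (1 - r)"
proof -
  have "(\<Sum>m\<in>S. r^m) \<le> (\<Sum>m. r^m)"
    using assms by (intro sum_le_suminf summable_geometric) auto
  also have "\<dots> = 1 / (1 - r)" using assms by (intro suminf_geometric) auto
  finally show ?thesis .
qed

text \<open>Were \<open>S\<close> null, its neighbourhoods of small measure would contain the whole
  finest mollification. For \<kappa> m proportional to 2 powr (\<gamma> m / 2), both
  \<open>\<kappa> m\<close> and the energy bound divided by \<open>\<kappa> m\<close> are geometric,
  so a mass of at least b would be at most 2b/3.\<close>

lemma spread_imp_positive_measure:
  assumes S: "compact S" and sp: "spread \<gamma> S" and \<gamma>: "\<gamma> < 0"
  shows "emeasure lebesgue S > 0"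
proof (rule ccontr)
  assume "\<not> ?thesis"
  then have zero: "emeasure lebesgue S = 0" by simp
  obtain c C n0 T where c: "c > 0" "C \<ge> 0" "S \<subseteq> {-(T-1)..T-1}" and
    ex: "\<And>N. \<exists>(I :: (real \<times> real \<times> real) set) q v. scale_weights \<gamma> c C n0 T S N I q v"
    using sp unfolding spread_def by blast
  obtain M where M: "M \<ge> 1" "\<And>t. \<bar>bump t\<bar> \<le> M" using kernel_bound by blast
  define b where "b = bump_mass * c"
  have b: "b > 0" using c bump_mass_pos by (simp add: b_def)
  define r where "r = 2 powr (\<gamma>/2)"
  have r: "0 < r" "r < 1" using \<gamma> by (simp_all add: r_def powr_less_one)
  have r2: "2 powr (\<gamma> * real m) = r^m * r^m" for m
    unfolding r_def by (simp add: powr_realpow[symmetric] powr_powr powr_add[symmetric])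
  define G where "G = 1 / (1 - r)"
  have G: "G > 0" using r by (simp add: G_def)
  \<comment> \<open>\<open>K\<close> makes the energy part of \<open>mass_bound\<close> at most b/3;
    afterwards \<open>e\<close> makes the part proportional to the measure of \<open>E\<close> at
    most b/3. Neither depends on \<open>N\<close>, which is read off from the neighbourhood.\<close>
  define K where "K = 3 * C * G / b + 1"
  have K: "K > 0" "C * G / K \<le> b / 3"
  proof -
    have "0 \<le> 3 * C * G / b" using c G b by simp
    then show "K > 0" unfolding K_def by linarith
    have "C * G \<le> b / 3 * K" unfolding K_def using b by (simp add: field_simps)
    then show "C * G / K \<le> b / 3" using \<open>K > 0\<close> by (simp add: field_simps)
  qed
  define A where "A = 2^n0 * M + K * G"
  have A: "A > 0" unfolding A_def using M K G by (intro add_pos_pos) auto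
  define e where "e = b / (3 * A)"
  have e: "e > 0" using A b by (simp add: e_def)
  have "S \<in> sets lebesgue" using S by (intro lmeasurable_compact[THEN fmeasurableD])
  then obtain U where U: "open U" "S \<subseteq> U" "(U - S) \<in> lmeasurable" "emeasure lebesgue (U - S) < ennreal e"
    using sets_lebesgue_outer_open[OF _ e] by blast
  obtain \<eta> where \<eta>: "\<eta> > 0" "(\<Union>x\<in>S. cball x \<eta>) \<subseteq> U"
    using compact_subset_open_imp_cball_epsilon_subset[OF S U(1,2)] by blast
  obtain N1 where "(1/2)^N1 < \<eta>" using real_arch_pow_inv[OF \<eta>(1), of "1/2"] by auto
  define N where "N = max n0 N1"
  have "(1/2::real)^N \<le> (1/2)^N1" by (rule power_decreasing) (auto simp: N_def)
  then have N: "n0 \<le> N" "1/2^N \<le> \<eta>" using \<open>(1/2)^N1 < \<eta>\<close> by (auto simp: N_def power_divide)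
  define E where "E = U \<inter> {-T..T}"
  have E: "E \<in> sets borel" "E \<subseteq> {-T..T}" using U(1) by (auto simp: E_def)
  have mE: "measure lborel E \<le> e"
  proof -
    have "emeasure lborel E = emeasure lebesgue E" using E(1) by simp
    also have "\<dots> \<le> emeasure lebesgue (S \<union> (U - S))"
      by (intro emeasure_mono sets.Un \<open>S \<in> sets lebesgue\<close> fmeasurableD U(3)) (auto simp: E_def)
    also have "\<dots> \<le> emeasure lebesgue S + emeasure lebesgue (U - S)"
      by (intro emeasure_subadditive \<open>S \<in> sets lebesgue\<close> fmeasurableD U(3))
    also have "\<dots> \<le> ennreal e" using zero U(4) by simp
    finally show ?thesis unfolding measure_def using e by (intro enn2real_leI) auto
  qed
  obtain I :: "(real \<times> real \<times> real) set" and q v where I: "finite I" "\<And>i. i \<in> I \<Longrightarrow> q i \<in> S \<and> 0 \<le> v i" "c \<le> sum v I" "sum v I \<le> 1"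
    "\<And>n. n0 \<le> n \<Longrightarrow> n \<le> N \<Longrightarrow> integral {-T..T} (\<lambda>t. (smear wav I q v n t)^2) \<le> C * 2 powr (\<gamma> * real n)"
    using ex[of N] unfolding scale_weights_def by blast
  have "bump_mass * sum v I \<le> 2^n0 * M * measure lborel E +
      (\<Sum>m\<in>{n0..<N}. K * r^m * measure lborel E + C * (r^m * r^m) / (K * r^m))"
  proof (rule mass_bound[where T = T and q = q])
    show "\<bar>q i\<bar> \<le> T - 1 \<and> 0 \<le> v i" if "i \<in> I" for i
      using I(2)[OF that] c(3) by (auto simp: abs_le_iff)
    show "{q i - 1/2^N..q i + 1/2^N} \<inter> {-T..T} \<subseteq> E" if "i \<in> I" for i
    proof
      fix x assume x: "x \<in> {q i - 1/2^N..q i + 1/2^N} \<inter> {-T..T}"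
      then have "q i - 1/2^N \<le> x" "x \<le> q i + 1/2^N" by auto
      then have "\<bar>q i - x\<bar> \<le> \<eta>" using N(2) by linarith
      then have "x \<in> cball (q i) \<eta>" by (simp add: dist_real_def)
      then have "x \<in> U" using \<eta>(2) I(2)[OF that] by blast
      then show "x \<in> E" using x by (auto simp: E_def)
    qed
    show "0 < K * r^m" for m using K r by simp
    show "integral {-T..T} (\<lambda>t. (smear wav I q v m t)^2) \<le> C * (r^m * r^m)" if "n0 \<le> m" "m < N" for m
      using I(5)[of m] that by (simp add: r2)
  qed (use I M N E in auto)
  also have "(\<Sum>m\<in>{n0..<N}. K * r^m * measure lborel E + C * (r^m * r^m) / (K * r^m)) =
      (K * measure lborel E + C / K) * (\<Sum>m\<in>{n0..<N}. r^m)"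
    unfolding sum_distrib_left using r K by (intro sum.cong) (auto simp: field_simps)
  also have "2^n0 * M * measure lborel E + (K * measure lborel E + C / K) * (\<Sum>m\<in>{n0..<N}. r^m) \<le>
      2^n0 * M * measure lborel E + (K * measure lborel E + C / K) * G"
    unfolding G_def using r K c by (intro add_left_mono mult_left_mono sum_power_le) auto
  also have "\<dots> = A * measure lborel E + C * G / K" by (simp add: A_def algebra_simps)
  also have "\<dots> \<le> A * e + b / 3" using mE A K(2) by (intro add_mono mult_left_mono) auto
  also have "\<dots> = 2 * b / 3" using A by (simp add: e_def)
  finally have "bump_mass * sum v I \<le> 2 * b / 3" .
  moreover have "b \<le> bump_mass * sum v I" unfolding b_def using I(3) bump_mass_pos by simp
  ultimately show False using b by linarith
qed

section \<open>Slowly growing energies exclude efficient covers\<close>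

lemma exists_dyadic_scale:
  fixes l :: real
  assumes "0 < l" "l \<le> 1/2^n0"
  shows "\<exists>n\<ge>n0. 1/2^Suc n < l \<and> l \<le> 1/2^n"
proof -
  obtain n where n: "(1/2)^n < l" using real_arch_pow_inv[OF assms(1), of "1/2"] by auto
  have "1/2^n0 \<le> (1::real)" by simp
  then have "l \<le> 1" using assms(2) by linarith
  from dyadic_scale[OF this, of n] n obtain k where k: "1/2^Suc k < l" "l \<le> 1/2^k"
    by (auto simp: power_divide)
  have "n0 \<le> k"
  proof (rule ccontr)
    assume "\<not> ?thesis"
    then have "Suc k \<le> n0" by simp
    then have "(1/2::real)^n0 \<le> (1/2)^Suc k" by (rule power_decreasing) auto
    then show False using k(1) assms(2) by (simp add: power_divide)
  qed
  then show ?thesis using k by blast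
qed

text \<open>Each covering set is replaced by an open interval around one of its points, with radius
  slightly above its diameter; the surplus costs sum to at most e/2. Compactness leaves finitely
  many intervals, hence finitely many scales.\<close>

lemma content_null_interval_cover:
  assumes S: "compact S" "content_null u S" and u: "u > 0" and e: "e > 0"
  shows "\<exists>(D::nat set) x l. finite D \<and> S \<subseteq> (\<Union>j\<in>D. {x j - l j<..<x j + l j}) \<and> (\<forall>j\<in>D. 0 < l j) \<and>
    (\<Sum>j\<in>D. l j powr u) \<le> (e::real)"
proof -
  have "content_le u S (e/2)" using S(2) e unfolding content_null_def by auto
  then obtain U where U: "S \<subseteq> (\<Union>n. U n)" "\<And>n. bounded (U n)"
      "(\<Sum>n. ennreal (diameter (U n) powr u)) \<le> ennreal (e/2)"
    unfolding content_le_def by blast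
  \<comment> \<open>For empty \<open>U n\<close> this is an arbitrary point; the additional interval
    does no harm.\<close>
  define x where "x = (\<lambda>n. SOME y. y \<in> U n)"
  define p where "p = (\<lambda>n. diameter (U n) powr u + (e/2) * (1/2)^Suc n)"
  define l where "l = (\<lambda>n. p n powr (1/u))"
  have p: "p n > 0" for n unfolding p_def using e by (intro add_nonneg_pos) auto
  have l: "l n > 0" "l n powr u = p n" for n using p[of n] u by (auto simp: l_def powr_powr)
  have dl: "diameter (U n) < l n" for n
  proof -
    have "diameter (U n) powr u < l n powr u" unfolding l(2) p_def using e by simp
    then show ?thesis
      using l(1)[of n] u powr_mono2[of u "l n" "diameter (U n)"] by (meson less_imp_le not_less)
  qed
  have "S \<subseteq> (\<Union>n\<in>UNIV. {x n - l n<..<x n + l n})"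
  proof
    fix y assume "y \<in> S"
    then obtain n where n: "y \<in> U n" using U(1) by blast
    then have "x n \<in> U n" unfolding x_def by (rule someI)
    then have "dist y (x n) \<le> diameter (U n)" using n U(2) by (intro diameter_bounded_bound)
    then have "\<bar>y - x n\<bar> < l n" using dl[of n] by (simp add: dist_real_def)
    then show "y \<in> (\<Union>n\<in>UNIV. {x n - l n<..<x n + l n})" by (intro UN_I[of n]) (auto simp: abs_less_iff)
  qed
  then obtain D where D: "finite D" "S \<subseteq> (\<Union>j\<in>D. {x j - l j<..<x j + l j})"
    using compactE_image[OF S(1), of UNIV "\<lambda>n. {x n - l n<..<x n + l n}"] by auto
  have "(\<Sum>j\<in>D. l j powr u) = (\<Sum>j\<in>D. diameter (U j) powr u) + e/2 * (\<Sum>j\<in>D. (1/2)^Suc j)"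
    by (simp add: l(2) p_def sum.distrib sum_distrib_left)
  also have "(\<Sum>j\<in>D. diameter (U j) powr u) \<le> e/2"
  proof -
    have "ennreal (\<Sum>j\<in>D. diameter (U j) powr u) = (\<Sum>j\<in>D. ennreal (diameter (U j) powr u))"
      by (rule sum_ennreal[symmetric]) simp
    also have "\<dots> \<le> ennreal (e/2)" by (rule order_trans[OF sum_le_suminf U(3)]) (use D in auto)
    finally show ?thesis using e by (simp add: ennreal_le_iff)
  qed
  also have "(\<Sum>j\<in>D. (1/2::real)^Suc j) \<le> 1"
    using sum_power_le[of "1/2" D] D(1) by (simp add: sum_divide_distrib[symmetric])
  then have "e/2 + e/2 * (\<Sum>j\<in>D. (1/2)^Suc j) \<le> e/2 + e/2 * 1" using e by (intro add_left_mono mult_left_mono) auto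
  finally have "(\<Sum>j\<in>D. l j powr u) \<le> e" by simp
  then show ?thesis using D l(1) by blast
qed

text \<open>At scale n the mass bound sums up to n equal terms. Half of the exponential gain absorbs
  this factor, and the other half still gives a convergent series.\<close>

lemma linear_le_exponential:
  fixes \<epsilon> :: real
  assumes "\<epsilon> > 0"
  shows "\<exists>H\<ge>1. \<forall>n::nat. real n * 2 powr (- real n * \<epsilon>) \<le> H * (2 powr (- \<epsilon> / 2))^n"
proof -
  define H where "H = 1 + 2 / (\<epsilon> * ln 2)"
  have "real n * 2 powr (- real n * \<epsilon>) \<le> H * (2 powr (- \<epsilon> / 2))^n" for n
  proof -
    define y where "y = 2 powr (- (real n * \<epsilon> / 2))"
    have y: "y > 0" by (simp add: y_def)
    have "1 + real n * \<epsilon> / 2 * ln 2 \<le> exp (real n * \<epsilon> / 2 * ln 2)" by (rule exp_ge_add_one_self)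
    also have "\<dots> = 1 / y"
    proof -
      have "y = exp (- (real n * \<epsilon> / 2 * ln 2))" unfolding y_def powr_def by simp
      then show ?thesis by (simp only: exp_minus inverse_eq_divide divide_divide_eq_right mult_1)
    qed
    finally have "real n * (\<epsilon> * ln 2) \<le> 2 * (1 / y)" by (simp add: algebra_simps)
    moreover have "\<epsilon> * ln 2 > 0" using assms by simp
    ultimately have "real n \<le> 2 * (1 / y) / (\<epsilon> * ln 2)" by (simp only: pos_le_divide_eq)
    then have "real n \<le> 2 / (\<epsilon> * ln 2) * (1 / y)" by (simp add: mult.commute mult.left_commute)
    also have "\<dots> \<le> H * (1 / y)" using y by (intro mult_right_mono) (auto simp: H_def)
    finally have "real n * (y * y) \<le> H * (1 / y) * (y * y)" using y by (intro mult_right_mono) auto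
    moreover have "2 powr (- real n * \<epsilon>) = y * y" by (simp add: y_def powr_add[symmetric] mult.commute)
    moreover have "(2 powr (- \<epsilon> / 2))^n = y" by (simp add: y_def powr_powr mult.commute flip: powr_realpow)
    ultimately show ?thesis using y by simp
  qed
  moreover have "H \<ge> 1" using assms by (simp add: H_def)
  ultimately show ?thesis by blast
qed

text \<open>The intervals of an efficient cover are sorted by dyadic length. Those of radius about
  1/2^n catch the weights with index in \<open>In n\<close>, and \<open>mass_bound\<close> is
  applied at that very scale with \<open>E\<close> their neighbourhood. Its measure is at most a
  multiple of 2 powr (- n (1 - u)) times the sum \<open>L n\<close> of their costs. Summed over n,
  the bounds stay below the total mass.\<close>

lemma spread_imp_not_content_null:
  assumes S: "compact S" and sp: "spread \<gamma> S" and u: "0 < u" "u < 1" and \<gamma>: "\<gamma> < 1 - u"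
  shows "\<not> content_null u S"
proof
  assume null: "content_null u S"
  obtain c C n0 T where c: "c > 0" "C \<ge> 0" "S \<subseteq> {-(T-1)..T-1}" and
    ex: "\<And>N. \<exists>(I :: (real \<times> real \<times> real) set) q v. scale_weights \<gamma> c C n0 T S N I q v"
    using sp unfolding spread_def by blast
  obtain M where M: "M \<ge> 1" "\<And>t. \<bar>bump t\<bar> \<le> M" using kernel_bound by blast
  \<comment> \<open>Half the room between the growth rate \<gamma> and 1 - u. The maximum with 0
    makes 2 powr ((1 - u - 2 \<epsilon>) n) nondecreasing in n, so that it also bounds the energies
    of all coarser scales m < n.\<close>
  define \<epsilon> where "\<epsilon> = (1 - u - max \<gamma> 0) / 2"
  have \<epsilon>: "\<epsilon> > 0" using \<gamma> u by (simp add: \<epsilon>_def max_def)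
  have "1 - u - 2 * \<epsilon> = max \<gamma> 0" by (simp add: \<epsilon>_def field_simps)
  then have \<gamma>': "\<gamma> \<le> 1 - u - 2 * \<epsilon>" "0 \<le> 1 - u - 2 * \<epsilon>" by simp_all
  obtain H where H: "H \<ge> 1" "\<And>n. real n * 2 powr (- real n * \<epsilon>) \<le> H * (2 powr (- \<epsilon> / 2))^n"
    using linear_le_exponential[OF \<epsilon>] by blast
  define r where "r = 2 powr (- \<epsilon> / 2)"
  have r: "0 < r" "r < 1" using \<epsilon> by (simp_all add: r_def powr_less_one)
  define G where "G = 1 / (1 - r)"
  have G: "G > 0" using r by (simp add: G_def)
  define b where "b = bump_mass * c"
  have b: "b > 0" using c bump_mass_pos by (simp add: b_def)
  define K where "K = 3 * C * H * G / b + 1"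
  have K: "K > 0" "C * H * G / K \<le> b / 3"
  proof -
    have "0 \<le> 3 * C * H * G / b" using c G b H by simp
    then show "K > 0" unfolding K_def by linarith
    have "C * H * G \<le> b / 3 * K" unfolding K_def using b by (simp add: field_simps)
    then show "C * H * G / K \<le> b / 3" using \<open>K > 0\<close> by (simp add: field_simps)
  qed
  \<comment> \<open>8 = 4 * 2: an enlarged interval has length 4/2^n, and (2 l)^u <= 2 l^u as u <
    1.\<close>
  define A where "A = 8 * (2^n0 * M + K * H)"
  have A: "A > 0" unfolding A_def using M K H by (intro mult_pos_pos add_pos_pos) auto
  \<comment> \<open>The second term forces every radius \<open>l j\<close> to be at most 1/2^n0, the
    first scale with controlled energy.\<close>
  define e where "e = min (b / (3 * A)) ((1/2^n0) powr u)"
  have e: "e > 0" "A * e \<le> b / 3" "e \<le> (1/2^n0) powr u"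
  proof -
    show "e > 0" "e \<le> (1/2^n0) powr u" using A b by (auto simp: e_def)
    have "A * e \<le> A * (b / (3 * A))" using A by (intro mult_left_mono) (auto simp: e_def)
    then show "A * e \<le> b / 3" using A by simp
  qed
  obtain D :: "nat set" and x l where D: "finite D" "S \<subseteq> (\<Union>j\<in>D. {x j - l j<..<x j + l j})" "\<And>j. j \<in> D \<Longrightarrow> 0 < l j"
    "(\<Sum>j\<in>D. l j powr u) \<le> e"
    using content_null_interval_cover[OF S null u(1) e(1)] by blast
  have "\<exists>n\<ge>n0. 1/2^Suc n < l j \<and> l j \<le> 1/2^n" if "j \<in> D" for j
  proof (rule exists_dyadic_scale[OF D(3)[OF that]])
    have "l j powr u \<le> (\<Sum>j\<in>D. l j powr u)" using D(1) that by (intro member_le_sum) auto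
    then have "l j powr u \<le> (1/2^n0) powr u" using D(4) e(3) by linarith
    then show "l j \<le> 1/2^n0" using u(1) D(3)[OF that] powr_less_mono2[of u "1/2^n0" "l j"] by (meson not_le less_imp_le zero_le_divide_1_iff zero_le_numeral zero_le_power)
  qed
  then obtain k where k: "\<And>j. j \<in> D \<Longrightarrow> n0 \<le> k j \<and> 1/2^Suc (k j) < l j \<and> l j \<le> 1/2^(k j)" by metis
  \<comment> \<open>Any common bound for the finitely many scales \<open>k j\<close> can serve as
    the resolution.\<close>
  define N where "N = (\<Sum>j\<in>D. k j)"
  have kN: "k j \<le> N" if "j \<in> D" for j unfolding N_def using D(1) that by (intro member_le_sum) auto
  obtain I :: "(real \<times> real \<times> real) set" and q v where I: "finite I" "\<And>i. i \<in> I \<Longrightarrow> q i \<in> S \<and> 0 \<le> v i" "c \<le> sum v I" "sum v I \<le> 1"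
    "\<And>n. n0 \<le> n \<Longrightarrow> n \<le> N \<Longrightarrow> integral {-T..T} (\<lambda>t. (smear wav I q v n t)^2) \<le> C * 2 powr (\<gamma> * real n)"
    using ex[of N] unfolding scale_weights_def by blast
  define Dn where "Dn = (\<lambda>n. {j\<in>D. k j = n})"
  define In where "In = (\<lambda>n. {i\<in>I. \<exists>j\<in>Dn n. q i \<in> {x j - l j<..<x j + l j}})"
  define L where "L = (\<lambda>n. \<Sum>j\<in>Dn n. l j powr u)"
  have L0: "L n \<ge> 0" for n by (simp add: L_def sum_nonneg)
  have finDn: "finite (Dn n)" for n using D(1) by (simp add: Dn_def)
  have scale: "bump_mass * sum v (In n) \<le> A * L n + C * H / K * r^n" if n: "n0 \<le> n" "n \<le> N" for n
  proof -
    define E where "E = (\<Union>j\<in>Dn n. {x j - 2/2^n..x j + 2/2^n}) \<inter> {-T..T}"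
    have Eb: "E \<in> sets borel" "E \<subseteq> {-T..T}" using finDn by (auto simp: E_def intro!: sets.finite_UN)
    have mE: "measure lborel E \<le> 8 * 2 powr (- (real n * (1 - u))) * L n"
    proof -
      have "measure lborel E \<le> measure lborel (\<Union>j\<in>Dn n. {x j - 2/2^n..x j + 2/2^n})"
        unfolding E_def using finDn
        by (intro measure_mono_fmeasurable fmeasurable.finite_UN) (auto intro!: sets.finite_UN simp: fmeasurable_def emeasure_lborel_Icc_eq)
      also have "\<dots> \<le> (\<Sum>j\<in>Dn n. measure lborel {x j - 2/2^n..x j + 2/2^n})"
        using finDn by (intro measure_UNION_le) auto
      also have "\<dots> \<le> (\<Sum>j\<in>Dn n. 8 * 2 powr (- (real n * (1 - u))) * l j powr u)"
      proof (rule sum_mono)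
        fix j assume "j \<in> Dn n"
        then have "j \<in> D" "k j = n" by (auto simp: Dn_def)
        then have l: "1/2^n \<le> 2 * l j" "0 < l j" using k[of j] D(3) by (auto simp: field_simps)
        have "measure lborel {x j - 2/2^n..x j + 2/2^n} = 4 * (1/2^n)" by simp
        also have "1/2^n = 2 powr (- (real n * (1 - u))) * (1/2^n :: real) powr u"
        proof -
          have e: "(1/2^n :: real) = 2 powr (- real n)" by (simp add: powr_minus powr_realpow divide_inverse)
          show ?thesis unfolding e powr_powr powr_add[symmetric] by (simp add: algebra_simps)
        qed
        also have "(1/2^n) powr u \<le> (2 * l j) powr u" using l u by (intro powr_mono2) auto
        also have "(2 * l j) powr u \<le> 2 * l j powr u"
        proof -
          have "2 powr u \<le> 2 powr 1" using u by (intro powr_mono) auto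
          then show ?thesis using l by (simp add: powr_mult mult_right_mono)
        qed
        finally show "measure lborel {x j - 2/2^n..x j + 2/2^n} \<le> 8 * 2 powr (- (real n * (1 - u))) * l j powr u"
          by (simp add: mult_left_mono)
      qed
      also have "\<dots> = 8 * 2 powr (- (real n * (1 - u))) * L n" by (simp add: L_def sum_distrib_left)
      finally show ?thesis .
    qed
    \<comment> \<open>Midway between the energy growth 2 powr (n (1 - u - 2 \<epsilon>)) and the
      reciprocal 2 powr (n (1 - u)) of the measure factor, so that both parts of
      \<open>mass_bound\<close> gain 2 powr (- n \<epsilon>).\<close>
    define \<kappa> where "\<kappa> = K * 2 powr (real n * (1 - u) - real n * \<epsilon>)"
    have \<kappa>: "\<kappa> > 0" using K by (simp add: \<kappa>_def)
    have "bump_mass * sum v (In n) \<le> 2^n0 * M * measure lborel E +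
      (\<Sum>m\<in>{n0..<n}. \<kappa> * measure lborel E + C * 2 powr (real n * (1 - u - 2 * \<epsilon>)) / \<kappa>)"
    proof (rule mass_bound[where T = T and q = q and I = I])
      show "\<bar>q i\<bar> \<le> T - 1 \<and> 0 \<le> v i" if "i \<in> I" for i
        using I(2)[OF that] c(3) by (auto simp: abs_le_iff)
      show "In n \<subseteq> I" by (auto simp: In_def)
      show "{q i - 1/2^n..q i + 1/2^n} \<inter> {-T..T} \<subseteq> E" if i: "i \<in> In n" for i
      proof
        fix y assume y: "y \<in> {q i - 1/2^n..q i + 1/2^n} \<inter> {-T..T}"
        obtain j where j: "j \<in> Dn n" "q i \<in> {x j - l j<..<x j + l j}" using i by (auto simp: In_def)
        then have "l j \<le> 1/2^n" using k[of j] by (auto simp: Dn_def)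
        moreover have "q i - 1/2^n \<le> y" "y \<le> q i + 1/2^n" "x j - l j < q i" "q i < x j + l j"
          using j(2) y by auto
        moreover have "(2::real)/2^n = 1/2^n + 1/2^n" by simp
        ultimately have "x j - 2/2^n \<le> y" "y \<le> x j + 2/2^n" by linarith+
        then have "y \<in> {x j - 2/2^n..x j + 2/2^n}" by simp
        then show "y \<in> E" using j(1) y by (auto simp: E_def)
      qed
      show "integral {-T..T} (\<lambda>t. (smear wav I q v m t)^2) \<le> C * 2 powr (real n * (1 - u - 2 * \<epsilon>))" if "n0 \<le> m" "m < n" for m
      proof -
        have "\<gamma> * real m \<le> (1 - u - 2 * \<epsilon>) * real m" using \<gamma>' by (intro mult_right_mono) auto
        also have "\<dots> \<le> (1 - u - 2 * \<epsilon>) * real n" using \<gamma>' that by (intro mult_left_mono) auto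
        finally have "2 powr (\<gamma> * real m) \<le> 2 powr (real n * (1 - u - 2 * \<epsilon>))" by (simp add: mult.commute)
        then have "C * 2 powr (\<gamma> * real m) \<le> C * 2 powr (real n * (1 - u - 2 * \<epsilon>))" using c by (intro mult_left_mono) auto
        then show ?thesis using I(5)[of m] that n by linarith
      qed
    qed (use I M n Eb \<kappa> in auto)
    also have "\<dots> = (2^n0 * M + real (n - n0) * \<kappa>) * measure lborel E + real (n - n0) * (C * 2 powr (real n * (1 - u - 2 * \<epsilon>)) / \<kappa>)"
      by (simp add: algebra_simps)
    also have "\<dots> \<le> (2^n0 * M + real n * \<kappa>) * measure lborel E + real n * (C * 2 powr (real n * (1 - u - 2 * \<epsilon>)) / \<kappa>)"
      using \<kappa> c by (intro add_mono mult_right_mono add_left_mono) auto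
    also have "\<dots> \<le> (2^n0 * M + real n * \<kappa>) * (8 * 2 powr (- (real n * (1 - u))) * L n) + real n * (C * 2 powr (real n * (1 - u - 2 * \<epsilon>)) / \<kappa>)"
      using mE \<kappa> M by (intro add_right_mono mult_left_mono) auto
    also have "\<dots> \<le> A * L n + C * H / K * r^n"
    proof (rule add_mono)
      have a: "\<kappa> * 2 powr (- (real n * (1 - u))) = K * 2 powr (- real n * \<epsilon>)"
        by (simp add: \<kappa>_def mult.assoc powr_add[symmetric])
      have "2 powr (- (real n * (1 - u))) \<le> 2 powr 0" using u by (intro powr_mono) auto
      then have 1: "2^n0 * M * 2 powr (- (real n * (1 - u))) \<le> 2^n0 * M * 1" using M by (intro mult_left_mono) auto
      have "real n * 2 powr (- real n * \<epsilon>) \<le> H * r^n" unfolding r_def by (rule H)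
      also have "\<dots> \<le> H * 1" using H r by (intro mult_left_mono power_le_one) auto
      finally have "K * (real n * 2 powr (- real n * \<epsilon>)) \<le> K * (H * 1)" using K by (intro mult_left_mono) auto
      then have 2: "real n * (\<kappa> * 2 powr (- (real n * (1 - u)))) \<le> K * H" unfolding a by (simp add: mult_ac)
      have "(2^n0 * M + real n * \<kappa>) * 2 powr (- (real n * (1 - u))) \<le> 2^n0 * M + K * H"
        using add_mono[OF 1 2] by (simp add: algebra_simps)
      then have "(2^n0 * M + real n * \<kappa>) * 2 powr (- (real n * (1 - u))) * (8 * L n) \<le> (2^n0 * M + K * H) * (8 * L n)"
        using L0 by (intro mult_right_mono) auto
      then show "(2^n0 * M + real n * \<kappa>) * (8 * 2 powr (- (real n * (1 - u))) * L n) \<le> A * L n"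
        by (simp add: A_def mult_ac)
      have ratio: "2 powr (real n * (1 - u - 2 * \<epsilon>)) / \<kappa> = 2 powr (- real n * \<epsilon>) / K"
      proof -
        have "2 powr (real n * (1 - u - 2 * \<epsilon>)) = 2 powr (- real n * \<epsilon>) * 2 powr (real n * (1 - u) - real n * \<epsilon>)"
          unfolding powr_add[symmetric] by (simp add: algebra_simps)
        then show ?thesis using K by (simp add: \<kappa>_def)
      qed
      have "real n * (C * 2 powr (real n * (1 - u - 2 * \<epsilon>)) / \<kappa>) = C * real n * (2 powr (real n * (1 - u - 2 * \<epsilon>)) / \<kappa>)"
        by simp
      also have "\<dots> = C / K * (real n * 2 powr (- real n * \<epsilon>))" unfolding ratio by simp
      also have "\<dots> \<le> C / K * (H * r^n)" unfolding r_def using c K by (intro mult_left_mono H) auto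
      finally show "real n * (C * 2 powr (real n * (1 - u - 2 * \<epsilon>)) / \<kappa>) \<le> C * H / K * r^n" by simp
    qed
    finally show ?thesis .
  qed
  have "I \<subseteq> (\<Union>n\<in>{n0..N}. In n)"
  proof
    fix i assume i: "i \<in> I"
    then obtain j where j: "j \<in> D" "q i \<in> {x j - l j<..<x j + l j}" using I(2) D(2) by blast
    then have "i \<in> In (k j)" using i by (auto simp: In_def Dn_def)
    moreover have "k j \<in> {n0..N}" using k kN j by auto
    ultimately show "i \<in> (\<Union>n\<in>{n0..N}. In n)" by blast
  qed
  moreover have "(\<Union>n\<in>{n0..N}. In n) \<subseteq> I" by (auto simp: In_def)
  ultimately have Ieq: "I = (\<Union>n\<in>{n0..N}. In n)" by blast
  have "sum v I \<le> (\<Sum>n\<in>{n0..N}. sum v (In n))"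
  proof -
    have "sum v (\<Union>n\<in>X. In n) \<le> (\<Sum>n\<in>X. sum v (In n))" if "finite X" for X
      using that
    proof (induction X rule: finite_induct)
      case (insert n X)
      have f: "finite (In n)" "finite (\<Union>n\<in>X. In n)" using I(1) insert(1) by (auto simp: In_def)
      have "sum v (In n \<union> (\<Union>n\<in>X. In n)) = sum v (In n) + sum v (\<Union>n\<in>X. In n) - sum v (In n \<inter> (\<Union>n\<in>X. In n))"
        using f by (simp add: sum_Un)
      also have "\<dots> \<le> sum v (In n) + sum v (\<Union>n\<in>X. In n)"
      proof -
        have "0 \<le> sum v (In n \<inter> (\<Union>n\<in>X. In n))" by (rule sum_nonneg) (use I(2) in \<open>auto simp: In_def\<close>)
        then show ?thesis by simp
      qed
      finally show ?case using insert by simp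
    qed simp
    then show ?thesis by (subst Ieq) simp
  qed
  then have "bump_mass * sum v I \<le> (\<Sum>n\<in>{n0..N}. bump_mass * sum v (In n))"
    using bump_mass_pos by (simp flip: sum_distrib_left)
  also have "\<dots> \<le> (\<Sum>n\<in>{n0..N}. A * L n + C * H / K * r^n)" by (intro sum_mono scale) auto
  also have "\<dots> = A * (\<Sum>n\<in>{n0..N}. L n) + C * H / K * (\<Sum>n\<in>{n0..N}. r^n)"
    by (simp add: sum.distrib sum_distrib_left)
  also have "\<dots> \<le> A * e + C * H / K * G"
  proof (intro add_mono mult_left_mono)
    have "(\<Sum>n\<in>{n0..N}. L n) = (\<Sum>j\<in>D. l j powr u)"
      unfolding L_def Dn_def
      by (rule sum.group) (use D k kN in auto)
    then show "(\<Sum>n\<in>{n0..N}. L n) \<le> e" using D(4) by simp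
    show "(\<Sum>n\<in>{n0..N}. r^n) \<le> G" unfolding G_def using r by (intro sum_power_le) auto
  qed (use A c H K in auto)
  also have "\<dots> \<le> b / 3 + b / 3" using e(2) K(2) by (intro add_mono) auto
  finally have "bump_mass * sum v I \<le> 2 * b / 3" by simp
  moreover have "b \<le> bump_mass * sum v I" unfolding b_def using I(3) bump_mass_pos by simp
  ultimately show False using b by linarith
qed

section \<open>Calculus of smooth functions\<close>

lemma smooth_on_partial: "smooth_on S f \<Longrightarrow> smooth_on S (partial i f)"
  unfolding smooth_on_def using Ck_on.simps(2) by blast

lemma smooth_on_differentiable: "smooth_on S f \<Longrightarrow> x \<in> S \<Longrightarrow> f differentiable (at x)"
  unfolding smooth_on_def by (metis Ck_on.simps(2))

lemma smooth_on_continuous: "smooth_on S f \<Longrightarrow> continuous_on S f"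
  unfolding smooth_on_def by (metis Ck_on.simps(1))

text \<open>\<open>partial\<close> is a \<open>deriv\<close>, hence informative only where that
  derivative exists. Total differentiability supplies it, and its value at every point of the line
  is the differential applied to the axis vector.\<close>

lemma DERIV_along_axis:
  fixes f :: "real ^ 'n::finite \<Rightarrow> real"
  assumes "f differentiable (at (x + t *\<^sub>R axis i 1))"
  shows "((\<lambda>t. f (x + t *\<^sub>R axis i 1)) has_real_derivative partial i f (x + t *\<^sub>R axis i 1)) (at t)"
proof -
  obtain f' where f': "(f has_derivative f') (at (x + t *\<^sub>R axis i 1))"
    using assms by (auto simp: differentiable_def)
  interpret f': bounded_linear f' using f' by (rule has_derivative_bounded_linear)
  have *: "((\<lambda>s. f (y + s *\<^sub>R axis i 1)) has_real_derivative f' (axis i 1)) (at r)"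
    if "y + r *\<^sub>R axis i 1 = x + t *\<^sub>R axis i 1" for y r
  proof -
    have "((\<lambda>s. y + s *\<^sub>R axis i 1) has_derivative (\<lambda>s. s *\<^sub>R axis i 1)) (at r)"
      by (auto intro!: derivative_eq_intros)
    from has_derivative_compose[OF this, of f f'] f' that
    have "((\<lambda>s. f (y + s *\<^sub>R axis i 1)) has_derivative (\<lambda>s. f' (s *\<^sub>R axis i 1))) (at r)" by simp
    then show ?thesis by (simp add: has_field_derivative_def f'.scaleR mult_commute_abs)
  qed
  have "partial i f (x + t *\<^sub>R axis i 1) = f' (axis i 1)"
    unfolding partial_def by (rule DERIV_imp_deriv, rule *) simp
  then show ?thesis using *[of x t] by simp
qed

lemma MVT_interval:
  fixes f f' :: "real \<Rightarrow> real"
  assumes "\<And>t. min u v \<le> t \<Longrightarrow> t \<le> max u v \<Longrightarrow> (f has_real_derivative f' t) (at t)"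
  shows "\<exists>t. min u v \<le> t \<and> t \<le> max u v \<and> f u - f v = f' t * (u - v)"
proof (cases u v rule: linorder_cases)
  case less
  then obtain z where "u < z" "z < v" "f v - f u = (v - u) * f' z" using MVT2[OF less, of f f'] assms by auto
  then show ?thesis by (intro exI[of _ z]) (auto simp: algebra_simps)
next
  case equal then show ?thesis by (intro exI[of _ u]) auto
next
  case greater
  then obtain z where "v < z" "z < u" "f u - f v = (u - v) * f' z" using MVT2[OF greater, of f f'] assms by auto
  then show ?thesis by (intro exI[of _ z]) (auto simp: algebra_simps)
qed

section \<open>Symmetry of mixed second derivatives\<close>

lemma second_difference:
  fixes f :: "real ^ 'n::finite \<Rightarrow> real"
  assumes f: "smooth_on S f" and d: "d \<ge> 0"
    and sub: "\<And>s t. 0 \<le> s \<Longrightarrow> s \<le> d \<Longrightarrow> 0 \<le> t \<Longrightarrow> t \<le> d \<Longrightarrow> x + s *\<^sub>R axis i 1 + t *\<^sub>R axis j 1 \<in> S"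
  shows "\<exists>s t. 0 \<le> s \<and> s \<le> d \<and> 0 \<le> t \<and> t \<le> d \<and>
    f (x + d *\<^sub>R axis i 1 + d *\<^sub>R axis j 1) - f (x + d *\<^sub>R axis i 1) - f (x + d *\<^sub>R axis j 1) + f x
      = partial j (partial i f) (x + s *\<^sub>R axis i 1 + t *\<^sub>R axis j 1) * d^2"
proof -
  have sub': "x + t *\<^sub>R axis j 1 + s *\<^sub>R axis i 1 \<in> S" if "0 \<le> s" "s \<le> d" "0 \<le> t" "t \<le> d" for s t
    using sub[OF that] by (simp add: add_ac)
  have "\<exists>s. min d 0 \<le> s \<and> s \<le> max d 0 \<and>
     (f (x + d *\<^sub>R axis j 1 + d *\<^sub>R axis i 1) - f (x + 0 *\<^sub>R axis j 1 + d *\<^sub>R axis i 1))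
     - (f (x + d *\<^sub>R axis j 1 + 0 *\<^sub>R axis i 1) - f (x + 0 *\<^sub>R axis j 1 + 0 *\<^sub>R axis i 1))
     = (partial i f (x + d *\<^sub>R axis j 1 + s *\<^sub>R axis i 1) - partial i f (x + 0 *\<^sub>R axis j 1 + s *\<^sub>R axis i 1)) * (d - 0)"
    by (rule MVT_interval[where f = "\<lambda>s. f (x + d *\<^sub>R axis j 1 + s *\<^sub>R axis i 1) - f (x + 0 *\<^sub>R axis j 1 + s *\<^sub>R axis i 1)"])
      (intro DERIV_diff DERIV_along_axis smooth_on_differentiable[OF f] sub'; use d in simp)
  then obtain s where s: "0 \<le> s" "s \<le> d" and
    eq1: "f (x + d *\<^sub>R axis j 1 + d *\<^sub>R axis i 1) - f (x + d *\<^sub>R axis i 1) - f (x + d *\<^sub>R axis j 1) + f x =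
      (partial i f (x + d *\<^sub>R axis j 1 + s *\<^sub>R axis i 1) - partial i f (x + s *\<^sub>R axis i 1)) * d"
    using d by (auto simp: algebra_simps)
  have "\<exists>t. min d 0 \<le> t \<and> t \<le> max d 0 \<and>
     partial i f (x + s *\<^sub>R axis i 1 + d *\<^sub>R axis j 1) - partial i f (x + s *\<^sub>R axis i 1 + 0 *\<^sub>R axis j 1)
     = partial j (partial i f) (x + s *\<^sub>R axis i 1 + t *\<^sub>R axis j 1) * (d - 0)"
    by (rule MVT_interval[where f = "\<lambda>t. partial i f (x + s *\<^sub>R axis i 1 + t *\<^sub>R axis j 1)"])
      (intro DERIV_along_axis smooth_on_differentiable[OF smooth_on_partial[OF f]] sub; use d s in simp)
  then obtain t where t: "0 \<le> t" "t \<le> d" and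
    eq2: "partial i f (x + s *\<^sub>R axis i 1 + d *\<^sub>R axis j 1) - partial i f (x + s *\<^sub>R axis i 1)
     = partial j (partial i f) (x + s *\<^sub>R axis i 1 + t *\<^sub>R axis j 1) * d"
    using d by auto
  show ?thesis
  proof (intro exI conjI)
    have c: "x + d *\<^sub>R axis j 1 + s *\<^sub>R axis i 1 = x + s *\<^sub>R axis i 1 + d *\<^sub>R axis j 1"
      "x + d *\<^sub>R axis i 1 + d *\<^sub>R axis j 1 = x + d *\<^sub>R axis j 1 + d *\<^sub>R axis i 1"
      by (simp_all add: add_ac)
    show "f (x + d *\<^sub>R axis i 1 + d *\<^sub>R axis j 1) - f (x + d *\<^sub>R axis i 1) - f (x + d *\<^sub>R axis j 1) + f x
      = partial j (partial i f) (x + s *\<^sub>R axis i 1 + t *\<^sub>R axis j 1) * d^2"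
      unfolding c(2) eq1 unfolding c(1) eq2 by (simp add: power2_eq_square)
  qed (fact s t)+
qed

text \<open>The second difference over a small square is d^2 times the mixed derivative, in either
  order, at some point of the square; continuity forces equality at the corner. \<open>Ck_on\<close>
  does not identify the two orders, while the determinants below always have the parameter
  derivative innermost.\<close>

lemma partial_commute:
  fixes f :: "real ^ 'n::finite \<Rightarrow> real"
  assumes S: "open S" and f: "smooth_on S f" and x: "x \<in> S"
  shows "partial i (partial j f) x = partial j (partial i f) x"
proof (rule ccontr)
  assume ne: "\<not> ?thesis"
  define e where "e = \<bar>partial i (partial j f) x - partial j (partial i f) x\<bar> / 2"
  have e: "e > 0" using ne by (simp add: e_def)
  have c: "isCont (partial i (partial j f)) x" "isCont (partial j (partial i f)) x"
    using smooth_on_continuous[OF smooth_on_partial[OF smooth_on_partial[OF f]]] S x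
    by (simp_all add: continuous_on_eq_continuous_at)
  obtain r1 where r1: "r1 > 0" "\<And>y. dist y x < r1 \<Longrightarrow> \<bar>partial i (partial j f) y - partial i (partial j f) x\<bar> < e"
    using c(1) e unfolding continuous_at_eps_delta dist_real_def by blast
  obtain r2 where r2: "r2 > 0" "\<And>y. dist y x < r2 \<Longrightarrow> \<bar>partial j (partial i f) y - partial j (partial i f) x\<bar> < e"
    using c(2) e unfolding continuous_at_eps_delta dist_real_def by blast
  obtain r3 where r3: "r3 > 0" "ball x r3 \<subseteq> S" using S x openE by blast
  define r where "r = Min {r1, r2, r3}"
  \<comment> \<open>Two steps of length at most d stay strictly inside the ball of radius r.\<close>
  define d where "d = r / 3"
  have r: "r > 0" "r \<le> r1" "r \<le> r2" "r \<le> r3" using r1 r2 r3 by (auto simp: r_def)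
  have d: "d > 0" using r by (simp add: d_def)
  have near: "dist (x + s *\<^sub>R axis k 1 + t *\<^sub>R axis l 1) x < r" if "0 \<le> s" "s \<le> d" "0 \<le> t" "t \<le> d" for s t and k l :: 'n
  proof -
    have "dist (x + s *\<^sub>R axis k 1 + t *\<^sub>R axis l 1) x = norm (s *\<^sub>R axis k 1 + t *\<^sub>R axis l (1::real))"
      by (simp add: dist_norm add.assoc)
    also have "\<dots> \<le> norm (s *\<^sub>R axis k (1::real)) + norm (t *\<^sub>R axis l (1::real))" by (rule norm_triangle_ineq)
    also have "\<dots> = s + t" using that by simp
    also have "\<dots> < r" using that r(1) unfolding d_def by linarith
    finally show ?thesis .
  qed
  have inS: "x + s *\<^sub>R axis k 1 + t *\<^sub>R axis l 1 \<in> S" if "0 \<le> s" "s \<le> d" "0 \<le> t" "t \<le> d" for s t and k l :: 'n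
    using near[OF that, of k l] r r3 by (auto simp: subset_iff dist_commute)
  obtain s t where st: "0 \<le> s" "s \<le> d" "0 \<le> t" "t \<le> d"
    "f (x + d *\<^sub>R axis i 1 + d *\<^sub>R axis j 1) - f (x + d *\<^sub>R axis i 1) - f (x + d *\<^sub>R axis j 1) + f x
      = partial j (partial i f) (x + s *\<^sub>R axis i 1 + t *\<^sub>R axis j 1) * d^2"
    using second_difference[OF f less_imp_le[OF d] inS] by blast
  obtain s' t' where st': "0 \<le> s'" "s' \<le> d" "0 \<le> t'" "t' \<le> d"
    "f (x + d *\<^sub>R axis j 1 + d *\<^sub>R axis i 1) - f (x + d *\<^sub>R axis j 1) - f (x + d *\<^sub>R axis i 1) + f x
      = partial i (partial j f) (x + s' *\<^sub>R axis j 1 + t' *\<^sub>R axis i 1) * d^2"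
    using second_difference[OF f less_imp_le[OF d] inS] by blast
  have comm: "x + d *\<^sub>R axis j 1 + d *\<^sub>R axis i 1 = x + d *\<^sub>R axis i 1 + d *\<^sub>R axis j 1" by (simp add: add_ac)
  have "partial j (partial i f) (x + s *\<^sub>R axis i 1 + t *\<^sub>R axis j 1) * d^2 =
      partial i (partial j f) (x + s' *\<^sub>R axis j 1 + t' *\<^sub>R axis i 1) * d^2"
    using st(5) st'(5) unfolding comm by linarith
  then have "partial j (partial i f) (x + s *\<^sub>R axis i 1 + t *\<^sub>R axis j 1) =
      partial i (partial j f) (x + s' *\<^sub>R axis j 1 + t' *\<^sub>R axis i 1)"
    using d by simp
  moreover have "\<bar>partial j (partial i f) (x + s *\<^sub>R axis i 1 + t *\<^sub>R axis j 1) - partial j (partial i f) x\<bar> < e"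
    using near[OF st(1-4), of i j] r by (intro r2) simp
  moreover have "\<bar>partial i (partial j f) (x + s' *\<^sub>R axis j 1 + t' *\<^sub>R axis i 1) - partial i (partial j f) x\<bar> < e"
    using near[OF st'(1-4), of j i] r by (intro r1) simp
  moreover have False if "A = B" "\<bar>A - u\<bar> < \<bar>w - u\<bar> / 2" "\<bar>B - w\<bar> < \<bar>w - u\<bar> / 2" for A B u w :: real
    using that by (simp add: abs_if split: if_splits)
  ultimately show False unfolding e_def by blast
qed

text \<open>The parameter goes to coordinate \<open>i\<close>, the plane point to \<open>j\<close>
  and the remaining coordinate, so that each of the three coordinates can serve as the
  parameter.\<close>

definition emb :: "3 \<Rightarrow> 3 \<Rightarrow> real \<Rightarrow> real \<times> real \<Rightarrow> real ^ 3" where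
  "emb i j l x = (\<chi> m. if m = i then l else if m = j then fst x else snd x)"

context
  fixes i j k :: 3
  assumes ijk: "i \<noteq> j" "i \<noteq> k" "j \<noteq> k" "UNIV = {i, j, k}"
begin

lemma emb_nth: "emb i j l x $ i = l" "emb i j l x $ j = fst x" "emb i j l x $ k = snd x"
  using ijk by (auto simp: emb_def)

lemma vec3_eq_iff: "y = z \<longleftrightarrow> y $ i = z $ i \<and> y $ j = z $ j \<and> y $ k = z $ k" for y z :: "real ^ 3"
proof -
  have "(\<forall>m. y $ m = z $ m) \<longleftrightarrow> (\<forall>m\<in>{i,j,k}. y $ m = z $ m)" using ijk(4) by (metis UNIV_I)
  then show ?thesis by (simp add: vec_eq_iff)
qed

lemma emb_shift:
  "emb i j l x = emb i j 0 x + l *\<^sub>R axis i 1"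
  "emb i j l (p, q) = emb i j l (0, q) + p *\<^sub>R axis j 1"
  "emb i j l (p, q) = emb i j l (p, 0) + q *\<^sub>R axis k 1"
  using ijk by (simp_all add: vec3_eq_iff axis_def emb_nth)

lemma DERIV_emb:
  assumes "g differentiable (at (emb i j l (p, q)))"
  shows "((\<lambda>l. g (emb i j l (p, q))) has_real_derivative partial i g (emb i j l (p, q))) (at l)"
    and "((\<lambda>p. g (emb i j l (p, q))) has_real_derivative partial j g (emb i j l (p, q))) (at p)"
    and "((\<lambda>q. g (emb i j l (p, q))) has_real_derivative partial k g (emb i j l (p, q))) (at q)"
proof -
  show "((\<lambda>l. g (emb i j l (p, q))) has_real_derivative partial i g (emb i j l (p, q))) (at l)"
    using DERIV_along_axis[of g "emb i j 0 (p, q)" l i] assms by (simp flip: emb_shift(1))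
  show "((\<lambda>p. g (emb i j l (p, q))) has_real_derivative partial j g (emb i j l (p, q))) (at p)"
    using DERIV_along_axis[of g "emb i j l (0, q)" p j] assms by (simp flip: emb_shift(2))
  show "((\<lambda>q. g (emb i j l (p, q))) has_real_derivative partial k g (emb i j l (p, q))) (at q)"
    using DERIV_along_axis[of g "emb i j l (p, 0)" q k] assms by (simp flip: emb_shift(3))
qed

text \<open>Moving one coordinate at a time produces two intermediate points, in general different.
  This is why \<open>linear_map_lower_bound\<close> perturbs its four entries independently.\<close>

lemma mean_value_emb:
  assumes g: "smooth_on \<Omega> g" and box: "\<And>x. x \<in> X \<times> Y \<Longrightarrow> emb i j l x \<in> \<Omega>"
    and XY: "X = {p0..p1}" "Y = {q0..q1}" and x: "x \<in> X \<times> Y" and y: "y \<in> X \<times> Y"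
  shows "\<exists>\<xi>\<in>X \<times> Y. \<exists>\<zeta>\<in>X \<times> Y. g (emb i j l x) - g (emb i j l y) =
    partial j g (emb i j l \<xi>) * (fst x - fst y) + partial k g (emb i j l \<zeta>) * (snd x - snd y)"
proof -
  obtain p q where xpq: "x = (p, q)" by force
  obtain p' q' where ypq: "y = (p', q')" by force
  have in1: "min p p' \<le> t \<Longrightarrow> t \<le> max p p' \<Longrightarrow> (t, q) \<in> X \<times> Y" for t
    using x y by (auto simp: XY xpq ypq)
  have in2: "min q q' \<le> t \<Longrightarrow> t \<le> max q q' \<Longrightarrow> (p', t) \<in> X \<times> Y" for t
    using x y by (auto simp: XY xpq ypq)
  have "\<exists>t. min p p' \<le> t \<and> t \<le> max p p' \<and>
    g (emb i j l (p, q)) - g (emb i j l (p', q)) = partial j g (emb i j l (t, q)) * (p - p')"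
    by (rule MVT_interval) (intro DERIV_emb smooth_on_differentiable[OF g] box in1; simp)
  then obtain t where t: "(t, q) \<in> X \<times> Y"
    "g (emb i j l (p, q)) - g (emb i j l (p', q)) = partial j g (emb i j l (t, q)) * (p - p')" using in1 by blast
  have "\<exists>t. min q q' \<le> t \<and> t \<le> max q q' \<and>
    g (emb i j l (p', q)) - g (emb i j l (p', q')) = partial k g (emb i j l (p', t)) * (q - q')"
    by (rule MVT_interval) (intro DERIV_emb smooth_on_differentiable[OF g] box in2; simp)
  then obtain t' where t': "(p', t') \<in> X \<times> Y"
    "g (emb i j l (p', q)) - g (emb i j l (p', q')) = partial k g (emb i j l (p', t')) * (q - q')" using in2 by blast
  show ?thesis using t t' by (intro bexI[of _ "(t, q)"] bexI[of _ "(p', t')"]) (auto simp: xpq ypq)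
qed

end

section \<open>From nonvanishing determinants to transversality\<close>

lemma compact_vec_box:
  fixes K :: "'n::finite \<Rightarrow> real set"
  assumes "\<And>m. compact (K m)"
  shows "compact {x :: real ^ 'n. \<forall>m. x $ m \<in> K m}"
proof -
  have "closed {x :: real ^ 'n. \<forall>m. x $ m \<in> K m}"
  proof -
    have "closed ((\<lambda>x :: real ^ 'n. x $ m) -` K m)" for m
      by (intro continuous_closed_vimage compact_imp_closed assms continuous_intros)
    then have "closed (\<Inter>m. (\<lambda>x :: real ^ 'n. x $ m) -` K m)" by blast
    moreover have "(\<Inter>m. (\<lambda>x :: real ^ 'n. x $ m) -` K m) = {x. \<forall>m. x $ m \<in> K m}" by auto
    ultimately show ?thesis by simp
  qed
  moreover have "bounded {x :: real ^ 'n. \<forall>m. x $ m \<in> K m}"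
  proof -
    have "\<exists>b. \<forall>y\<in>K m. \<bar>y\<bar> \<le> b" for m
      using compact_imp_bounded[OF assms[of m]] by (auto simp: bounded_iff)
    then obtain b where b: "\<And>m y. y \<in> K m \<Longrightarrow> \<bar>y\<bar> \<le> b m" by metis
    show ?thesis unfolding bounded_iff
    proof (intro exI ballI)
      fix x :: "real ^ 'n" assume x: "x \<in> {x. \<forall>m. x $ m \<in> K m}"
      have "norm x \<le> (\<Sum>m\<in>UNIV. \<bar>x $ m\<bar>)" by (rule norm_le_l1_cart)
      also have "\<dots> \<le> (\<Sum>m\<in>UNIV. b m)" using x b by (intro sum_mono) auto
      finally show "norm x \<le> (\<Sum>m\<in>UNIV. b m)" .
    qed
  qed
  ultimately show ?thesis by (simp add: compact_eq_bounded_closed)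
qed

text \<open>Cramer's rule: the determinant times u or v is a combination of the two components with
  coefficients at most m. Perturbing the entries adds an error of at most 4 m \<epsilon> r, which
  the choice \<epsilon> = D/(8 m) turns into D r/2.\<close>

lemma linear_map_lower_bound:
  fixes \<alpha> \<beta> \<gamma> \<delta> :: real
  assumes det: "\<alpha> * \<delta> - \<beta> * \<gamma> \<noteq> 0"
  shows "\<exists>\<epsilon>>0. \<exists>c>0. \<forall>a1 a2 a3 a4 u v. \<bar>a1 - \<alpha>\<bar> \<le> \<epsilon> \<longrightarrow> \<bar>a2 - \<beta>\<bar> \<le> \<epsilon> \<longrightarrow> \<bar>a3 - \<gamma>\<bar> \<le> \<epsilon> \<longrightarrow> \<bar>a4 - \<delta>\<bar> \<le> \<epsilon> \<longrightarrow>
    c * max \<bar>u\<bar> \<bar>v\<bar> \<le> \<bar>a1 * u + a2 * v\<bar> + \<bar>a3 * u + a4 * v\<bar>"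
proof -
  define D where "D = \<bar>\<alpha> * \<delta> - \<beta> * \<gamma>\<bar>"
  define m where "m = \<bar>\<alpha>\<bar> + \<bar>\<beta>\<bar> + \<bar>\<gamma>\<bar> + \<bar>\<delta>\<bar> + 1"
  define \<epsilon> where "\<epsilon> = D / (8 * m)"
  have D: "D > 0" using det by (simp add: D_def)
  have m: "m > 0" "\<bar>\<alpha>\<bar> \<le> m" "\<bar>\<beta>\<bar> \<le> m" "\<bar>\<gamma>\<bar> \<le> m" "\<bar>\<delta>\<bar> \<le> m" by (auto simp: m_def)
  have \<epsilon>: "\<epsilon> > 0" using D m by (simp add: \<epsilon>_def)
  have "D / (2 * m) * max \<bar>u\<bar> \<bar>v\<bar> \<le> \<bar>a1 * u + a2 * v\<bar> + \<bar>a3 * u + a4 * v\<bar>"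
    if h: "\<bar>a1 - \<alpha>\<bar> \<le> \<epsilon>" "\<bar>a2 - \<beta>\<bar> \<le> \<epsilon>" "\<bar>a3 - \<gamma>\<bar> \<le> \<epsilon>" "\<bar>a4 - \<delta>\<bar> \<le> \<epsilon>" for a1 a2 a3 a4 u v
  proof -
    define r where "r = max \<bar>u\<bar> \<bar>v\<bar>"
    define X where "X = a1 * u + a2 * v"
    define Y where "Y = a3 * u + a4 * v"
    define e1 where "e1 = (a1 - \<alpha>) * u + (a2 - \<beta>) * v"
    define e2 where "e2 = (a3 - \<gamma>) * u + (a4 - \<delta>) * v"
    have r: "\<bar>u\<bar> \<le> r" "\<bar>v\<bar> \<le> r" "r \<ge> 0" by (auto simp: r_def)
    have e: "\<bar>e1\<bar> \<le> 2 * \<epsilon> * r" "\<bar>e2\<bar> \<le> 2 * \<epsilon> * r"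
    proof -
      have *: "\<bar>x * u + y * v\<bar> \<le> 2 * \<epsilon> * r" if "\<bar>x\<bar> \<le> \<epsilon>" "\<bar>y\<bar> \<le> \<epsilon>" for x y
      proof -
        have "\<bar>x * u + y * v\<bar> \<le> \<bar>x\<bar> * \<bar>u\<bar> + \<bar>y\<bar> * \<bar>v\<bar>" using abs_triangle_ineq[of "x * u" "y * v"] by (simp add: abs_mult)
        also have "\<dots> \<le> \<epsilon> * r + \<epsilon> * r" using that r \<epsilon> by (intro add_mono mult_mono) auto
        finally show ?thesis by simp
      qed
      show "\<bar>e1\<bar> \<le> 2 * \<epsilon> * r" "\<bar>e2\<bar> \<le> 2 * \<epsilon> * r" unfolding e1_def e2_def using * h by auto
    qed
    have bd: "\<bar>x * (X - e1) - y * (Y - e2)\<bar> \<le> m * (\<bar>X\<bar> + \<bar>Y\<bar>) + 4 * m * \<epsilon> * r" if "\<bar>x\<bar> \<le> m" "\<bar>y\<bar> \<le> m" for x y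
    proof -
      have "\<bar>x * (X - e1) - y * (Y - e2)\<bar> \<le> \<bar>x\<bar> * \<bar>X - e1\<bar> + \<bar>y\<bar> * \<bar>Y - e2\<bar>"
        using abs_triangle_ineq4[of "x * (X - e1)" "y * (Y - e2)"] by (simp add: abs_mult)
      also have "\<dots> \<le> m * (\<bar>X\<bar> + 2 * \<epsilon> * r) + m * (\<bar>Y\<bar> + 2 * \<epsilon> * r)"
      proof (intro add_mono mult_mono)
        show "\<bar>X - e1\<bar> \<le> \<bar>X\<bar> + 2 * \<epsilon> * r" "\<bar>Y - e2\<bar> \<le> \<bar>Y\<bar> + 2 * \<epsilon> * r" using e by linarith+
      qed (use that m in auto)
      finally show ?thesis by (simp add: algebra_simps)
    qed
    have "\<bar>(\<alpha> * \<delta> - \<beta> * \<gamma>) * u\<bar> \<le> m * (\<bar>X\<bar> + \<bar>Y\<bar>) + 4 * m * \<epsilon> * r"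
    proof -
      have "(\<alpha> * \<delta> - \<beta> * \<gamma>) * u = \<delta> * (X - e1) - \<beta> * (Y - e2)" by (simp add: X_def Y_def e1_def e2_def algebra_simps)
      then show ?thesis using bd[OF m(5) m(3)] by simp
    qed
    moreover have "\<bar>(\<alpha> * \<delta> - \<beta> * \<gamma>) * v\<bar> \<le> m * (\<bar>X\<bar> + \<bar>Y\<bar>) + 4 * m * \<epsilon> * r"
    proof -
      have "(\<alpha> * \<delta> - \<beta> * \<gamma>) * v = - (\<gamma> * (X - e1) - \<alpha> * (Y - e2))" by (simp add: X_def Y_def e1_def e2_def algebra_simps)
      then show ?thesis using bd[OF m(4) m(2)] by simp
    qed
    ultimately have "D * r \<le> m * (\<bar>X\<bar> + \<bar>Y\<bar>) + 4 * m * \<epsilon> * r"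
      unfolding D_def r_def abs_mult by (auto simp: max_def)
    moreover have "4 * m * \<epsilon> * r = D * r / 2" using m by (simp add: \<epsilon>_def)
    ultimately have "D * r / 2 \<le> m * (\<bar>X\<bar> + \<bar>Y\<bar>)" by linarith
    then have "D / (2 * m) * r \<le> \<bar>X\<bar> + \<bar>Y\<bar>" using m by (simp add: field_simps)
    then show ?thesis by (simp add: r_def X_def Y_def)
  qed
  moreover have "D / (2 * m) > 0" using D m by simp
  ultimately show ?thesis using \<epsilon> by blast
qed

context
  fixes i j k :: 3
  assumes ijk: "i \<noteq> j" "i \<noteq> k" "j \<noteq> k" "UNIV = {i, j, k}"
begin

text \<open>Continuity keeps the four entries within the tolerance of
  \<open>linear_map_lower_bound\<close> on a box of radius \<eta>, and compactness of that box
  bounds the derivatives by \<open>M\<close>. Only then can \<rho> be shrunk to satisfy 4 M \<rho>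
  <= c; the bounds on the larger box remain valid.\<close>

lemma exists_transversal_family:
  fixes f :: "real ^ 3 \<Rightarrow> real" and a :: "real ^ 3"
  assumes \<Omega>: "open \<Omega>" "a \<in> \<Omega>" and f: "smooth_on \<Omega> f"
    and det: "partial j f a * partial k (partial i f) a - partial k f a * partial j (partial i f) a \<noteq> 0"
  shows "\<exists>\<rho> M c. \<rho> > 0 \<and> {x. \<forall>m. x $ m \<in> {a $ m - \<rho>..a $ m + \<rho>}} \<subseteq> \<Omega> \<and>
    transversal_family (\<lambda>l x. f (emb i j l x)) (\<lambda>l x. partial i f (emb i j l x)) (\<lambda>l x. partial i (partial i f) (emb i j l x))
      ({a $ j - \<rho>..a $ j + \<rho>} \<times> {a $ k - \<rho>..a $ k + \<rho>}) (a $ i) \<rho> M c"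
proof -
  note emb_nth [OF ijk, simp]
  obtain \<epsilon> c where \<epsilon>: "\<epsilon> > 0" and c: "c > 0" and lower0: "\<forall>a1 a2 a3 a4 u v. \<bar>a1 - partial j f a\<bar> \<le> \<epsilon> \<longrightarrow>
      \<bar>a2 - partial k f a\<bar> \<le> \<epsilon> \<longrightarrow> \<bar>a3 - partial j (partial i f) a\<bar> \<le> \<epsilon> \<longrightarrow> \<bar>a4 - partial k (partial i f) a\<bar> \<le> \<epsilon> \<longrightarrow>
      c * max \<bar>u\<bar> \<bar>v\<bar> \<le> \<bar>a1 * u + a2 * v\<bar> + \<bar>a3 * u + a4 * v\<bar>"
    using linear_map_lower_bound[OF det] by (elim exE conjE)
  note lower = lower0[rule_format]
  define Q where "Q = (\<lambda>\<eta>. {x :: real ^ 3. \<forall>m. x $ m \<in> {a $ m - \<eta>..a $ m + \<eta>}})"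
  have Q_ball: "Q \<eta> \<subseteq> ball a r" if "4 * \<eta> \<le> r" "0 < \<eta>" for \<eta> r
  proof
    fix x assume x: "x \<in> Q \<eta>"
    have "norm (x - a) \<le> (\<Sum>m\<in>UNIV. \<bar>(x - a) $ m\<bar>)" by (rule norm_le_l1_cart)
    also have "\<dots> \<le> (\<Sum>m\<in>(UNIV :: 3 set). \<eta>)"
    proof (rule sum_mono)
      fix m :: 3
      have "x $ m \<in> {a $ m - \<eta>..a $ m + \<eta>}" using x by (simp add: Q_def)
      then show "\<bar>(x - a) $ m\<bar> \<le> \<eta>" by (auto simp: abs_le_iff)
    qed
    also have "\<dots> = 3 * \<eta>" by simp
    finally show "x \<in> ball a r" using that by (simp add: dist_norm norm_minus_commute)
  qed
  have near: "\<exists>r>0. \<forall>x. dist x a < r \<longrightarrow> \<bar>g x - g a\<bar> \<le> \<epsilon>" if "smooth_on \<Omega> g" for g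
  proof -
    have "isCont g a" using smooth_on_continuous[OF that] \<Omega> by (simp add: continuous_on_eq_continuous_at)
    then show ?thesis using \<epsilon> unfolding continuous_at_eps_delta dist_real_def by (meson less_imp_le)
  qed
  obtain r1 where r1: "r1 > 0" "\<And>x. dist x a < r1 \<Longrightarrow> \<bar>partial j f x - partial j f a\<bar> \<le> \<epsilon>"
    using near[OF smooth_on_partial[OF f]] by blast
  obtain r2 where r2: "r2 > 0" "\<And>x. dist x a < r2 \<Longrightarrow> \<bar>partial k f x - partial k f a\<bar> \<le> \<epsilon>"
    using near[OF smooth_on_partial[OF f]] by blast
  obtain r3 where r3: "r3 > 0" "\<And>x. dist x a < r3 \<Longrightarrow> \<bar>partial j (partial i f) x - partial j (partial i f) a\<bar> \<le> \<epsilon>"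
    using near[OF smooth_on_partial[OF smooth_on_partial[OF f]]] by blast
  obtain r4 where r4: "r4 > 0" "\<And>x. dist x a < r4 \<Longrightarrow> \<bar>partial k (partial i f) x - partial k (partial i f) a\<bar> \<le> \<epsilon>"
    using near[OF smooth_on_partial[OF smooth_on_partial[OF f]]] by blast
  obtain r5 where r5: "r5 > 0" "ball a r5 \<subseteq> \<Omega>" using \<Omega> openE by blast
  \<comment> \<open>The entry 1 keeps distances in the rectangle at most 1, where the dyadic
    decomposition of distances starts.\<close>
  define r where "r = Min {r1, r2, r3, r4, r5, 1}"
  have r: "r > 0" "r \<le> r1" "r \<le> r2" "r \<le> r3" "r \<le> r4" "r \<le> r5" "r \<le> 1" using r1 r2 r3 r4 r5 by (auto simp: r_def)
  define \<eta> where "\<eta> = r / 4"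
  have \<eta>: "\<eta> > 0" "4 * \<eta> \<le> r" using r by (auto simp: \<eta>_def)
  have Qd: "dist x a < r" if "x \<in> Q \<eta>" for x using Q_ball[OF \<eta>(2,1)] that by (auto simp: dist_commute)
  have Q\<Omega>: "Q \<eta> \<subseteq> \<Omega>" using Q_ball[OF \<eta>(2,1)] r r5 by (auto simp: subset_iff)
  have "compact (Q \<eta>)" unfolding Q_def by (rule compact_vec_box) simp
  then have bd: "\<exists>b. \<forall>x\<in>Q \<eta>. \<bar>g x\<bar> \<le> b" if "smooth_on \<Omega> g" for g
    using compact_imp_bounded[OF compact_continuous_image[OF continuous_on_subset[OF smooth_on_continuous[OF that] Q\<Omega>]]]
    by (auto simp: bounded_iff)
  note sm = f smooth_on_partial[OF f] smooth_on_partial[OF smooth_on_partial[OF f]]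
    smooth_on_partial[OF smooth_on_partial[OF smooth_on_partial[OF f]]]
  obtain b1 where b1: "\<And>x. x \<in> Q \<eta> \<Longrightarrow> \<bar>f x\<bar> \<le> b1" using bd[OF sm(1)] by blast
  obtain b2 where b2: "\<And>x. x \<in> Q \<eta> \<Longrightarrow> \<bar>partial i f x\<bar> \<le> b2" using bd[OF sm(2)] by blast
  obtain b3 where b3: "\<And>x. x \<in> Q \<eta> \<Longrightarrow> \<bar>partial i (partial i f) x\<bar> \<le> b3" using bd[OF sm(3)] by blast
  obtain b4 where b4: "\<And>x. x \<in> Q \<eta> \<Longrightarrow> \<bar>partial j (partial i f) x\<bar> \<le> b4" using bd[OF sm(3)] by blast
  obtain b5 where b5: "\<And>x. x \<in> Q \<eta> \<Longrightarrow> \<bar>partial k (partial i f) x\<bar> \<le> b5" using bd[OF sm(3)] by blast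
  obtain b6 where b6: "\<And>x. x \<in> Q \<eta> \<Longrightarrow> \<bar>partial j (partial i (partial i f)) x\<bar> \<le> b6" using bd[OF sm(4)] by blast
  obtain b7 where b7: "\<And>x. x \<in> Q \<eta> \<Longrightarrow> \<bar>partial k (partial i (partial i f)) x\<bar> \<le> b7" using bd[OF sm(4)] by blast
  have "a \<in> Q \<eta>" using \<eta> by (simp add: Q_def)
  note nonneg = order_trans[OF abs_ge_zero b1[OF this]] order_trans[OF abs_ge_zero b2[OF this]] order_trans[OF abs_ge_zero b3[OF this]]
    order_trans[OF abs_ge_zero b4[OF this]] order_trans[OF abs_ge_zero b5[OF this]] order_trans[OF abs_ge_zero b6[OF this]]
    order_trans[OF abs_ge_zero b7[OF this]]
  define M where "M = 1 + b1 + b2 + b3 + b4 + b5 + b6 + b7"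
  have M: "M \<ge> 1" using nonneg by (simp add: M_def)
  define \<rho> where "\<rho> = min \<eta> (c / (4 * M))"
  have \<rho>: "\<rho> > 0" "\<rho> \<le> \<eta>" "4 * M * \<rho> \<le> c"
  proof -
    show "\<rho> > 0" "\<rho> \<le> \<eta>" using \<eta> c M by (auto simp: \<rho>_def)
    have "4 * M * \<rho> \<le> 4 * M * (c / (4 * M))" using M by (intro mult_left_mono) (auto simp: \<rho>_def)
    then show "4 * M * \<rho> \<le> c" using M by simp
  qed
  define J where "J = {a $ i - \<rho>..a $ i + \<rho>}"
  define X where "X = {a $ j - \<rho>..a $ j + \<rho>}"
  define Y where "Y = {a $ k - \<rho>..a $ k + \<rho>}"
  have inQ: "emb i j l x \<in> Q \<eta>" if "l \<in> J" "x \<in> X \<times> Y" for l x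
  proof -
    have "emb i j l x $ m \<in> {a $ m - \<eta>..a $ m + \<eta>}" for m
    proof -
      have "m = i \<or> m = j \<or> m = k" using ijk(4) UNIV_I[of m] by auto
      then show ?thesis using that \<rho>(2) by (auto simp: J_def X_def Y_def)
    qed
    then show ?thesis by (simp add: Q_def)
  qed
  have in\<Omega>: "emb i j l x \<in> \<Omega>" if "l \<in> J" "x \<in> X \<times> Y" for l x using inQ[OF that] Q\<Omega> by blast
  have aJ: "a $ i \<in> J" using \<rho> by (simp add: J_def)
  have deriv: "((\<lambda>l. g (emb i j l x)) has_real_derivative partial i g (emb i j l x)) (at l)"
    if "smooth_on \<Omega> g" "l \<in> J" "x \<in> X \<times> Y" for g l x
    using DERIV_emb(1)[OF ijk smooth_on_differentiable[OF that(1)], of l "fst x" "snd x"] in\<Omega>[OF that(2,3)] by simp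
  have lip: "\<bar>g (emb i j l x) - g (emb i j l y)\<bar> \<le> (c1 + c2) * pdist x y"
    if g: "smooth_on \<Omega> g" "\<And>x. x \<in> Q \<eta> \<Longrightarrow> \<bar>partial j g x\<bar> \<le> c1" "\<And>x. x \<in> Q \<eta> \<Longrightarrow> \<bar>partial k g x\<bar> \<le> c2"
      and l: "l \<in> J" and xy: "x \<in> X \<times> Y" "y \<in> X \<times> Y" for g l x y c1 c2
  proof -
    obtain \<xi> \<zeta> where \<xi>: "\<xi> \<in> X \<times> Y" "\<zeta> \<in> X \<times> Y" "g (emb i j l x) - g (emb i j l y) =
        partial j g (emb i j l \<xi>) * (fst x - fst y) + partial k g (emb i j l \<zeta>) * (snd x - snd y)"
      using mean_value_emb[OF ijk g(1) in\<Omega>[OF l] X_def Y_def xy] by blast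
    have "\<bar>g (emb i j l x) - g (emb i j l y)\<bar> \<le> \<bar>partial j g (emb i j l \<xi>)\<bar> * \<bar>fst x - fst y\<bar> + \<bar>partial k g (emb i j l \<zeta>)\<bar> * \<bar>snd x - snd y\<bar>"
      unfolding \<xi>(3) abs_mult[symmetric] by (rule abs_triangle_ineq)
    also have "\<dots> \<le> c1 * pdist x y + c2 * pdist x y"
      using g(2)[OF inQ[OF l \<xi>(1)]] g(3)[OF inQ[OF l \<xi>(2)]] by (intro add_mono mult_mono) (auto simp: pdist_def)
    finally show ?thesis by (simp add: distrib_right)
  qed
  have "transversal_family (\<lambda>l x. f (emb i j l x)) (\<lambda>l x. partial i f (emb i j l x)) (\<lambda>l x. partial i (partial i f) (emb i j l x))
      (X \<times> Y) (a $ i) \<rho> M c"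
  proof (unfold_locales, unfold J_def[symmetric])
    show "\<rho> > 0" "M \<ge> 1" "c > 0" "4 * M * \<rho> \<le> c" by (fact \<rho> M c)+
    fix x assume x: "x \<in> X \<times> Y"
    show "((\<lambda>l. f (emb i j l x)) has_real_derivative partial i f (emb i j l x)) (at l)"
      "((\<lambda>l. partial i f (emb i j l x)) has_real_derivative partial i (partial i f) (emb i j l x)) (at l)" if "l \<in> J" for l
      using deriv[OF sm(1) that x] deriv[OF sm(2) that x] by auto
    show "continuous_on J (\<lambda>l. partial i (partial i f) (emb i j l x))"
      by (rule DERIV_at_imp_continuous_on) (rule deriv[OF sm(3) _ x])
    show "\<bar>f (emb i j l x)\<bar> \<le> M \<and> \<bar>partial i f (emb i j l x)\<bar> \<le> M \<and> \<bar>partial i (partial i f) (emb i j l x)\<bar> \<le> M" if "l \<in> J" for l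
      using b1[OF inQ[OF that x]] b2[OF inQ[OF that x]] b3[OF inQ[OF that x]] nonneg unfolding M_def by linarith
    fix y assume y: "y \<in> X \<times> Y"
    have p0: "pdist x y \<ge> 0" by (rule pdist_nonneg)
    show "\<bar>partial i f (emb i j l x) - partial i f (emb i j l y)\<bar> \<le> M * pdist x y \<and>
      \<bar>partial i (partial i f) (emb i j l x) - partial i (partial i f) (emb i j l y)\<bar> \<le> M * pdist x y" if "l \<in> J" for l
    proof
      have "(b4 + b5) * pdist x y \<le> M * pdist x y" "(b6 + b7) * pdist x y \<le> M * pdist x y"
        using p0 nonneg by (intro mult_right_mono; simp add: M_def)+
      then show "\<bar>partial i f (emb i j l x) - partial i f (emb i j l y)\<bar> \<le> M * pdist x y"
        "\<bar>partial i (partial i f) (emb i j l x) - partial i (partial i f) (emb i j l y)\<bar> \<le> M * pdist x y"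
        using lip[OF sm(2) b4 b5 that x y] lip[OF sm(3) b6 b7 that x y] by linarith+
    qed
    show "c * pdist x y \<le> \<bar>f (emb i j (a $ i) x) - f (emb i j (a $ i) y)\<bar> +
      \<bar>partial i f (emb i j (a $ i) x) - partial i f (emb i j (a $ i) y)\<bar>"
    proof -
      obtain \<xi> \<zeta> where 1: "\<xi> \<in> X \<times> Y" "\<zeta> \<in> X \<times> Y" "f (emb i j (a $ i) x) - f (emb i j (a $ i) y) =
          partial j f (emb i j (a $ i) \<xi>) * (fst x - fst y) + partial k f (emb i j (a $ i) \<zeta>) * (snd x - snd y)"
        using mean_value_emb[OF ijk sm(1) in\<Omega>[OF aJ] X_def Y_def x y] by blast
      obtain \<xi>' \<zeta>' where 2: "\<xi>' \<in> X \<times> Y" "\<zeta>' \<in> X \<times> Y" "partial i f (emb i j (a $ i) x) - partial i f (emb i j (a $ i) y) =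
          partial j (partial i f) (emb i j (a $ i) \<xi>') * (fst x - fst y) + partial k (partial i f) (emb i j (a $ i) \<zeta>') * (snd x - snd y)"
        using mean_value_emb[OF ijk sm(2) in\<Omega>[OF aJ] X_def Y_def x y] by blast
      have d: "dist (emb i j (a $ i) z) a < r" if "z \<in> X \<times> Y" for z by (rule Qd[OF inQ[OF aJ that]])
      show ?thesis unfolding 1(3) 2(3) pdist_def
        by (rule lower; (rule r1 r2 r3 r4, rule less_le_trans[OF d])) (use 1 2 r in auto)
    qed
    show "pdist x y \<le> 1"
    proof -
      have "\<bar>fst x - fst y\<bar> \<le> 2 * \<rho>" "\<bar>snd x - snd y\<bar> \<le> 2 * \<rho>"
        using x y by (auto simp: X_def Y_def abs_le_iff)
      then show ?thesis using \<rho>(2) \<eta>(2) r(7) by (simp add: pdist_def)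
    qed
  qed
  moreover have "{x. \<forall>m. x $ m \<in> {a $ m - \<rho>..a $ m + \<rho>}} \<subseteq> \<Omega>"
  proof -
    have "Q \<rho> \<subseteq> Q \<eta>"
    proof
      fix x assume "x \<in> Q \<rho>"
      then have "a $ m - \<rho> \<le> x $ m \<and> x $ m \<le> a $ m + \<rho>" for m by (simp add: Q_def)
      then have "a $ m - \<eta> \<le> x $ m \<and> x $ m \<le> a $ m + \<eta>" for m using \<rho>(2) by (smt (verit))
      then show "x \<in> Q \<eta>" by (simp add: Q_def)
    qed
    then show ?thesis using Q\<Omega> by (auto simp: Q_def)
  qed
  ultimately show ?thesis using \<rho>(1) unfolding X_def Y_def by blast
qed

end

section \<open>The theorem\<close>

context
  fixes i j k :: 3
  assumes ijk: "i \<noteq> j" "i \<noteq> k" "j \<noteq> k" "UNIV = {i, j, k}"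
begin

text \<open>Thickness gives Frostman weights on the parts of the three sets near \<open>a\<close>.
  The smear of their product is the parameter average of waves, and its energy bound C 4^n (1/2^n)
  powr \<sigma>, with \<sigma> the sum of the exponents, is C 2 powr ((2 - \<sigma>) n). The result
  is a compact piece \<open>S\<close> of the image, which suffices for lower bounds on its
  size.\<close>

lemma exists_spread_image:
  fixes f :: "real ^ 3 \<Rightarrow> real" and a :: "real ^ 3" and A :: "3 \<Rightarrow> real set" and s :: "3 \<Rightarrow> real"
  assumes \<Omega>: "open \<Omega>" "a \<in> \<Omega>" and f: "smooth_on \<Omega> f"
    and det: "partial j f a * partial k (partial i f) a - partial k f a * partial j (partial i f) a \<noteq> 0"
    and A: "\<And>m. compact (A m)" "\<And>m. thick_at (s m) (A m) (a $ m)" and s: "\<And>m. 0 < s m" "\<And>m. s m < 1"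
  shows "\<exists>S. compact S \<and> S \<subseteq> f ` {x. \<forall>m. x $ m \<in> A m} \<and> spread (2 - (s i + s j + s k)) S"
proof -
  obtain \<rho> M c where \<rho>: "\<rho> > 0" and box: "{x. \<forall>m. x $ m \<in> {a $ m - \<rho>..a $ m + \<rho>}} \<subseteq> \<Omega>" and
    fam: "transversal_family (\<lambda>l x. f (emb i j l x)) (\<lambda>l x. partial i f (emb i j l x)) (\<lambda>l x. partial i (partial i f) (emb i j l x))
      ({a $ j - \<rho>..a $ j + \<rho>} \<times> {a $ k - \<rho>..a $ k + \<rho>}) (a $ i) \<rho> M c"
    using exists_transversal_family[OF ijk \<Omega> f det] by blast
  interpret T: transversal_family "\<lambda>l x. f (emb i j l x)" "\<lambda>l x. partial i f (emb i j l x)" "\<lambda>l x. partial i (partial i f) (emb i j l x)"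
    "{a $ j - \<rho>..a $ j + \<rho>} \<times> {a $ k - \<rho>..a $ k + \<rho>}" "a $ i" \<rho> M c by (rule fam)
  \<comment> \<open>The radius \<rho>/4 is the one demanded of the parameter weights in
    \<open>averaged_energy_estimate\<close>; for uniformity it is imposed on all three sets.\<close>
  define K where "K = (\<lambda>m. A m \<inter> {a $ m - \<rho>/4..a $ m + \<rho>/4})"
  have K: "compact (K m)" "\<not> content_null (s m) (K m)" "bounded (K m)" for m
  proof -
    show "compact (K m)" unfolding K_def by (intro compact_Int_closed A closed_atLeastAtMost)
    then show "bounded (K m)" by (rule compact_imp_bounded)
    show "\<not> content_null (s m) (K m)" unfolding K_def using A(2)[of m] \<rho> by (simp add: thick_at_def)
  qed
  have Kin: "K m \<subseteq> {a $ m - \<rho>/4..a $ m + \<rho>/4}" "K m \<subseteq> {a $ m - \<rho>..a $ m + \<rho>}" for m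
    using \<rho> by (auto simp: K_def)
  have "\<exists>c>0. \<forall>N. \<exists>P w. P \<subseteq> K m \<and> frostman (s m) N P w \<and> c \<le> sum w P" for m
    by (rule exists_frostman[OF s(1) K(3) K(2)])
  then obtain d where d: "\<And>m. d m > 0" and frost: "\<And>m N. \<exists>P w. P \<subseteq> K m \<and> frostman (s m) N P w \<and> d m \<le> sum w P" by metis
  define S where "S = f ` {x. \<forall>m. x $ m \<in> K m}"
  have Kbox: "{x. \<forall>m. x $ m \<in> K m} \<subseteq> \<Omega>" using Kin(2) box by blast
  have "compact S" unfolding S_def
    by (intro compact_continuous_image continuous_on_subset[OF smooth_on_continuous[OF f] Kbox] compact_vec_box K(1))
  moreover have "S \<subseteq> f ` {x. \<forall>m. x $ m \<in> A m}" unfolding S_def K_def by auto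
  moreover have "spread (2 - (s i + s j + s k)) S"
  proof -
    have "s j + s k < 2" using s(2)[of j] s(2)[of k] by simp
    then obtain C where C: "C \<ge> 0" and est: "\<forall>N Q v P w n. frostman (s i) N Q v \<longrightarrow> Q \<subseteq> {a $ i - \<rho>/4..a $ i + \<rho>/4} \<longrightarrow> plane_frostman (s j + s k) 9 N P w \<longrightarrow>
        P \<subseteq> {a $ j - \<rho>..a $ j + \<rho>} \<times> {a $ k - \<rho>..a $ k + \<rho>} \<longrightarrow> n \<le> N \<longrightarrow> 1/2^n \<le> \<rho>/4 \<longrightarrow>
        integral {-(M+1)..M+1} (\<lambda>t. (\<Sum>l\<in>Q. v l * T.wave wav (\<lambda>_ _. 1) P w n l t)^2) \<le>
          C * (2^n)^2 * (1/2^n) powr (s i + (s j + s k))"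
      using T.averaged_energy_estimate[of "s j + s k" 9 "s i"] by auto
    have "\<rho>/4 > 0" using \<rho> by simp
    then obtain n0 where "(1/2)^n0 < \<rho>/4" using real_arch_pow_inv[of "\<rho>/4" "1/2"] by auto
    then have n0: "1/2^n \<le> \<rho>/4" if "n0 \<le> n" for n
    proof -
      have "(1/2::real)^n \<le> (1/2)^n0" using that by (rule power_decreasing) auto
      then have "(1/2::real)^n \<le> \<rho>/4" using \<open>(1/2)^n0 < \<rho>/4\<close> by linarith
      then show ?thesis by (simp add: power_divide)
    qed
    have Sbd: "S \<subseteq> {-((M+1)-1)..(M+1)-1}"
    proof
      fix y assume "y \<in> S"
      then obtain x where x: "y = f x" "\<And>m. x $ m \<in> K m" by (auto simp: S_def)
      have "emb i j (x $ i) (x $ j, x $ k) = x" using ijk by (simp add: vec3_eq_iff[OF ijk] emb_nth[OF ijk])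
      moreover have x': "x $ m \<in> {a $ m - \<rho>..a $ m + \<rho>}" for m using x(2) Kin(2) by blast
      have "(x $ j, x $ k) \<in> {a $ j - \<rho>..a $ j + \<rho>} \<times> {a $ k - \<rho>..a $ k + \<rho>}" using x' by blast
      then have "\<bar>f (emb i j (x $ i) (x $ j, x $ k))\<bar> \<le> M" using T.bound[OF x'] by blast
      ultimately have "\<bar>y\<bar> \<le> M" by (simp add: x(1))
      then show "y \<in> {-((M+1)-1)..(M+1)-1}" by (simp add: abs_le_iff)
    qed
    have ex: "\<exists>(I :: (real \<times> real \<times> real) set) q v. scale_weights (2 - (s i + s j + s k)) (d i * d j * d k) C n0 (M+1) S N I q v" for N
    proof -
      obtain P1 w1 where 1: "P1 \<subseteq> K i" "frostman (s i) N P1 w1" "d i \<le> sum w1 P1" using frost by blast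
      obtain P2 w2 where 2: "P2 \<subseteq> K j" "frostman (s j) N P2 w2" "d j \<le> sum w2 P2" using frost by blast
      obtain P3 w3 where 3: "P3 \<subseteq> K k" "frostman (s k) N P3 w3" "d k \<le> sum w3 P3" using frost by blast
      define w where "w = (\<lambda>x :: real \<times> real. w2 (fst x) * w3 (snd x))"
      define v where "v = (\<lambda>z :: real \<times> real \<times> real. w1 (fst z) * w (snd z))"
      define q where "q = (\<lambda>z :: real \<times> real \<times> real. f (emb i j (fst z) (snd z)))"
      define I where "I = P1 \<times> (P2 \<times> P3)"
      have fin: "finite P1" "finite P2" "finite P3" and pos: "\<And>x. 0 \<le> w1 x" "\<And>x. 0 \<le> w2 x" "\<And>x. 0 \<le> w3 x"
        and le1: "sum w1 P1 \<le> 1" "sum w2 P2 \<le> 1" "sum w3 P3 \<le> 1"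
        using 1(2) 2(2) 3(2) by (auto simp: frostman_def)
      have pf: "plane_frostman (s j + s k) 9 N (P2 \<times> P3) w"
        unfolding w_def by (rule plane_frostman_Times[OF 2(2) 3(2)])
      have sumw: "sum w (P2 \<times> P3) = sum w2 P2 * sum w3 P3"
        by (simp add: w_def sum_product sum.cartesian_product case_prod_beta)
      have sumv: "sum v I = sum w1 P1 * (sum w2 P2 * sum w3 P3)"
        unfolding sumw[symmetric] by (simp add: v_def I_def sum_product sum.cartesian_product case_prod_beta)
      have low: "d i * (d j * d k) \<le> sum v I"
        unfolding sumv using 1(3) 2(3) 3(3) d pos
        by (intro mult_mono mult_nonneg_nonneg sum_nonneg less_imp_le[OF d]) auto
      have up: "sum v I \<le> 1"
        unfolding sumv using le1 pos by (intro mult_le_one mult_nonneg_nonneg sum_nonneg) auto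
      have qv: "q z \<in> S \<and> 0 \<le> v z" if "z \<in> I" for z
      proof
        have "emb i j (fst z) (snd z) $ m \<in> K m" for m
        proof -
          have "m = i \<or> m = j \<or> m = k" using ijk(4) UNIV_I[of m] by auto
          then show ?thesis using that 1(1) 2(1) 3(1) by (auto simp: I_def emb_nth[OF ijk])
        qed
        then show "q z \<in> S" by (auto simp: q_def S_def)
        show "0 \<le> v z" by (simp add: v_def w_def pos)
      qed
      have en: "integral {-(M+1)..M+1} (\<lambda>t. (smear wav I q v n t)^2) \<le> C * 2 powr ((2 - (s i + s j + s k)) * real n)"
        if n: "n0 \<le> n" "n \<le> N" for n
      proof -
        have eq: "smear wav I q v n t = (\<Sum>l\<in>P1. w1 l * T.wave wav (\<lambda>_ _. 1) (P2 \<times> P3) w n l t)" for t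
          unfolding smear_def T.wave_def sum_distrib_left I_def
          by (subst sum.cartesian_product) (auto simp: v_def q_def case_prod_beta mult_ac intro!: sum.cong)
        have "P1 \<subseteq> {a $ i - \<rho>/4..a $ i + \<rho>/4}" using 1(1) Kin(1) by blast
        moreover have "P2 \<times> P3 \<subseteq> {a $ j - \<rho>..a $ j + \<rho>} \<times> {a $ k - \<rho>..a $ k + \<rho>}"
          using 2(1) 3(1) Kin(2) by blast
        ultimately have "integral {-(M+1)..M+1} (\<lambda>t. (smear wav I q v n t)^2) \<le> C * (2^n)^2 * (1/2^n) powr (s i + (s j + s k))"
          unfolding eq using est 1(2) pf n n0[OF n(1)] by blast
        also have "(2^n)^2 * (1/2^n) powr (s i + (s j + s k)) = 2 powr ((2 - (s i + s j + s k)) * real n)"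
        proof -
          have 1: "(1/2^n :: real) = 2 powr (- real n)" by (simp add: powr_minus powr_realpow divide_inverse)
          have 2: "((2::real)^n)^2 = 2 powr (2 * real n)" by (simp add: powr_realpow[symmetric] powr_powr mult.commute power2_eq_square powr_add[symmetric])
          show ?thesis unfolding 1 2 powr_powr powr_add[symmetric] by (simp add: algebra_simps)
        qed
        then have "C * (2^n)^2 * (1/2^n) powr (s i + (s j + s k)) = C * 2 powr ((2 - (s i + s j + s k)) * real n)"
          by (simp only: mult.assoc)
        finally show ?thesis .
      qed
      have "finite I" using fin by (simp add: I_def)
      moreover have "d i * d j * d k \<le> sum v I" using low by (simp only: mult.assoc)
      ultimately show ?thesis unfolding scale_weights_def using qv up en by blast
    qed
    have dpos: "0 < d i * d j * d k" using d by simp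
    show ?thesis unfolding spread_def
      by (rule exI[of _ "d i * d j * d k"], rule conjI[OF dpos], rule exI[of _ C], rule conjI[OF C], rule exI[of _ n0],
        rule exI[of _ "M+1"], rule conjI[OF Sbd], rule allI, rule ex)
  qed
  ultimately show ?thesis by blast
qed

end

lemma indices3: "(1::3) \<noteq> 2" "(1::3) \<noteq> 3" "(2::3) \<noteq> 3" "(2::3) \<noteq> 1" "(3::3) \<noteq> 1" "(3::3) \<noteq> 2"
  by simp_all

text \<open>The determinants required by \<open>exists_spread_image\<close> are, up to sign and the order of the
  mixed derivatives, \<open>G 1\<close>, \<open>G 2\<close> and \<open>G 3\<close>; the coordinate singled out as the parameter is the
  index of \<open>G\<close>.\<close>

lemma exists_spread_image_G:
  fixes f :: "real ^ 3 \<Rightarrow> real" and a :: "real ^ 3" and A :: "3 \<Rightarrow> real set" and s :: "3 \<Rightarrow> real"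
  assumes \<Omega>: "open \<Omega>" "a \<in> \<Omega>" and f: "smooth_on \<Omega> f" and G: "G m0 f a \<noteq> 0"
    and A: "\<And>m. compact (A m)" "\<And>m. thick_at (s m) (A m) (a $ m)" and s: "\<And>m. 0 < s m" "\<And>m. s m < 1"
  shows "\<exists>S. compact S \<and> S \<subseteq> f ` {x. \<forall>m. x $ m \<in> A m} \<and> spread (2 - (s 1 + s 2 + s 3)) S"
proof -
  note comm = partial_commute[OF \<Omega>(1) f \<Omega>(2)]
  have U: "UNIV = {1, 2, 3 :: 3}" "UNIV = {2, 1, 3 :: 3}" "UNIV = {3, 1, 2 :: 3}" using UNIV_3 by auto
  consider "m0 = 1" | "m0 = 2" | "m0 = 3" using exhaust_3 by blast
  then show ?thesis
  proof cases
    case 1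
    then have "partial 2 f a * partial 3 (partial 1 f) a - partial 3 f a * partial 2 (partial 1 f) a \<noteq> 0"
      using G comm[of 3 1] comm[of 2 1] by (simp add: G_def mult.commute)
    from exists_spread_image[OF indices3(1,2,3) U(1) \<Omega> f this A s] show ?thesis by simp
  next
    case 2
    then have "partial 1 f a * partial 3 (partial 2 f) a - partial 3 f a * partial 1 (partial 2 f) a \<noteq> 0"
      using G comm[of 3 2] by (simp add: G_def indices3 mult.commute)
    from exists_spread_image[OF indices3(4,3,2) U(2) \<Omega> f this A s] show ?thesis by (simp add: add_ac)
  next
    case 3
    then have "partial 1 f a * partial 2 (partial 3 f) a - partial 2 f a * partial 1 (partial 3 f) a \<noteq> 0"
      using G by (simp add: G_def indices3 mult.commute)
    from exists_spread_image[OF indices3(5,6,1) U(3) \<Omega> f this A s] show ?thesis by (simp add: add_ac)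
  qed
qed

section \<open>Leaving the zero set of \<open>G\<close> through nearby thick points\<close>

lemma differentiable_G:
  assumes "smooth_on \<Omega> f" "x \<in> \<Omega>"
  shows "G m f differentiable (at x)"
proof -
  note d1 = smooth_on_differentiable[OF smooth_on_partial[OF assms(1)] assms(2)]
  note d2 = smooth_on_differentiable[OF smooth_on_partial[OF smooth_on_partial[OF assms(1)]] assms(2)]
  consider "m = 1" | "m = 2" | "m = 3" using exhaust_3 by blast
  then show ?thesis
    by cases (auto simp: G_def[abs_def] indices3 intro!: differentiable_diff differentiable_mult d1 d2)
qed

lemma DERIV_nonzero_isolated:
  fixes \<phi> :: "real \<Rightarrow> real"
  assumes "(\<phi> has_real_derivative d) (at x)" "d \<noteq> 0" "\<phi> x = 0"
  shows "\<exists>\<epsilon>>0. \<forall>y. y \<noteq> x \<longrightarrow> \<bar>y - x\<bar> \<le> \<epsilon> \<longrightarrow> \<phi> y \<noteq> 0"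
proof -
  have "((\<lambda>y. (\<phi> y - \<phi> x) / (y - x)) \<longlongrightarrow> d) (at x)"
    using assms(1) by (simp add: has_field_derivative_iff)
  then have "\<forall>\<^sub>F y in at x. (\<phi> y - \<phi> x) / (y - x) \<noteq> 0" using assms(2) by (rule tendsto_imp_eventually_ne)
  then obtain e where e: "e > 0" "\<And>y. y \<noteq> x \<Longrightarrow> dist y x < e \<Longrightarrow> (\<phi> y - \<phi> x) / (y - x) \<noteq> 0"
    unfolding eventually_at by blast
  have "\<phi> y \<noteq> 0" if "y \<noteq> x" "\<bar>y - x\<bar> \<le> e/2" for y
    using e(2)[of y] that e(1) assms(3) by (auto simp: dist_real_def)
  then show ?thesis using e(1) by (intro exI[of _ "e/2"]) auto
qed

text \<open>Thickness is a condition on each coordinate separately, so replacing a single coordinate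
  by a nearby thick value stays in the product. Along a coordinate line in which
  \<open>G m0 f\<close> has nonzero derivative its zero at \<open>a\<close> is isolated.\<close>

lemma exists_thick_point_G_nonzero:
  fixes f :: "real ^ 3 \<Rightarrow> real" and A :: "3 \<Rightarrow> real set" and s :: "3 \<Rightarrow> real"
  assumes f: "smooth_on \<Omega> f" and grad: "\<And>x. x \<in> \<Omega> \<Longrightarrow> grad (G m0 f) x \<noteq> 0"
    and sub: "{x. \<forall>m. x $ m \<in> A m} \<subseteq> \<Omega>"
    and A: "\<And>m. compact (A m)" and s: "\<And>m. 0 < s m" and a: "\<And>m. thick_at (s m) (A m) (a $ m)"
  shows "\<exists>b. (\<forall>m. thick_at (s m) (A m) (b $ m)) \<and> G m0 f b \<noteq> 0"
proof (cases "G m0 f a = 0")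
  case False then show ?thesis using a by blast
next
  case True
  have "a \<in> \<Omega>" using a sub by (auto simp: thick_at_def)
  have "\<exists>m. partial m (G m0 f) a \<noteq> 0"
  proof (rule ccontr)
    assume "\<not> ?thesis"
    then have "grad (G m0 f) a = 0" by (simp add: grad_def vec_eq_iff)
    then show False using grad[OF \<open>a \<in> \<Omega>\<close>] by blast
  qed
  then obtain m where m: "partial m (G m0 f) a \<noteq> 0" by blast
  have "((\<lambda>t. G m0 f (a + t *\<^sub>R axis m 1)) has_real_derivative partial m (G m0 f) a) (at 0)"
    using DERIV_along_axis[of "G m0 f" a 0 m] differentiable_G[OF f \<open>a \<in> \<Omega>\<close>] by simp
  from DERIV_nonzero_isolated[OF this m] True obtain \<epsilon> where \<epsilon>: "\<epsilon> > 0"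
    "\<And>t. t \<noteq> 0 \<Longrightarrow> \<bar>t\<bar> \<le> \<epsilon> \<Longrightarrow> G m0 f (a + t *\<^sub>R axis m 1) \<noteq> 0" by auto
  obtain c where c: "thick_at (s m) (A m) c" "c \<noteq> a $ m" "\<bar>c - a $ m\<bar> \<le> \<epsilon>"
    using thick_at_accumulates[OF A a s \<epsilon>(1)] by blast
  define b where "b = a + (c - a $ m) *\<^sub>R axis m 1"
  have "b $ n = (if n = m then c else a $ n)" for n by (simp add: b_def axis_def)
  then have "thick_at (s n) (A n) (b $ n)" for n using a c(1) by simp
  moreover have "G m0 f b \<noteq> 0" unfolding b_def using c by (intro \<epsilon>(2)) auto
  ultimately show ?thesis by blast
qed

text \<open>The dimensions are at most 1, hence finite, and each is lowered by the same \<theta>. As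
  4 \<theta> is at most each dimension and at most the excess over \<tau>, losing 3 \<theta> in
  total is affordable.\<close>

lemma exists_exponents:
  fixes D :: "3 \<Rightarrow> ennreal"
  assumes D: "\<And>m. 0 < D m" "\<And>m. D m \<le> 1" and \<tau>: "0 \<le> \<tau>" "D 1 + D 2 + D 3 > ennreal \<tau>"
  shows "\<exists>s. (\<forall>m. 0 < s m \<and> s m < 1 \<and> ennreal (s m) < D m) \<and> \<tau> < s 1 + s 2 + s (3::3)"
proof -
  define r where "r = (\<lambda>m. enn2real (D m))"
  have "D m < top" for m using le_less_trans[OF D(2)] by (simp add: ennreal_one_less_top)
  then have Dr: "D m = ennreal (r m)" for m by (simp add: r_def)
  have r: "0 < r m" "r m \<le> 1" for m using D[of m] unfolding Dr by (auto simp: ennreal_less_zero_iff)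
  have "ennreal (r 1 + r 2 + r 3) = ennreal (r 1) + ennreal (r 2) + ennreal (r 3)"
    using r by (simp add: ennreal_plus less_imp_le)
  then have "ennreal \<tau> < ennreal (r 1 + r 2 + r 3)" using \<tau>(2) unfolding Dr by (simp only:)
  then have gap: "\<tau> < r 1 + r 2 + r 3" using \<tau>(1) by (simp add: ennreal_less_iff)
  define \<theta> where "\<theta> = min (Min {r 1, r 2, r 3}) (r 1 + r 2 + r 3 - \<tau>) / 4"
  have \<theta>: "\<theta> > 0" "4 * \<theta> \<le> r 1" "4 * \<theta> \<le> r 2" "4 * \<theta> \<le> r 3" "4 * \<theta> \<le> r 1 + r 2 + r 3 - \<tau>"
    using r gap by (auto simp: \<theta>_def)
  have \<theta>r: "4 * \<theta> \<le> r m" for m using \<theta> exhaust_3[of m] by auto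
  show ?thesis
  proof (intro exI[of _ "\<lambda>m. r m - \<theta>"] conjI allI)
    fix m
    show "0 < r m - \<theta>" using \<theta>r[of m] \<theta>(1) by linarith
    then show "ennreal (r m - \<theta>) < D m" unfolding Dr using \<theta>(1) by (simp add: ennreal_less_iff)
    show "r m - \<theta> < 1" using r(2)[of m] \<theta>(1) by linarith
  next
    show "\<tau> < (r 1 - \<theta>) + (r 2 - \<theta>) + (r 3 - \<theta>)" using \<theta>(1,5) by linarith
  qed
qed

theorem theorem5p1:
  fixes \<Omega> :: "(real ^ 3) set" and f :: "real ^ 3 \<Rightarrow> real" and A1 A2 A3 :: "real set"
  assumes "open \<Omega>" and "smooth_on \<Omega> f"
    and "compact A1" and "compact A2" and "compact A3"
    and "hausdorff_dim A1 > 0" and "hausdorff_dim A2 > 0" and "hausdorff_dim A3 > 0"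
  shows "(box3 A1 A2 A3 \<subseteq> \<Omega> - Z3 \<Omega> f \<longrightarrow>
            (\<forall>u::real. 0 < u \<and> u < 1 \<and>
               hausdorff_dim A1 + hausdorff_dim A2 + hausdorff_dim A3 > ennreal (1 + u) \<longrightarrow>
               hausdorff_dim (Delta f A1 A2 A3) \<ge> ennreal u) \<and>
            (hausdorff_dim A1 + hausdorff_dim A2 + hausdorff_dim A3 > 2 \<longrightarrow>
               emeasure lebesgue (Delta f A1 A2 A3) > 0)) \<and>
         ((\<exists>i0. \<forall>x\<in>\<Omega>. grad (G i0 f) x \<noteq> 0) \<longrightarrow>
            box3 A1 A2 A3 \<subseteq> \<Omega> \<longrightarrow>
            hausdorff_dim A1 + hausdorff_dim A2 + hausdorff_dim A3 > 2 \<longrightarrow>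
            emeasure lebesgue (Delta f A1 A2 A3) > 0)"
proof -
  note \<Omega> = assms(1) and f = assms(2)
  define A where "A = (\<lambda>m::3. if m = 1 then A1 else if m = 2 then A2 else A3)"
  have A123: "A 1 = A1" "A 2 = A2" "A 3 = A3" by (simp_all add: A_def indices3)
  have A: "compact (A m)" for m using assms(3-5) by (simp add: A_def)
  have dimA: "0 < hausdorff_dim (A m)" "hausdorff_dim (A m) \<le> 1" for m
    using assms(6-8) hausdorff_dim_le_1[OF compact_imp_bounded[OF A]] by (auto simp: A_def)
  have box: "box3 A1 A2 A3 = {x. \<forall>m. x $ m \<in> A m}"
    by (simp add: box3_def forall_3 A123)
  have thick: "\<exists>a :: real ^ 3. \<forall>m. thick_at (s m) (A m) (a $ m)"
    if s: "\<And>m. 0 < s m" "\<And>m. ennreal (s m) < hausdorff_dim (A m)" for s :: "3 \<Rightarrow> real"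
  proof -
    have "\<exists>a\<in>A m. thick_at (s m) (A m) a" for m
      by (rule exists_thick[OF A subset_refl hausdorff_dim_gtD[OF s(2,1)] s(1)])
    then obtain a where a: "\<And>m. thick_at (s m) (A m) (a m)" by metis
    show ?thesis by (rule exI[of _ "\<chi> m. a m"]) (simp add: a)
  qed
  have pos: "emeasure lebesgue (Delta f A1 A2 A3) > 0"
    if S: "compact S" "S \<subseteq> f ` {x. \<forall>m. x $ m \<in> A m}" "spread \<gamma> S" "\<gamma> < 0" and sub: "box3 A1 A2 A3 \<subseteq> \<Omega>" for S \<gamma>
  proof -
    \<comment> \<open>\<open>emeasure\<close> is 0 by default on nonmeasurable sets, so positivity
      passes from \<open>S\<close> to the image only once the image is known to be measurable, here
      through compactness.\<close>
    have "compact (Delta f A1 A2 A3)" unfolding Delta_def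
      using sub unfolding box
      by (intro compact_continuous_image continuous_on_subset[OF smooth_on_continuous[OF f]] compact_vec_box A)
    then have "Delta f A1 A2 A3 \<in> sets lebesgue" by (intro lmeasurable_compact[THEN fmeasurableD])
    moreover have "S \<subseteq> Delta f A1 A2 A3" using S(2) by (simp add: Delta_def box)
    ultimately have "emeasure lebesgue S \<le> emeasure lebesgue (Delta f A1 A2 A3)" by (intro emeasure_mono)
    then show ?thesis using spread_imp_positive_measure[OF S(1,3,4)] by (rule less_le_trans[rotated])
  qed
  have two: "\<exists>s. (\<forall>m. 0 < s m \<and> s m < 1 \<and> ennreal (s m) < hausdorff_dim (A m)) \<and> 2 < s 1 + s 2 + s 3"
    if "hausdorff_dim A1 + hausdorff_dim A2 + hausdorff_dim A3 > 2"
    using exists_exponents[of "\<lambda>m. hausdorff_dim (A m)" 2] dimA that by (simp add: A123)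
  have spread_image: "\<exists>S. compact S \<and> S \<subseteq> f ` {x. \<forall>m. x $ m \<in> A m} \<and> spread (2 - (s 1 + s 2 + s 3)) S"
    if sub: "box3 A1 A2 A3 \<subseteq> \<Omega> - Z3 \<Omega> f" and s: "\<And>m. 0 < s m" "\<And>m. s m < 1" "\<And>m. ennreal (s m) < hausdorff_dim (A m)" for s
  proof -
    obtain a where a: "\<And>m. thick_at (s m) (A m) (a $ m)" using thick[OF s(1,3)] by blast
    \<comment> \<open>A thick point lies in the product, so some \<open>G m0\<close> is nonzero
      there; the index \<open>m0\<close> decides which coordinate becomes the parameter.\<close>
    then have "a \<in> \<Omega> - Z3 \<Omega> f" using sub unfolding box thick_at_def by blast
    then have "a \<in> \<Omega>" "\<exists>m0. G m0 f a \<noteq> 0" unfolding Z3_def by blast+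
    then show ?thesis using exists_spread_image_G[OF \<Omega> _ f _ A a s(1,2)] by blast
  qed
  show ?thesis
  proof (intro conjI impI allI)
    fix u :: real
    assume sub: "box3 A1 A2 A3 \<subseteq> \<Omega> - Z3 \<Omega> f"
      and u: "0 < u \<and> u < 1 \<and> hausdorff_dim A1 + hausdorff_dim A2 + hausdorff_dim A3 > ennreal (1 + u)"
    then have "ennreal (1 + u) < hausdorff_dim (A 1) + hausdorff_dim (A 2) + hausdorff_dim (A 3)" by (simp only: A123)
    then have "\<exists>s. (\<forall>m. 0 < s m \<and> s m < 1 \<and> ennreal (s m) < hausdorff_dim (A m)) \<and> 1 + u < s 1 + s 2 + s 3"
      by (rule exists_exponents[OF dimA, rotated]) (use u in simp)
    then obtain s where s: "\<And>m. 0 < s m" "\<And>m. s m < 1" "\<And>m. ennreal (s m) < hausdorff_dim (A m)" "1 + u < s 1 + s 2 + s 3"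
      by blast
    obtain S where S: "compact S" "S \<subseteq> f ` {x. \<forall>m. x $ m \<in> A m}" "spread (2 - (s 1 + s 2 + s 3)) S"
      using spread_image[OF sub s(1-3)] by blast
    show "hausdorff_dim (Delta f A1 A2 A3) \<ge> ennreal u"
    proof (rule hausdorff_dim_geI)
      fix t assume t: "0 < t" "t < u"
      \<comment> \<open>Here 2 - (s 1 + s 2 + s 3) < 1 - u < 1 - t.\<close>
      have "\<not> content_null t S"
        by (rule spread_imp_not_content_null[OF S(1,3)]) (use t u s(4) in auto)
      then show "\<not> content_null t (Delta f A1 A2 A3)"
        using content_null_subset S(2) unfolding Delta_def box by blast
    qed
  next
    assume sub: "box3 A1 A2 A3 \<subseteq> \<Omega> - Z3 \<Omega> f" and dims: "hausdorff_dim A1 + hausdorff_dim A2 + hausdorff_dim A3 > 2"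
    obtain s where s: "\<And>m. 0 < s m" "\<And>m. s m < 1" "\<And>m. ennreal (s m) < hausdorff_dim (A m)" "2 < s 1 + s 2 + s 3"
      using two[OF dims] by blast
    obtain S where S: "compact S" "S \<subseteq> f ` {x. \<forall>m. x $ m \<in> A m}" "spread (2 - (s 1 + s 2 + s 3)) S"
      using spread_image[OF sub s(1-3)] by blast
    show "emeasure lebesgue (Delta f A1 A2 A3) > 0" by (rule pos[OF S]) (use s(4) sub in auto)
  next
    assume "\<exists>i0. \<forall>x\<in>\<Omega>. grad (G i0 f) x \<noteq> 0" and sub: "box3 A1 A2 A3 \<subseteq> \<Omega>"
      and dims: "hausdorff_dim A1 + hausdorff_dim A2 + hausdorff_dim A3 > 2"
    then obtain m0 where m0: "\<And>x. x \<in> \<Omega> \<Longrightarrow> grad (G m0 f) x \<noteq> 0" by blast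
    obtain s where s: "\<And>m. 0 < s m" "\<And>m. s m < 1" "\<And>m. ennreal (s m) < hausdorff_dim (A m)" "2 < s 1 + s 2 + s 3"
      using two[OF dims] by blast
    obtain a where a: "\<And>m. thick_at (s m) (A m) (a $ m)" using thick[OF s(1,3)] by blast
    obtain b where b: "\<And>m. thick_at (s m) (A m) (b $ m)" "G m0 f b \<noteq> 0"
      using exists_thick_point_G_nonzero[OF f m0 sub[unfolded box] A s(1) a] by blast
    have "b \<in> \<Omega>" using b(1) sub unfolding box by (auto simp: thick_at_def)
    from exists_spread_image_G[OF \<Omega> this f b(2) A b(1) s(1,2)]
    obtain S where S: "compact S" "S \<subseteq> f ` {x. \<forall>m. x $ m \<in> A m}" "spread (2 - (s 1 + s 2 + s 3)) S" by blast
    show "emeasure lebesgue (Delta f A1 A2 A3) > 0" by (rule pos[OF S _ sub]) (use s(4) in simp)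
  qed
qed

end
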